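(* Let $s\le0$, let $P$ be an $r\times r$ matrix whose entries are $2\pi$-periodic measurable functions on $\mathbb{R}^d$, and let $\Phi$ be a vector with $r$ entries in $W_2^s(\mathbb{R}^d)$ satisfying the refinement equation $$\widehat\Phi(2\cdot)=P\widehat\Phi.$$ Fix $\rho\in(0,\pi)$ and let $A=\{\omega\in\mathbb{R}^d:\tfrac12\rho<|\omega|\le\rho\}$. Assume that there exists $f\in S_\Phi(W_2^s)$ with the following properties: (1) $|\widehat f|$ is bounded above as well as away from zero on $A$. (2) The numbers $$\lambda_m=\Big\|\sum_{\alpha\in2^m(2\pi\mathbb{Z}^d\setminus\{0\})}|\widehat f(\cdot+\alpha)|^2\Big\|_{L_\infty(A)},\qquad m\in\mathbb{Z}_+,$$ satisfy $\lambda_m=O(2^{-2mk})$ for some positive $k$. Then $S_\Phi(W_2^s)$ provides approximation order $k$.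
   Context: $\widehat f(\omega)=\int f(x)e^{-i\omega\cdot x}dx$; $|\cdot|$ is the Euclidean norm. "$2\pi$-periodic" means invariant under translation by $2\pi\mathbb{Z}^d$. $W_2^s=W_2^s(\mathbb{R}^d)$ is the space of tempered distributions $f$ with $\widehat f$ locally in $L_2(\mathbb{R}^d)$ and $\|f\|_{W_2^s}^2=\int(1+|\omega|)^{2s}|\widehat f(\omega)|^2d\omega<\infty$. $S_\Phi(W_2^s)$ is the smallest closed subspace of $W_2^s$ containing the entries of $\Phi$ and invariant under integer translations. For $k>s$, "$S_\Phi(W_2^s)$ provides approximation order $k$" means: with $S^h=\{g(\cdot/h):g\in S_\Phi(W_2^s)\}$, there is a constant $C$ such that $\inf_{g\in S^h}\|f-g\|_{W_2^s}\le Ch^{k-s}\|f\|_{W_2^k}$ for every $f\in W_2^k(\mathbb{R}^d)$ and every $h>0$. *)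

theory Defs
  imports "HOL-Analysis.Analysis" "HOL-Probability.Essential_Supremum"
begin

text \<open>
  The Schwartz space. Iterated partial derivatives are indexed by lists of standard
  basis vectors. A function is \<open>C\<^sup>\<infinity>\<close> iff every iterated partial derivative is
  (Frechet) differentiable everywhere: this already yields continuity of all of them.
\<close>

definition partial_deriv :: "real^'d \<Rightarrow> (real^'d \<Rightarrow> complex) \<Rightarrow> real^'d \<Rightarrow> complex"
  where "partial_deriv b \<phi> x = frechet_derivative \<phi> (at x) b"

definition iter_deriv :: "(real^'d) list \<Rightarrow> (real^'d \<Rightarrow> complex) \<Rightarrow> real^'d \<Rightarrow> complex"
  where "iter_deriv bs \<phi> = foldr partial_deriv bs \<phi>"

definition smooth :: "(real^'d \<Rightarrow> complex) \<Rightarrow> bool"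
  where "smooth \<phi> \<longleftrightarrow>
    (\<forall>bs x. set bs \<subseteq> Basis \<longrightarrow> iter_deriv bs \<phi> differentiable (at x))"

definition schwartz :: "(real^'d \<Rightarrow> complex) set"
  where "schwartz = {\<phi>. smooth \<phi> \<and>
    (\<forall>N bs. set bs \<subseteq> Basis \<longrightarrow>
      bounded (range (\<lambda>x. (1 + norm x) ^ N *\<^sub>R iter_deriv bs \<phi> x)))}"

definition schwartz_seminorm :: "nat \<Rightarrow> (real^'d \<Rightarrow> complex) \<Rightarrow> real"
  where "schwartz_seminorm N \<phi> =
    (SUP (x, bs) \<in> UNIV \<times> {bs. set bs \<subseteq> Basis \<and> length bs \<le> N}.
       (1 + norm x) ^ N * cmod (iter_deriv bs \<phi> x))"

definition smooth_compact_support :: "(real^'d \<Rightarrow> complex) set"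
  where "smooth_compact_support =
    {\<phi>. smooth \<phi> \<and> (\<exists>K. compact K \<and> (\<forall>x. x \<notin> K \<longrightarrow> \<phi> x = 0))}"

text \<open>
  Tempered distributions are the continuous linear functionals on the Schwartz space.
  They are encoded as total functions; the value 0 is prescribed outside the Schwartz
  space so that equality of functions is equality of distributions.
\<close>

type_synonym 'd functional = "((real, 'd) vec \<Rightarrow> complex) \<Rightarrow> complex"

definition tempered :: "'d::finite functional set"
  where "tempered = {T.
    (\<forall>\<phi>\<in>schwartz. \<forall>\<psi>\<in>schwartz. \<forall>a b.
       T (\<lambda>x. a * \<phi> x + b * \<psi> x) = a * T \<phi> + b * T \<psi>) \<and>
    (\<exists>C N. \<forall>\<phi>\<in>schwartz. cmod (T \<phi>) \<le> C * schwartz_seminorm N \<phi>) \<and>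
    (\<forall>\<phi>. \<phi> \<notin> schwartz \<longrightarrow> T \<phi> = 0)}"

text \<open>The distributions \<open>T(\<cdot> - a)\<close> and \<open>T(\<cdot>/h)\<close>.\<close>

definition translate :: "real^'d \<Rightarrow> 'd::finite functional \<Rightarrow> 'd functional"
  where "translate a T = (\<lambda>\<phi>. T (\<lambda>x. \<phi> (x + a)))"

definition dilate :: "real \<Rightarrow> 'd::finite functional \<Rightarrow> 'd functional"
  where "dilate h T = (\<lambda>\<phi>. of_real (h ^ CARD('d)) * T (\<lambda>x. \<phi> (h *\<^sub>R x)))"

definition fourier :: "(real^'d \<Rightarrow> complex) \<Rightarrow> real^'d \<Rightarrow> complex"
  where "fourier \<phi> \<omega> = (LINT x|lborel. \<phi> x * exp (- \<i> * of_real (\<omega> \<bullet> x)))"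

definition locally_L2 :: "(real^'d \<Rightarrow> complex) \<Rightarrow> bool"
  where "locally_L2 g \<longleftrightarrow> g \<in> borel_measurable lborel \<and>
    (\<forall>K. compact K \<longrightarrow> set_integrable lborel K (\<lambda>\<omega>. (cmod (g \<omega>))\<^sup>2))"

text \<open>
  The Fourier transform of \<open>T\<close> is the distribution sending \<open>\<phi>\<close> to \<open>T\<close> applied to the
  Fourier transform of \<open>\<phi>\<close>. That it is the locally square integrable function \<open>g\<close>
  is tested against compactly supported functions, since a locally square integrable
  function need not be integrable against every Schwartz function. Such a \<open>g\<close> is
  unique up to null sets, and \<open>fhat T\<close> is an arbitrary representative; every notion
  below depends only on its class modulo null sets.
\<close>

definition has_fourier :: "'d::finite functional \<Rightarrow> (real^'d \<Rightarrow> complex) \<Rightarrow> bool"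
  where "has_fourier T g \<longleftrightarrow> locally_L2 g \<and>
    (\<forall>\<phi>\<in>smooth_compact_support. T (fourier \<phi>) = (LINT \<omega>|lborel. g \<omega> * \<phi> \<omega>))"

definition fhat :: "'d::finite functional \<Rightarrow> real^'d \<Rightarrow> complex"
  where "fhat T = (SOME g. has_fourier T g)"

definition sobolev :: "real \<Rightarrow> 'd::finite functional set"
  where "sobolev s = {T \<in> tempered. (\<exists>g. has_fourier T g) \<and>
    integrable lborel (\<lambda>\<omega>. (1 + norm \<omega>) powr (2 * s) * (cmod (fhat T \<omega>))\<^sup>2)}"

definition sobolev_norm :: "real \<Rightarrow> 'd::finite functional \<Rightarrow> real"
  where "sobolev_norm s T =
    sqrt (LINT \<omega>|lborel. (1 + norm \<omega>) powr (2 * s) * (cmod (fhat T \<omega>))\<^sup>2)"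

definition closed_sobolev_subspace :: "real \<Rightarrow> 'd::finite functional set \<Rightarrow> bool"
  where "closed_sobolev_subspace s V \<longleftrightarrow>
    V \<subseteq> sobolev s \<and> (\<lambda>\<phi>. 0) \<in> V \<and>
    (\<forall>T\<in>V. \<forall>U\<in>V. (\<lambda>\<phi>. T \<phi> + U \<phi>) \<in> V) \<and>
    (\<forall>c. \<forall>T\<in>V. (\<lambda>\<phi>. c * T \<phi>) \<in> V) \<and>
    (\<forall>T\<in>sobolev s.
       (\<forall>\<epsilon>>0. \<exists>U\<in>V. sobolev_norm s (\<lambda>\<phi>. T \<phi> - U \<phi>) < \<epsilon>) \<longrightarrow> T \<in> V)"

definition int_lattice :: "(real^'d) set"
  where "int_lattice = {j. \<forall>i. j $ i \<in> \<int>}"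

definition shift_inv_space :: "real \<Rightarrow> 'd::finite functional ^ 'r \<Rightarrow> 'd functional set"
  where "shift_inv_space s \<Phi> =
    \<Inter> {V. closed_sobolev_subspace s V \<and> (\<forall>i. \<Phi> $ i \<in> V) \<and>
           (\<forall>T\<in>V. \<forall>j\<in>int_lattice. translate j T \<in> V)}"

definition provides_approx_order :: "real \<Rightarrow> 'd::finite functional ^ 'r \<Rightarrow> real \<Rightarrow> bool"
  where "provides_approx_order s \<Phi> k \<longleftrightarrow>
    (\<exists>C. \<forall>f\<in>sobolev k. \<forall>h>0.
       (INF g\<in>dilate h ` shift_inv_space s \<Phi>. sobolev_norm s (\<lambda>\<phi>. f \<phi> - g \<phi>))
         \<le> C * h powr (k - s) * sobolev_norm k f)"

definition periodic_2pi :: "(real^'d \<Rightarrow> 'b) \<Rightarrow> bool"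
  where "periodic_2pi p \<longleftrightarrow> (\<forall>\<omega>. \<forall>j\<in>int_lattice. p (\<omega> + (2 * pi) *\<^sub>R j) = p \<omega>)"

definition annulus :: "real \<Rightarrow> (real^'d) set"
  where "annulus \<rho> = {\<omega>. \<rho> / 2 < norm \<omega> \<and> norm \<omega> \<le> \<rho>}"

text \<open>The numbers \<open>\<lambda>\<^sub>m\<close>, as elements of \<open>[0,\<infinity>]\<close>.\<close>

definition lambda_num :: "real \<Rightarrow> 'd::finite functional \<Rightarrow> nat \<Rightarrow> ennreal"
  where "lambda_num \<rho> f m =
    esssup (restrict_space lborel (annulus \<rho>))
      (\<lambda>\<omega>. \<Sum>\<^sub>\<infinity> \<alpha> \<in> (\<lambda>j. (2 ^ m * (2 * pi)) *\<^sub>R j) ` (int_lattice - {0}).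
              ennreal ((cmod (fhat f (\<omega> + \<alpha>)))\<^sup>2))"

end

theory Submission
  imports Defs "HOL-Real_Asymp.Real_Asymp"
begin

text \<open>
  Everything happens on the Fourier side. Write \<open>S\<close> for the shift-invariant space generated by
  \<open>\<Phi>\<close> and consider the closure of the Fourier transforms of its elements in the weighted
  \<open>L\<^sub>2\<close> space that defines \<open>W\<^sub>2\<^sup>s\<close> (\<open>spectral_space\<close>). It has two structural properties.

  \<^item> It is a module over the bounded \<open>2\<pi>\<close>-periodic functions (\<open>multipliers_cell_rep\<close>).
    Shift invariance gives the exponentials \<open>exp(-i j\<cdot>\<omega>)\<close> as multipliers, and Stone-Weierstrass
    followed by bounded pointwise limits leads from there to all bounded Borel functions on the torus.

  \<^item> It is invariant under \<open>u \<mapsto> u(2\<cdot>)\<close> (\<open>spectral_space_dilate_two\<close>). By minimality of \<open>S\<close> this need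
    only be checked on the generators, where it is the refinement equation: the transform of a
    generator at \<open>2\<omega>\<close> is a combination of the transforms at \<open>\<omega>\<close> with periodic coefficients.

  Hence all functions \<open>u(2\<^sup>m\<cdot>)\<close>, with \<open>u\<close> the transform of \<open>f\<close>, are available, multiplied by
  arbitrary bounded periodic functions. Let \<open>G\<close> be the transform of a target in \<open>W\<^sub>2\<^sup>k\<close> and put
  \<open>H = G(\<cdot>/h)\<close>. On the shell \<open>2\<^bsup>-m\<^esup>A\<close> the function \<open>u(2\<^sup>m\<cdot>)\<close> is bounded away from zero, so
  multiplying it by the periodization of \<open>H / u(2\<^sup>m\<cdot>)\<close>, restricted to that shell, reproduces \<open>H\<close>
  exactly there. The shells fill the punctured ball of radius \<open>\<rho>\<close>; as \<open>\<rho> < \<pi>\<close>, this ball is disjoint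
  from its translates by nonzero elements of \<open>2\<pi>\<int>\<^sup>d\<close>, so that the sum over \<open>m\<close> (\<open>approximant\<close>)
  agrees with \<open>H\<close> on the whole ball, apart from truncations that vanish in the limit
  (\<open>approximant_inside\<close>).

  Two errors remain. The frequencies of \<open>G\<close> outside the ball of radius \<open>\<rho>/h\<close> contribute
  \<open>O(h\<^bsup>2(k-s)\<^esup>)\<close> times the squared \<open>W\<^sub>2\<^sup>k\<close> norm, simply by comparing weights. The other error is
  aliasing: the periodic multipliers also produce mass on the translates of the ball. Over the shell
  \<open>2\<^bsup>-m\<^esup>A\<close> its density is at most a constant times \<open>\<lambda>\<^sub>m |H|\<^sup>2\<close>, and there
  \<open>\<lambda>\<^sub>m = O(2\<^bsup>-2mk\<^esup>) = O(|\<xi>|\<^bsup>2k\<^esup>)\<close>; so the total aliased mass is at most a multiple of the integral of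
  \<open>|\<xi>|\<^bsup>2k\<^esup>|H|\<^sup>2\<close> (\<open>approximant_tail\<close>). Since \<open>s \<le> 0\<close>, the weight is \<open>O(h\<^bsup>-2s\<^esup>)\<close> off the ball, and
  rescaling gives \<open>O(h\<^bsup>2(k-s)\<^esup>)\<close> again (\<open>approximation_error\<close>).

  Passing between distributions and functions rests on the fact that the Fourier transform of a
  distribution, when it is a locally square integrable function, is unique up to null sets
  (\<open>has_fourier_unique\<close>). A distribution with prescribed transform never has to be constructed:
  an approximation order asks for elements of \<open>S\<close> close to the approximant, and membership of the
  approximant in the closed space of functions provides them (\<open>distance_to_dilate_le\<close>).
\<close>

section \<open>Smooth functions\<close>

text \<open>
  Computing iterated derivatives is avoided as follows: a set of differentiable functions whose partial
  derivatives are sums of products of its members consists of smooth functions, because the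
  product rule keeps all higher derivatives inside the algebra that it generates.
\<close>

inductive generated_algebra ::
    "((real^'d \<Rightarrow> complex) \<Rightarrow> bool) \<Rightarrow> (real^'d \<Rightarrow> complex) \<Rightarrow> bool"
  for B where
    base: "B \<phi> \<Longrightarrow> generated_algebra B \<phi>"
  | add: "generated_algebra B \<phi> \<Longrightarrow> generated_algebra B \<psi> \<Longrightarrow>
      generated_algebra B (\<lambda>x. \<phi> x + \<psi> x)"
  | mult: "generated_algebra B \<phi> \<Longrightarrow> generated_algebra B \<psi> \<Longrightarrow>
      generated_algebra B (\<lambda>x. \<phi> x * \<psi> x)"

lemma partial_deriv_eqI:
  assumes "\<And>x. (\<phi> has_derivative D x) (at x)"
  shows "partial_deriv b \<phi> = (\<lambda>x. D x b)"
  using frechet_derivative_at[OF assms] by (auto simp: partial_deriv_def fun_eq_iff)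

lemma differentiable_partial_deriv:
  assumes "\<And>x. \<phi> differentiable (at x)"
  shows "(\<phi> has_derivative (\<lambda>b. partial_deriv b \<phi> x)) (at x)"
  using assms[of x] by (simp add: partial_deriv_def frechet_derivative_works)

lemma smooth_generated_algebra:
  fixes \<phi> :: "real^'d::finite \<Rightarrow> complex"
  assumes "generated_algebra B \<phi>"
    and diff: "\<And>\<phi> x. B \<phi> \<Longrightarrow> \<phi> differentiable (at x)"
    and step: "\<And>\<phi> b. B \<phi> \<Longrightarrow> b \<in> Basis \<Longrightarrow> generated_algebra B (partial_deriv b \<phi>)"
  shows "smooth \<phi>"
proof -
  have alg: "(\<forall>x. \<phi> differentiable (at x)) \<and> (\<forall>b\<in>Basis. generated_algebra B (partial_deriv b \<phi>))"
    if "generated_algebra B \<phi>" for \<phi> :: "real^'d \<Rightarrow> complex"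
    using that
  proof induction
    case (base \<phi>)
    then show ?case using diff step by blast
  next
    case (add \<phi> \<psi>)
    have "partial_deriv b (\<lambda>x. \<phi> x + \<psi> x) = (\<lambda>x. partial_deriv b \<phi> x + partial_deriv b \<psi> x)" for b
      using add by (intro partial_deriv_eqI) (auto intro!: derivative_eq_intros differentiable_partial_deriv)
    then show ?case
      using add by (auto intro: generated_algebra.intros)
  next
    case (mult \<phi> \<psi>)
    have "partial_deriv b (\<lambda>x. \<phi> x * \<psi> x) = (\<lambda>x. \<phi> x * partial_deriv b \<psi> x + partial_deriv b \<phi> x * \<psi> x)" for b
      using mult by (intro partial_deriv_eqI) (auto intro!: derivative_eq_intros differentiable_partial_deriv)
    then show ?case
      using mult by (auto intro!: generated_algebra.add generated_algebra.mult)
  qed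
  have "iter_deriv bs \<phi> differentiable (at x)"
    if "generated_algebra B \<phi>" "set bs \<subseteq> Basis" for bs \<phi> x
    using that
  proof (induction bs arbitrary: \<phi> rule: rev_induct)
    case Nil
    then show ?case using alg by (simp add: iter_deriv_def)
  next
    case (snoc b bs)
    then have "iter_deriv bs (partial_deriv b \<phi>) differentiable (at x)"
      using alg by auto
    then show ?case by (simp add: iter_deriv_def)
  qed
  with assms(1) show ?thesis
    by (auto simp: smooth_def)
qed

lemma smooth_differentiable: "smooth \<phi> \<Longrightarrow> \<phi> differentiable (at x)"
  by (auto simp: smooth_def iter_deriv_def dest: spec[of _ "[]"])

lemma smooth_partial_deriv:
  assumes "smooth \<phi>" "b \<in> Basis"
  shows "smooth (partial_deriv b \<phi>)"
  unfolding smooth_def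
proof (intro allI impI)
  fix bs :: "(real^'a) list" and x
  assume "set bs \<subseteq> Basis"
  with assms have "iter_deriv (bs @ [b]) \<phi> differentiable (at x)"
    unfolding smooth_def by (metis Un_subset_iff empty_set insert_subset list.simps(15) empty_subsetI set_append)
  then show "iter_deriv bs (partial_deriv b \<phi>) differentiable (at x)"
    by (simp add: iter_deriv_def)
qed

lemma smooth_mult:
  assumes "smooth \<phi>" "smooth \<psi>"
  shows "smooth (\<lambda>x. \<phi> x * \<psi> x)"
  using assms
  by (intro smooth_generated_algebra[where B = smooth])
    (auto intro: generated_algebra.intros smooth_differentiable smooth_partial_deriv)

lemma smooth_const: "smooth (\<lambda>x. c)"
proof (rule smooth_generated_algebra[where B = "\<lambda>\<phi>. \<exists>c. \<phi> = (\<lambda>x. c)"])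
  fix \<phi> :: "real^'a \<Rightarrow> complex" and b :: "real^'a"
  assume "\<exists>c. \<phi> = (\<lambda>x. c)"
  then have "partial_deriv b \<phi> = (\<lambda>x. 0)"
    by (intro partial_deriv_eqI) auto
  then show "generated_algebra (\<lambda>\<phi>. \<exists>c. \<phi> = (\<lambda>x. c)) (partial_deriv b \<phi>)"
    by (auto intro: generated_algebra.base)
qed (auto intro: generated_algebra.base)

lemma smooth_prod:
  "finite A \<Longrightarrow> (\<And>i. i \<in> A \<Longrightarrow> smooth (\<phi> i)) \<Longrightarrow> smooth (\<lambda>x. \<Prod>i\<in>A. \<phi> i x)"
  by (induction rule: finite_induct) (auto intro: smooth_const smooth_mult)

lemma smooth_exp: "smooth (\<lambda>x. exp (- \<i> * of_real (j \<bullet> x)))"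
proof (rule smooth_generated_algebra)
  let ?B = "\<lambda>\<phi>. \<exists>c. \<phi> = (\<lambda>x. c * exp (- \<i> * of_real (j \<bullet> x)))"
  have deriv: "((\<lambda>x. c * exp (- \<i> * of_real (j \<bullet> x))) has_derivative
      (\<lambda>b. c * (- \<i> * of_real (j \<bullet> b)) * exp (- \<i> * of_real (j \<bullet> x)))) (at x)" for c x
  proof -
    have "((\<lambda>x. - \<i> * of_real (j \<bullet> x)) has_derivative (\<lambda>b. - \<i> * of_real (j \<bullet> b))) (at x)"
      by (auto intro!: derivative_eq_intros)
    from has_derivative_mult_right[OF has_derivative_compose[OF this DERIV_exp[unfolded has_field_derivative_def]], of c]
    show ?thesis by (simp add: mult_ac)
  qed
  show "generated_algebra ?B (\<lambda>x. exp (- \<i> * of_real (j \<bullet> x)))"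
    by (intro generated_algebra.base exI[of _ 1]) simp
  show "\<phi> differentiable (at x)" if "?B \<phi>" for \<phi> x
    using that deriv unfolding differentiable_def by metis
  show "generated_algebra ?B (partial_deriv b \<phi>)" if "?B \<phi>" for b \<phi>
  proof -
    obtain c where c: "\<phi> = (\<lambda>x. c * exp (- \<i> * of_real (j \<bullet> x)))" using \<open>?B \<phi>\<close> by blast
    show ?thesis
      unfolding c partial_deriv_eqI[OF deriv] by (rule generated_algebra.base) blast
  qed
qed

lemma smooth_scale:
  assumes "smooth \<phi>"
  shows "smooth (\<lambda>x. \<phi> (c *\<^sub>R x))"
proof (rule smooth_generated_algebra)
  let ?B = "\<lambda>\<phi>. \<exists>a \<psi>. smooth \<psi> \<and> \<phi> = (\<lambda>x. a * \<psi> (c *\<^sub>R x))"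
  have deriv: "((\<lambda>x. a * \<psi> (c *\<^sub>R x)) has_derivative
      (\<lambda>b. a * of_real c * partial_deriv b \<psi> (c *\<^sub>R x))) (at x)" if "smooth \<psi>" for a \<psi> x
  proof -
    have d: "(\<psi> has_derivative (\<lambda>b. partial_deriv b \<psi> (c *\<^sub>R x))) (at (c *\<^sub>R x))"
      using that by (intro differentiable_partial_deriv smooth_differentiable)
    have "((\<lambda>x. \<psi> (c *\<^sub>R x)) has_derivative (\<lambda>b. partial_deriv (c *\<^sub>R b) \<psi> (c *\<^sub>R x))) (at x)"
      by (rule has_derivative_compose[of "\<lambda>x. c *\<^sub>R x" "\<lambda>b. c *\<^sub>R b" x UNIV, OF _ d])
        (auto intro!: derivative_eq_intros)
    moreover have "partial_deriv (c *\<^sub>R b) \<psi> (c *\<^sub>R x) = of_real c * partial_deriv b \<psi> (c *\<^sub>R x)" for b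
      using linear_cmul[OF has_derivative_linear[OF d]] by (simp add: scaleR_conv_of_real)
    ultimately show ?thesis
      by (auto intro!: derivative_eq_intros simp: algebra_simps)
  qed
  show "generated_algebra ?B (\<lambda>x. \<phi> (c *\<^sub>R x))"
    using assms by (intro generated_algebra.base exI[of _ 1] exI[of _ \<phi>]) simp
  show "\<phi> differentiable (at x)" if "?B \<phi>" for \<phi> x
    using that deriv unfolding differentiable_def by metis
  show "generated_algebra ?B (partial_deriv b \<phi>)" if "?B \<phi>" "b \<in> Basis" for b \<phi>
  proof -
    obtain a \<psi> where \<psi>: "smooth \<psi>" "\<phi> = (\<lambda>x. a * \<psi> (c *\<^sub>R x))" using \<open>?B \<phi>\<close> by blast
    have "partial_deriv b \<phi> = (\<lambda>x. a * of_real c * partial_deriv b \<psi> (c *\<^sub>R x))"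
      unfolding \<psi>(2) by (rule partial_deriv_eqI[OF deriv[OF \<psi>(1)]])
    moreover have "smooth (partial_deriv b \<psi>)" using \<psi> that by (intro smooth_partial_deriv)
    ultimately show ?thesis by (intro generated_algebra.base) blast
  qed
qed

text \<open>
  The function \<open>exp(-1/t)\<close> on the positive half-line, extended by zero, is smooth. The quotients by
  powers of \<open>t\<close> are included because their span is closed under differentiation.
\<close>

definition flat :: "nat \<Rightarrow> real \<Rightarrow> real" where
  "flat m t = (if t \<le> 0 then 0 else exp (- 1 / t) / t ^ m)"

lemma flat_has_real_derivative:
  "(flat m has_real_derivative flat (m + 2) t - of_nat m * flat (m + 1) t) (at t)"
proof -
  consider "t < 0" | "t > 0" | "t = 0" by linarith
  then show ?thesis
  proof cases
    case 1
    have "((\<lambda>t. 0) has_real_derivative flat (m + 2) t - of_nat m * flat (m + 1) t) (at t)"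
      using 1 by (simp add: flat_def)
    then show ?thesis
      by (rule has_field_derivative_transform_within_open[of _ _ _ "{..<0}"]) (use 1 in \<open>auto simp: flat_def\<close>)
  next
    case 2
    have "((\<lambda>t. exp (- 1 / t) / t ^ m) has_real_derivative flat (m + 2) t - of_nat m * flat (m + 1) t) (at t)"
      using 2 
      by (auto intro!: derivative_eq_intros simp: flat_def field_simps power2_eq_square)
        (cases m; simp add: field_simps)
    then show ?thesis
      by (rule has_field_derivative_transform_within_open[of _ _ _ "{0<..}"]) (use 2 in \<open>auto simp: flat_def\<close>)
  next
    case 3
    have "((\<lambda>t. exp (- 1 / t) / t ^ Suc m) \<longlongrightarrow> 0) (at_right (0::real))"
      by real_asymp
    then have "((\<lambda>t. flat m t / t) \<longlongrightarrow> 0) (at_right 0)"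
      by (rule filterlim_cong[THEN iffD1, rotated -1])
        (auto simp: flat_def eventually_at_filter intro!: always_eventually)
    moreover have "((\<lambda>t. flat m t / t) \<longlongrightarrow> 0) (at_left 0)"
      by (rule tendsto_eventually) (auto simp: flat_def eventually_at_filter intro!: always_eventually)
    ultimately have "((\<lambda>t. flat m t / t) \<longlongrightarrow> 0) (at 0)"
      by (simp add: filterlim_split_at)
    then show ?thesis
      using 3 by (simp add: has_field_derivative_iff flat_def)
  qed
qed

lemma smooth_flat: "smooth (\<lambda>x. of_real (flat m (v \<bullet> x + a)))"
proof (rule smooth_generated_algebra)
  let ?B = "\<lambda>\<phi>. (\<exists>m. \<phi> = (\<lambda>x. of_real (flat m (v \<bullet> x + a)))) \<or> (\<exists>c. \<phi> = (\<lambda>x. c :: complex))"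
  show "generated_algebra ?B (\<lambda>x. of_real (flat m (v \<bullet> x + a)))"
    by (intro generated_algebra.base) blast
  have deriv: "((\<lambda>x. of_real (flat m (v \<bullet> x + a)) :: complex) has_derivative (\<lambda>b. of_real ((v \<bullet> b) *
     (flat (m + 2) (v \<bullet> x + a) - of_nat m * flat (m + 1) (v \<bullet> x + a))))) (at x)" for m x
  proof -
    have "((\<lambda>x. v \<bullet> x + a) has_derivative (\<lambda>b. v \<bullet> b)) (at x)"
      by (auto intro!: derivative_eq_intros)
    from has_derivative_of_real[OF has_derivative_compose[OF this flat_has_real_derivative[unfolded has_field_derivative_def]]]
    show ?thesis by (simp add: mult_ac)
  qed
  show "\<phi> differentiable (at x)" if "?B \<phi>" for \<phi> x
    using that
  proof (elim disjE exE)
    fix m assume "\<phi> = (\<lambda>x. of_real (flat m (v \<bullet> x + a)))"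
    with deriv[of m x] show ?thesis by (auto simp: differentiable_def)
  qed simp
  show "generated_algebra ?B (partial_deriv b \<phi>)" if "?B \<phi>" for b \<phi>
    using that
  proof (elim disjE exE)
    fix m assume "\<phi> = (\<lambda>x. of_real (flat m (v \<bullet> x + a)))"
    then have "partial_deriv b \<phi> = (\<lambda>x. of_real (v \<bullet> b) *
     (of_real (flat (m + 2) (v \<bullet> x + a)) + of_real (- of_nat m) * of_real (flat (m + 1) (v \<bullet> x + a))))"
      using partial_deriv_eqI[OF deriv, of b m] by simp
    moreover have "generated_algebra ?B \<dots>"
      by (intro generated_algebra.add generated_algebra.mult; intro generated_algebra.base) blast+
    ultimately show ?thesis by metis
  next
    fix c assume "\<phi> = (\<lambda>x. c)"
    then have "partial_deriv b \<phi> = (\<lambda>x. 0)"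
      by (intro partial_deriv_eqI) auto
    then show ?thesis by (auto intro!: generated_algebra.base)
  qed
qed

section \<open>Test functions separate locally square integrable functions\<close>

lemma smooth_continuous_on: "smooth \<phi> \<Longrightarrow> continuous_on A \<phi>"
  by (meson continuous_at_imp_continuous_on differentiable_imp_continuous_within smooth_differentiable)

lemma test_function_borel: "\<phi> \<in> smooth_compact_support \<Longrightarrow> \<phi> \<in> borel_measurable borel"
  by (auto simp: smooth_compact_support_def intro: borel_measurable_continuous_onI smooth_continuous_on)

lemma test_function_mult:
  assumes "smooth \<eta>" "\<phi> \<in> smooth_compact_support"
  shows "(\<lambda>x. \<eta> x * \<phi> x) \<in> smooth_compact_support"
  using assms unfolding smooth_compact_support_def by (auto intro!: smooth_mult)

lemma test_function_scale:
  assumes "c \<noteq> 0" "\<phi> \<in> smooth_compact_support"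
  shows "(\<lambda>x. \<phi> (c *\<^sub>R x)) \<in> smooth_compact_support"
proof -
  obtain K where K: "compact K" "\<And>x. x \<notin> K \<Longrightarrow> \<phi> x = 0" and \<phi>: "smooth \<phi>"
    using assms by (auto simp: smooth_compact_support_def)
  have "compact ((*\<^sub>R) (1 / c) ` K)"
    using K by (intro compact_scaling)
  moreover have "\<phi> (c *\<^sub>R x) = 0" if "x \<notin> (*\<^sub>R) (1 / c) ` K" for x
    using that assms(1) by (intro K(2)) (auto simp: image_iff dest!: bspec[of _ _ "c *\<^sub>R x"])
  ultimately show ?thesis
    using smooth_scale[OF \<phi>] by (auto simp: smooth_compact_support_def)
qed

text \<open>
  On a set of finite measure the bound \<open>|g| \<le> |g|\<^sup>2 + 1\<close> is enough.
\<close>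

lemma locally_L2_set_integrable:
  assumes "locally_L2 g" "compact K"
  shows "set_integrable lborel K g"
  unfolding set_integrable_def
proof (rule Bochner_Integration.integrable_bound)
  have K: "K \<in> sets lborel"
    using assms by (simp add: borel_compact)
  have g: "g \<in> borel_measurable lborel"
    using assms by (auto simp: locally_L2_def)
  have "integrable lborel (\<lambda>x. indicator K x *\<^sub>R (cmod (g x))\<^sup>2)"
    using assms by (auto simp: locally_L2_def set_integrable_def)
  moreover have "integrable lborel (indicator K :: _ \<Rightarrow> real)"
    using assms K by (intro integrable_real_indicator) (auto simp: emeasure_compact_finite[unfolded infinity_ennreal_def])
  ultimately show "integrable lborel (\<lambda>x. indicator K x *\<^sub>R (cmod (g x))\<^sup>2 + indicator K x)"
    by (rule Bochner_Integration.integrable_add)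
  show "(\<lambda>x. indicat_real K x *\<^sub>R g x) \<in> borel_measurable lborel"
    using K g by simp
  have "cmod (g x) \<le> (cmod (g x))\<^sup>2 + 1" for x
    using sum_squares_bound[of "cmod (g x)" 1] norm_ge_zero[of "g x"]
    unfolding power_one mult_1_right by linarith
  then show "AE x in lborel. norm (indicat_real K x *\<^sub>R g x)
      \<le> norm (indicat_real K x *\<^sub>R (cmod (g x))\<^sup>2 + indicat_real K x)"
    by (auto simp: indicator_def intro!: always_eventually)
qed

lemma locally_L2_test_integrable:
  assumes "locally_L2 g" "\<phi> \<in> smooth_compact_support"
  shows "integrable lborel (\<lambda>\<omega>. g \<omega> * \<phi> \<omega>)"
proof -
  obtain K where K: "compact K" "\<And>x. x \<notin> K \<Longrightarrow> \<phi> x = 0" and \<phi>: "smooth \<phi>"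
    using assms by (auto simp: smooth_compact_support_def)
  have "bounded (\<phi> ` K)"
    using K \<phi> by (intro compact_imp_bounded compact_continuous_image smooth_continuous_on)
  then obtain B where B: "\<And>x. x \<in> K \<Longrightarrow> cmod (\<phi> x) \<le> B"
    by (auto simp: bounded_iff)
  have "integrable lborel (\<lambda>x. B * norm (indicat_real K x *\<^sub>R g x))"
    using locally_L2_set_integrable[OF assms(1) K(1)]
    unfolding set_integrable_def by (intro integrable_mult_right integrable_norm)
  then show ?thesis
  proof (rule Bochner_Integration.integrable_bound)
    show "(\<lambda>\<omega>. g \<omega> * \<phi> \<omega>) \<in> borel_measurable lborel"
      using assms test_function_borel[OF assms(2)] by (auto simp: locally_L2_def)
    show "AE x in lborel. cmod (g x * \<phi> x) \<le> norm (B * norm (indicat_real K x *\<^sub>R g x))"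
    proof (intro always_eventually allI)
      fix x
      show "cmod (g x * \<phi> x) \<le> norm (B * norm (indicat_real K x *\<^sub>R g x))"
      proof (cases "x \<in> K")
        case True
        then have "cmod (\<phi> x) * cmod (g x) \<le> B * cmod (g x)"
          using B by (intro mult_right_mono) auto
        then show ?thesis using True by (simp add: norm_mult mult.commute)
      qed (simp add: K)
    qed
  qed
qed

text \<open>
  For growing \<open>n\<close> the factors tend to 1 on the open box while the support stays in the closed one,
  which makes indicators of open boxes limits of test functions.
\<close>

definition bump :: "nat \<Rightarrow> real^'d \<Rightarrow> real^'d \<Rightarrow> real^'d \<Rightarrow> real" where
  "bump n a b x = (\<Prod>i\<in>UNIV. flat 0 (n * (x $ i - a $ i)) * flat 0 (n * (b $ i - x $ i)))"

lemma flat_0_bounds: "0 \<le> flat 0 t" "flat 0 t \<le> 1"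
  by (auto simp: flat_def)

lemma bump_bounds: "0 \<le> bump n a b x" "bump n a b x \<le> 1"
  unfolding bump_def by (auto intro!: prod_nonneg prod_le_1 mult_le_one simp: flat_0_bounds)

lemma bump_outside:
  assumes "x \<notin> box a b"
  shows "bump n a b x = 0"
proof -
  obtain i where "x $ i \<le> a $ i \<or> b $ i \<le> x $ i"
    using assms by (auto simp: mem_box_cart not_less)
  then have "flat 0 (n * (x $ i - a $ i)) * flat 0 (n * (b $ i - x $ i)) = 0"
    by (auto simp: flat_def mult_le_0_iff)
  then show ?thesis
    unfolding bump_def by (intro prod_zero) auto
qed

lemma bump_test_function:
  "(\<lambda>x. of_real (bump n a b x)) \<in> smooth_compact_support"
proof -
  have lin: "n * (x $ i - a $ i) = (n *\<^sub>R axis i 1) \<bullet> x + - n * a $ i"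
    "n * (b $ i - x $ i) = (- n *\<^sub>R axis i 1) \<bullet> x + n * b $ i" for x and n :: real and i
    by (simp_all add: inner_axis' algebra_simps)
  have "smooth (\<lambda>x. of_real (bump n a b x))"
    unfolding bump_def of_real_prod of_real_mult lin
    by (intro smooth_prod smooth_mult smooth_flat) auto
  moreover have "bump n a b x = 0" if "x \<notin> cbox a b" for x
    using that box_subset_cbox by (intro bump_outside) blast
  ultimately show ?thesis
    unfolding smooth_compact_support_def
    by (auto intro!: exI[of _ "cbox a b"])
qed

lemma bump_tendsto: "(\<lambda>n. bump n a b x) \<longlonglongrightarrow> indicator (box a b) x"
proof (cases "x \<in> box a b")
  case True
  have one: "(\<lambda>n. flat 0 (real n * t)) \<longlonglongrightarrow> 1" if "t > 0" for t
  proof -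
    have "(\<lambda>n. exp (- 1 / (real n * t))) \<longlonglongrightarrow> 1"
      using that by real_asymp
    moreover have "\<forall>\<^sub>F n in sequentially. exp (- 1 / (real n * t)) = flat 0 (real n * t)"
      using eventually_gt_at_top[of 0]
      by eventually_elim (use that in \<open>auto simp: flat_def mult_le_0_iff\<close>)
    ultimately show ?thesis
      by (rule Lim_transform_eventually)
  qed
  have "(\<lambda>n. bump n a b x) \<longlonglongrightarrow> (\<Prod>i\<in>(UNIV::'a set). 1 * 1)"
    unfolding bump_def using True
    by (intro tendsto_prod tendsto_mult one) (auto simp: mem_box_cart)
  then show ?thesis using True by simp
qed (simp add: bump_outside)

text \<open>
  Bump functions show that \<open>g\<close> integrates to zero over every open box. The open boxes are stable
  under intersection and generate the Borel sets, so the integral over every bounded Borel set is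
  zero as well.
\<close>

lemma locally_L2_eq_zero:
  fixes g :: "real^'d::finite \<Rightarrow> complex"
  assumes g: "locally_L2 g"
    and zero: "\<And>\<phi>. \<phi> \<in> smooth_compact_support \<Longrightarrow> (LINT \<omega>|lborel. g \<omega> * \<phi> \<omega>) = 0"
  shows "AE \<omega> in lborel. g \<omega> = 0"
proof -
  have gm[measurable]: "g \<in> borel_measurable borel"
    using g by (auto simp: locally_L2_def)
  have box: "(LINT \<omega>|lborel. indicator (box a b) \<omega> *\<^sub>R g \<omega>) = 0" for a b
  proof -
    have "(\<lambda>n. LINT \<omega>|lborel. g \<omega> * of_real (bump n a b \<omega>)) \<longlonglongrightarrow>
        (LINT \<omega>|lborel. indicator (box a b) \<omega> *\<^sub>R g \<omega>)"
    proof (rule integral_dominated_convergence)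
      show "integrable lborel (\<lambda>x. norm (indicat_real (cbox a b) x *\<^sub>R g x))"
        using locally_L2_set_integrable[OF g compact_cbox, of a b]
        unfolding set_integrable_def by (rule integrable_norm)
      show "(\<lambda>\<omega>. g \<omega> * of_real (bump n a b \<omega>)) \<in> borel_measurable lborel" for n
        using test_function_borel[OF bump_test_function, of n a b] by simp
      show "AE x in lborel. (\<lambda>n. g x * of_real (bump n a b x)) \<longlonglongrightarrow> indicat_real (box a b) x *\<^sub>R g x"
        unfolding scaleR_conv_of_real
        by (subst mult.commute) (intro always_eventually allI tendsto_mult tendsto_of_real bump_tendsto tendsto_const)
      show "AE x in lborel. norm (g x * of_real (bump n a b x)) \<le> norm (indicat_real (cbox a b) x *\<^sub>R g x)" for n
      proof (intro always_eventually allI)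
        fix x
        show "norm (g x * of_real (bump n a b x)) \<le> norm (indicat_real (cbox a b) x *\<^sub>R g x)"
        proof (cases "x \<in> box a b")
          case True
          then have "x \<in> cbox a b" using box_subset_cbox by blast
          then show ?thesis
            using bump_bounds[of n a b x] by (auto simp: norm_mult intro!: mult_left_le)
        qed (simp add: bump_outside)
      qed
    qed simp
    then show ?thesis
      by (simp add: zero bump_test_function LIMSEQ_const_iff)
  qed
  have "AE \<omega> in lborel. indicator (box (- c) c) \<omega> *\<^sub>R g \<omega> = 0" for c :: "real^'d"
  proof (rule sigma_finite_measure.density_zero[OF sigma_finite_lborel])
    let ?f = "\<lambda>\<omega>. indicator (box (- c) c) \<omega> *\<^sub>R g \<omega>"
    have "set_integrable lborel (cbox (- c) c) g"
      using g by (intro locally_L2_set_integrable) auto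
    then have "set_integrable lborel (box (- c) c) g"
      by (rule set_integrable_subset) (auto simp: box_subset_cbox)
    then show int: "integrable lborel ?f"
      by (simp add: set_integrable_def)
    fix A :: "(real^'d) set" assume "A \<in> sets lborel"
    then have A: "A \<in> sigma_sets UNIV (range (\<lambda>(a, b). box a b))"
      by (simp add: borel_eq_box)
    have "Int_stable (range (\<lambda>(a, b). box a b :: (real^'d) set))"
      by (auto simp: Int_stable_def box_Int_box)
    moreover have "range (\<lambda>(a, b). box a b :: (real^'d) set) \<subseteq> Pow UNIV"
      by auto
    ultimately show "set_lebesgue_integral lborel A ?f = 0"
      using A
    proof (induction rule: sigma_sets_induct_disjoint)
      case (basic A)
      then obtain a b where A: "A = box a b" by auto
      obtain a' b' where "box a b \<inter> box (- c) c = box a' b'"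
        unfolding box_Int_box by blast
      then have "indicator A x *\<^sub>R ?f x = indicator (box a' b') x *\<^sub>R g x" for x
        unfolding A scaleR_scaleR indicator_inter_arith[symmetric] by simp
      then show ?case
        by (simp only: set_lebesgue_integral_def box)
    next
      case empty
      then show ?case by (simp add: set_lebesgue_integral_def)
    next
      case (compl A)
      then have A: "A \<in> sets lborel" by (simp add: borel_eq_box)
      have "indicator (UNIV - A) x *\<^sub>R ?f x = ?f x - indicator A x *\<^sub>R ?f x" for x
        by (auto simp: indicator_def)
      moreover have "integrable lborel (\<lambda>x. indicator A x *\<^sub>R ?f x)"
        using A int by (rule integrable_mult_indicator)
      ultimately show ?case
        using compl int by (simp add: set_lebesgue_integral_def box)
    next
      case (union A)
      then have A: "\<And>i. A i \<in> sets lborel" by (auto simp: borel_eq_box)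
      have "set_integrable lborel (\<Union>i. A i) ?f"
        unfolding set_integrable_def by (rule integrable_mult_indicator[OF _ int]) (use A in auto)
      then have "set_lebesgue_integral lborel (\<Union>i. A i) ?f = (\<Sum>i. set_lebesgue_integral lborel (A i) ?f)"
        using A union(1) by (intro lebesgue_integral_countable_add) (auto simp: disjoint_family_on_def)
      then show ?case using union by simp
    qed
  qed
  then have "AE \<omega> in lborel. \<forall>n::nat. indicator (box (- (\<chi> i. n)) (\<chi> i. n)) \<omega> *\<^sub>R g \<omega> = 0"
    unfolding AE_all_countable by blast
  then show ?thesis
  proof eventually_elim
    case (elim \<omega>)
    obtain n :: nat where "norm \<omega> < n" using reals_Archimedean2 by blast
    then have "\<bar>\<omega> $ i\<bar> < n" for i
      by (rule le_less_trans[OF component_le_norm_cart])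
    then have "\<omega> \<in> box (- (\<chi> i. n)) (\<chi> i. n)"
      by (auto simp: mem_box_cart abs_less_iff minus_less_iff)
    with elim show ?case by (auto dest: spec[of _ n])
  qed
qed

section \<open>Change of variables\<close>

lemma AE_lborel_scale:
  fixes c :: real
  assumes "AE x in lborel. Q x" "c \<noteq> 0"
  shows "AE x in lborel. Q (c *\<^sub>R (x :: 'a::euclidean_space))"
proof -
  have "AE x in density (distr lborel borel (\<lambda>x. 0 + c *\<^sub>R x)) (\<lambda>_. ennreal (\<bar>c\<bar> ^ DIM('a))). Q x"
    using assms(1) by (subst (asm) lborel_affine[OF assms(2), of 0])
  then have "AE x in distr lborel borel (\<lambda>x. 0 + c *\<^sub>R x). Q x"
    using assms(2) by (subst (asm) AE_density) auto
  then have "AE x in lborel. Q (0 + c *\<^sub>R x)"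
    by (rule AE_distrD[rotated]) simp
  then show ?thesis by simp
qed

lemma AE_lborel_translate:
  assumes "AE x in lborel. Q x"
  shows "AE x in lborel. Q (x + (a :: 'a::euclidean_space))"
proof -
  have "AE x in distr lborel borel ((+) a). Q x"
    using assms by (subst lborel_distr_plus)
  then have "AE x in lborel. Q (a + x)"
    by (rule AE_distrD[rotated]) simp
  then show ?thesis by (simp add: add.commute)
qed

lemma nn_integral_lborel_scale:
  assumes [measurable]: "f \<in> borel_measurable borel" and "c > 0"
  shows "(\<integral>\<^sup>+x. f (c *\<^sub>R x) \<partial>lborel) = ennreal (inverse c ^ DIM('a)) * (\<integral>\<^sup>+x. f x \<partial>(lborel :: 'a::euclidean_space measure))"
proof -
  have "(\<integral>\<^sup>+x. f x \<partial>(lborel :: 'a measure)) = ennreal (c ^ DIM('a)) * (\<integral>\<^sup>+x. f (c *\<^sub>R x) \<partial>lborel)"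
    using assms(2)
    by (subst lborel_affine[of c 0]) (auto simp: nn_integral_density nn_integral_distr nn_integral_cmult)
  then have "ennreal (inverse c ^ DIM('a)) * (\<integral>\<^sup>+x. f x \<partial>(lborel :: 'a measure))
      = ennreal (inverse c ^ DIM('a) * c ^ DIM('a)) * (\<integral>\<^sup>+x. f (c *\<^sub>R x) \<partial>lborel)"
    using assms(2) by (simp add: ennreal_mult mult.assoc)
  then show ?thesis
    using assms(2) by (simp flip: power_mult_distrib)
qed

lemma nn_integral_lborel_translate:
  assumes [measurable]: "f \<in> borel_measurable borel"
  shows "(\<integral>\<^sup>+x. f (x + a) \<partial>lborel) = (\<integral>\<^sup>+x. f x \<partial>(lborel :: 'a::euclidean_space measure))"
proof -
  have "(\<integral>\<^sup>+x. f x \<partial>(lborel :: 'a measure)) = (\<integral>\<^sup>+x. f (a + x) \<partial>lborel)"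
    by (subst lborel_distr_plus[of a, symmetric]) (auto simp: nn_integral_distr)
  then show ?thesis by (simp add: add.commute)
qed

lemma lborel_integral_scale:
  fixes f :: "'a::euclidean_space \<Rightarrow> 'b::{banach, second_countable_topology}"
  assumes [measurable]: "f \<in> borel_measurable borel" and "c > 0"
  shows "(LINT x|lborel. f x) = c ^ DIM('a) *\<^sub>R (LINT x|lborel. f (c *\<^sub>R x))"
  using assms(2)
  by (subst lborel_affine[of c 0]) (auto simp: integral_density integral_distr)

lemma lborel_integrable_scale:
  fixes f :: "'a::euclidean_space \<Rightarrow> 'b::{banach, second_countable_topology}"
  assumes f: "integrable lborel f" and "c > 0"
  shows "integrable lborel (\<lambda>x. f (c *\<^sub>R x))"
proof -
  have [measurable]: "f \<in> borel_measurable borel"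
    using f by auto
  have "integrable (density (distr lborel borel (\<lambda>x. 0 + c *\<^sub>R x)) (\<lambda>_. \<bar>c\<bar>^DIM('a))) f"
    using f lborel_affine[of c "0 :: 'a"] assms(2) by simp
  then have "integrable (distr lborel borel (\<lambda>x. 0 + c *\<^sub>R x)) (\<lambda>x. \<bar>c\<bar>^DIM('a) *\<^sub>R f x)"
    using assms(2) by (subst (asm) integrable_density) auto
  from integrable_scaleR_right[OF this, of "inverse (\<bar>c\<bar>^DIM('a))"]
  have "integrable (distr lborel borel (\<lambda>x. 0 + c *\<^sub>R x)) f"
    using assms(2) by simp
  then show ?thesis
    by (subst (asm) integrable_distr_eq) auto
qed

section \<open>Fourier transforms that are locally square integrable functions\<close>

lemma has_fourier_borel: "has_fourier T g \<Longrightarrow> g \<in> borel_measurable borel"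
  by (simp add: has_fourier_def locally_L2_def)

lemma norm_add_square_le: "(norm (x + y))\<^sup>2 \<le> 2 * (norm x)\<^sup>2 + 2 * (norm (y :: 'a::real_normed_vector))\<^sup>2"
proof -
  have "(norm (x + y))\<^sup>2 \<le> (norm x + norm y)\<^sup>2"
    by (intro power_mono norm_triangle_ineq) auto
  also have "\<dots> \<le> 2 * (norm x)\<^sup>2 + 2 * (norm y)\<^sup>2"
    using sum_squares_bound[of "norm x" "norm y"] by (simp add: power2_sum)
  finally show ?thesis .
qed

lemma locally_L2_lincomb:
  assumes "locally_L2 g" "locally_L2 g'"
  shows "locally_L2 (\<lambda>\<omega>. a * g \<omega> + b * g' \<omega>)"
  unfolding locally_L2_def
proof (intro conjI allI impI)
  have [measurable]: "g \<in> borel_measurable borel" "g' \<in> borel_measurable borel"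
    using assms by (auto simp: locally_L2_def)
  show "(\<lambda>\<omega>. a * g \<omega> + b * g' \<omega>) \<in> borel_measurable lborel"
    by simp
  fix K :: "(real^'a) set" assume K: "compact K"
  have [measurable]: "K \<in> sets borel" using K by (rule borel_compact)
  have "set_integrable lborel K (\<lambda>\<omega>. (cmod (g \<omega>))\<^sup>2)" "set_integrable lborel K (\<lambda>\<omega>. (cmod (g' \<omega>))\<^sup>2)"
    using assms K by (auto simp: locally_L2_def)
  then have "set_integrable lborel K (\<lambda>\<omega>. 2 * (cmod a)\<^sup>2 * (cmod (g \<omega>))\<^sup>2 + 2 * (cmod b)\<^sup>2 * (cmod (g' \<omega>))\<^sup>2)"
    by (intro set_integral_add set_integrable_mult_right) auto
  then show "set_integrable lborel K (\<lambda>\<omega>. (cmod (a * g \<omega> + b * g' \<omega>))\<^sup>2)"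
    unfolding set_integrable_def
  proof (rule Bochner_Integration.integrable_bound)
    show "(\<lambda>x. indicat_real K x *\<^sub>R (cmod (a * g x + b * g' x))\<^sup>2) \<in> borel_measurable lborel"
      by measurable
    have "(cmod (a * g x + b * g' x))\<^sup>2 \<le> 2 * (cmod a)\<^sup>2 * (cmod (g x))\<^sup>2 + 2 * (cmod b)\<^sup>2 * (cmod (g' x))\<^sup>2" for x
      using norm_add_square_le[of "a * g x" "b * g' x"] by (simp add: norm_mult power_mult_distrib)
    then show "AE x in lborel. norm (indicat_real K x *\<^sub>R (cmod (a * g x + b * g' x))\<^sup>2)
        \<le> norm (indicat_real K x *\<^sub>R (2 * (cmod a)\<^sup>2 * (cmod (g x))\<^sup>2 + 2 * (cmod b)\<^sup>2 * (cmod (g' x))\<^sup>2))"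
      by (auto simp: indicator_def intro!: always_eventually)
  qed
qed

lemma has_fourier_lincomb:
  assumes "has_fourier T g" "has_fourier U g'"
  shows "has_fourier (\<lambda>\<phi>. a * T \<phi> + b * U \<phi>) (\<lambda>\<omega>. a * g \<omega> + b * g' \<omega>)"
  unfolding has_fourier_def
proof (intro conjI ballI)
  have L: "locally_L2 g" "locally_L2 g'" using assms by (auto simp: has_fourier_def)
  then show "locally_L2 (\<lambda>\<omega>. a * g \<omega> + b * g' \<omega>)"
    by (rule locally_L2_lincomb)
  fix \<phi> :: "real^'a \<Rightarrow> complex" assume \<phi>: "\<phi> \<in> smooth_compact_support"
  have "(LINT \<omega>|lborel. (a * g \<omega> + b * g' \<omega>) * \<phi> \<omega>) =
      (LINT \<omega>|lborel. a * (g \<omega> * \<phi> \<omega>) + b * (g' \<omega> * \<phi> \<omega>))"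
    by (simp add: algebra_simps)
  also have "\<dots> = a * (LINT \<omega>|lborel. g \<omega> * \<phi> \<omega>) + b * (LINT \<omega>|lborel. g' \<omega> * \<phi> \<omega>)"
    using locally_L2_test_integrable[OF L(1) \<phi>] locally_L2_test_integrable[OF L(2) \<phi>] by simp
  finally show "a * T (fourier \<phi>) + b * U (fourier \<phi>) = (LINT \<omega>|lborel. (a * g \<omega> + b * g' \<omega>) * \<phi> \<omega>)"
    using assms \<phi> by (simp add: has_fourier_def)
qed

text \<open>
  This is what makes the choice of representative in \<open>fhat\<close> harmless: every identity between
  distributions becomes an almost everywhere identity between their transforms.
\<close>

lemma has_fourier_unique:
  assumes "has_fourier T g" "has_fourier T g'"
  shows "AE \<omega> in lborel. g \<omega> = g' \<omega>"
proof -
  have "has_fourier (\<lambda>\<phi>. 1 * T \<phi> + (-1) * T \<phi>) (\<lambda>\<omega>. 1 * g \<omega> + (-1) * g' \<omega>)"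
    using assms by (rule has_fourier_lincomb)
  then have "AE \<omega> in lborel. 1 * g \<omega> + (-1) * g' \<omega> = 0"
    by (intro locally_L2_eq_zero) (auto simp: has_fourier_def)
  then show ?thesis by simp
qed

lemma has_fourier_fhat: "has_fourier T g \<Longrightarrow> has_fourier T (fhat T)"
  unfolding fhat_def by (rule someI[of "has_fourier T"])

lemma AE_fhat_eq:
  assumes "has_fourier T g"
  shows "AE \<omega> in lborel. fhat T \<omega> = g \<omega>"
  using has_fourier_unique[OF has_fourier_fhat[OF assms] assms] .

lemma has_fourier_translate:
  assumes "has_fourier T g"
  shows "has_fourier (translate j T) (\<lambda>\<omega>. exp (- \<i> * of_real (j \<bullet> \<omega>)) * g \<omega>)"
  unfolding has_fourier_def
proof (intro conjI ballI)
  have "locally_L2 g" using assms by (simp add: has_fourier_def)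
  then show "locally_L2 (\<lambda>\<omega>. exp (- \<i> * of_real (j \<bullet> \<omega>)) * g \<omega>)"
    using borel_measurable_continuous_onI[OF smooth_continuous_on[OF smooth_exp[of j]]]
    by (auto simp: locally_L2_def norm_mult intro!: borel_measurable_times)
  fix \<phi> :: "real^'a \<Rightarrow> complex" assume \<phi>: "\<phi> \<in> smooth_compact_support"
  have "(\<lambda>x. fourier \<phi> (x + j)) = fourier (\<lambda>x. exp (- \<i> * of_real (j \<bullet> x)) * \<phi> x)"
    by (simp add: fourier_def fun_eq_iff inner_add_left distrib_left exp_add algebra_simps exp_diff exp_minus divide_inverse)
  moreover have "T (fourier (\<lambda>x. exp (- \<i> * of_real (j \<bullet> x)) * \<phi> x)) =
      (LINT \<omega>|lborel. g \<omega> * (exp (- \<i> * of_real (j \<bullet> \<omega>)) * \<phi> \<omega>))"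
    using assms test_function_mult[OF smooth_exp \<phi>, of j] unfolding has_fourier_def by blast
  ultimately show "translate j T (fourier \<phi>) =
      (LINT \<omega>|lborel. exp (- \<i> * of_real (j \<bullet> \<omega>)) * g \<omega> * \<phi> \<omega>)"
    by (simp add: translate_def mult_ac)
qed

lemma has_fourier_dilate:
  fixes g :: "real^'d::finite \<Rightarrow> complex"
  assumes T: "has_fourier T g" and h: "h > 0"
  shows "has_fourier (dilate h T) (\<lambda>\<omega>. of_real (h ^ CARD('d)) * g (h *\<^sub>R \<omega>))"
  unfolding has_fourier_def
proof (intro conjI ballI)
  have g: "locally_L2 g" using T by (simp add: has_fourier_def)
  then have [measurable]: "g \<in> borel_measurable borel" by (simp add: locally_L2_def)
  have "locally_L2 (\<lambda>\<omega>. g (h *\<^sub>R \<omega>))"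
    unfolding locally_L2_def
  proof (intro conjI allI impI)
    fix K :: "(real^'d) set" assume "compact K"
    then have "compact ((*\<^sub>R) h ` K)" by (rule compact_scaling)
    then have "integrable lborel (\<lambda>x. indicator ((*\<^sub>R) h ` K) x *\<^sub>R (cmod (g x))\<^sup>2)"
      using g by (auto simp: locally_L2_def set_integrable_def)
    from lborel_integrable_scale[OF this h]
    show "set_integrable lborel K (\<lambda>x. (cmod (g (h *\<^sub>R x)))\<^sup>2)"
      using h by (simp add: set_integrable_def indicator_def image_iff)
  qed simp
  from locally_L2_lincomb[OF this this, of "of_real (h ^ CARD('d))" 0]
  show "locally_L2 (\<lambda>\<omega>. of_real (h ^ CARD('d)) * g (h *\<^sub>R \<omega>))" by simp
  fix \<phi> :: "real^'d \<Rightarrow> complex" assume \<phi>: "\<phi> \<in> smooth_compact_support"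
  have [measurable]: "\<phi> \<in> borel_measurable borel" using \<phi> by (rule test_function_borel)
  \<comment> \<open>normalized so that its transform at \<open>x\<close> is the transform of \<open>\<phi>\<close> at \<open>h x\<close>\<close>
  define \<psi> where "\<psi> = (\<lambda>\<omega>. inverse (of_real (h ^ CARD('d))) * \<phi> (inverse h *\<^sub>R \<omega>))"
  have \<psi>: "\<psi> \<in> smooth_compact_support"
    unfolding \<psi>_def using h \<phi> by (intro test_function_mult smooth_const test_function_scale) auto
  have [measurable]: "\<psi> \<in> borel_measurable borel" using \<psi> by (rule test_function_borel)
  have \<psi>h: "of_real (h ^ CARD('d)) * \<psi> (h *\<^sub>R x) = \<phi> x" for x
    using h by (simp add: \<psi>_def)
  have "(\<lambda>x. fourier \<phi> (h *\<^sub>R x)) = fourier \<psi>"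
  proof
    fix x
    have "fourier \<psi> x = (LINT y|lborel. of_real (h ^ CARD('d)) * \<psi> (h *\<^sub>R y) * exp (- \<i> * of_real (x \<bullet> (h *\<^sub>R y))))"
      unfolding fourier_def by (subst lborel_integral_scale[OF _ h]) (auto simp: scaleR_conv_of_real mult.assoc)
    then show "fourier \<phi> (h *\<^sub>R x) = fourier \<psi> x"
      unfolding \<psi>h by (simp add: fourier_def)
  qed
  then have "dilate h T (fourier \<phi>) = of_real (h ^ CARD('d)) * (LINT \<omega>|lborel. g \<omega> * \<psi> \<omega>)"
    using T \<psi> by (simp add: dilate_def has_fourier_def)
  also have "\<dots> = of_real (h ^ CARD('d)) * (LINT \<omega>|lborel. g (h *\<^sub>R \<omega>) * (of_real (h ^ CARD('d)) * \<psi> (h *\<^sub>R \<omega>)))"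
    by (subst lborel_integral_scale[OF _ h]) (auto simp: scaleR_conv_of_real mult_ac)
  also have "\<dots> = (LINT \<omega>|lborel. of_real (h ^ CARD('d)) * g (h *\<^sub>R \<omega>) * \<phi> \<omega>)"
    unfolding \<psi>h by (simp add: mult.assoc)
  finally show "dilate h T (fourier \<phi>) = (LINT \<omega>|lborel. of_real (h ^ CARD('d)) * g (h *\<^sub>R \<omega>) * \<phi> \<omega>)" .
qed

section \<open>Tempered distributions\<close>

lemma has_derivative_translate_iff:
  fixes \<psi> :: "real^'d::finite \<Rightarrow> complex"
  shows "((\<lambda>x. \<psi> (x + a)) has_derivative D) (at x) \<longleftrightarrow> (\<psi> has_derivative D) (at (x + a))"
proof -
  have shift: "((\<lambda>y. y + b) has_derivative (\<lambda>y. y)) (at y)" for b y :: "real^'d"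
    by (intro has_derivative_add_const has_derivative_ident)
  have "((\<lambda>x. \<eta> (x + b)) has_derivative D) (at y)" if "(\<eta> has_derivative D) (at (y + b))"
    for \<eta> :: "real^'d \<Rightarrow> complex" and b y
    using has_derivative_compose[of "\<lambda>y. y + b" "\<lambda>y. y" y UNIV \<eta> D, OF shift that] .
  from this[of \<psi> x a] this[of "\<lambda>x. \<psi> (x + a)" "x + a" "- a"] show ?thesis
    by auto
qed

lemma iter_deriv_translate:
  fixes \<phi> :: "real^'d::finite \<Rightarrow> complex"
  shows "iter_deriv bs (\<lambda>x. \<phi> (x + a)) = (\<lambda>x. iter_deriv bs \<phi> (x + a))"
proof (induction bs)
  case (Cons b bs)
  have "partial_deriv b (\<lambda>x. \<psi> (x + a)) x = partial_deriv b \<psi> (x + a)" for \<psi> :: "real^'d \<Rightarrow> complex" and x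
    by (simp add: partial_deriv_def frechet_derivative_def has_derivative_translate_iff)
  moreover have "iter_deriv (b # bs) \<psi> = partial_deriv b (iter_deriv bs \<psi>)" for \<psi> :: "real^'d \<Rightarrow> complex"
    by (simp add: iter_deriv_def)
  ultimately show ?case by (simp add: Cons fun_eq_iff)
qed (simp add: iter_deriv_def)

text \<open>
  Peetre's inequality, the reason why translations act continuously on the Schwartz space.
\<close>

lemma one_plus_norm_translate: "1 + norm (x :: 'a::real_normed_vector) \<le> (1 + norm a) * (1 + norm (x + a))"
proof -
  have "norm x \<le> norm (x + a) + norm a"
    using norm_triangle_ineq4[of "x + a" a] by simp
  moreover have "0 \<le> norm a * norm (x + a)" by simp
  ultimately show ?thesis unfolding distrib_left distrib_right by linarith
qed

lemma schwartz_translate: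
  assumes "\<phi> \<in> schwartz"
  shows "(\<lambda>x. \<phi> (x + a)) \<in> schwartz"
proof -
  have "smooth (\<lambda>x. \<phi> (x + a))"
    using assms by (simp add: smooth_def schwartz_def iter_deriv_translate differentiable_def has_derivative_translate_iff)
  moreover have "bounded (range (\<lambda>x. (1 + norm x) ^ N *\<^sub>R iter_deriv bs (\<lambda>x. \<phi> (x + a)) x))"
    if "set bs \<subseteq> Basis" for N bs
  proof -
    have "bounded (range (\<lambda>x. (1 + norm x) ^ N *\<^sub>R iter_deriv bs \<phi> x))"
      using assms that by (simp add: schwartz_def)
    then obtain B where B: "\<And>x. norm ((1 + norm x) ^ N *\<^sub>R iter_deriv bs \<phi> x) \<le> B"
      unfolding bounded_iff by blast
    have "norm ((1 + norm x) ^ N *\<^sub>R iter_deriv bs (\<lambda>x. \<phi> (x + a)) x) \<le> (1 + norm a) ^ N * B" for x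
    proof -
      have "(1 + norm x) ^ N * cmod (iter_deriv bs \<phi> (x + a)) \<le>
          ((1 + norm a) * (1 + norm (x + a))) ^ N * cmod (iter_deriv bs \<phi> (x + a))"
        by (intro mult_right_mono power_mono one_plus_norm_translate) auto
      also have "\<dots> \<le> (1 + norm a) ^ N * B"
        using B[of "x + a"] by (simp add: power_mult_distrib mult.assoc mult_left_mono)
      finally show ?thesis by (simp add: iter_deriv_translate)
    qed
    then show ?thesis by (auto simp: bounded_iff)
  qed
  ultimately show ?thesis by (simp add: schwartz_def)
qed

lemma schwartz_translate_iff: "(\<lambda>x. \<phi> (x + a)) \<in> schwartz \<longleftrightarrow> \<phi> \<in> schwartz"
  using schwartz_translate[of \<phi> a] schwartz_translate[of "\<lambda>x. \<phi> (x + a)" "- a"] by auto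

lemma schwartz_seminorm_upper:
  assumes "\<phi> \<in> schwartz" "set bs \<subseteq> Basis" "length bs \<le> N"
  shows "(1 + norm x) ^ N * cmod (iter_deriv bs \<phi> x) \<le> schwartz_seminorm N \<phi>"
proof -
  let ?B = "{bs :: (real^'a) list. set bs \<subseteq> Basis \<and> length bs \<le> N}"
  let ?f = "\<lambda>x bs. (1 + norm x) ^ N * cmod (iter_deriv bs \<phi> x)"
  have fin: "finite ?B" by (rule finite_lists_length_le) simp
  have "\<exists>B. \<forall>x. ?f x bs \<le> B" if "bs \<in> ?B" for bs
  proof -
    have "bounded (range (\<lambda>x. (1 + norm x) ^ N *\<^sub>R iter_deriv bs \<phi> x))"
      using assms(1) that by (simp add: schwartz_def)
    then obtain B where "\<And>x. norm ((1 + norm x) ^ N *\<^sub>R iter_deriv bs \<phi> x) \<le> B"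
      unfolding bounded_iff by blast
    then show ?thesis by auto
  qed
  then have "\<forall>bs\<in>?B. \<exists>B. \<forall>x. ?f x bs \<le> B" by blast
  from bchoice[OF this] obtain B where B: "\<And>x bs. bs \<in> ?B \<Longrightarrow> ?f x bs \<le> B bs"
    by auto
  have "bdd_above ((\<lambda>(x, bs). ?f x bs) ` (UNIV \<times> ?B))"
  proof (rule bdd_aboveI2)
    fix p :: "(real^'a) \<times> (real^'a) list" assume p: "p \<in> UNIV \<times> ?B"
    then have "?f (fst p) (snd p) \<le> \<bar>B (snd p)\<bar>"
      using B[of "snd p" "fst p"] by (auto simp: mem_Times_iff)
    also have "\<dots> \<le> (\<Sum>bs\<in>?B. \<bar>B bs\<bar>)"
      using p fin by (intro member_le_sum) auto
    finally show "(\<lambda>(x, bs). ?f x bs) p \<le> (\<Sum>bs\<in>?B. \<bar>B bs\<bar>)"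
      by (simp add: case_prod_beta)
  qed
  from cSUP_upper[OF _ this, of "(x, bs)"] show ?thesis
    using assms by (simp add: schwartz_seminorm_def)
qed

lemma schwartz_seminorm_least:
  assumes "\<And>x bs. set bs \<subseteq> Basis \<Longrightarrow> length bs \<le> N \<Longrightarrow> (1 + norm x) ^ N * cmod (iter_deriv bs \<phi> x) \<le> B"
  shows "schwartz_seminorm N \<phi> \<le> B"
  unfolding schwartz_seminorm_def
proof (rule cSUP_least)
  have "[] \<in> {bs :: (real^'a) list. set bs \<subseteq> Basis \<and> length bs \<le> N}" by simp
  then show "UNIV \<times> {bs :: (real^'a) list. set bs \<subseteq> Basis \<and> length bs \<le> N} \<noteq> {}" by blast
qed (use assms in auto)

lemma schwartz_seminorm_nonneg:
  assumes "\<phi> \<in> schwartz"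
  shows "0 \<le> schwartz_seminorm N \<phi>"
  by (rule order_trans[OF _ schwartz_seminorm_upper[OF assms, of "[]" N 0]]) auto

lemma schwartz_seminorm_mono:
  assumes "\<phi> \<in> schwartz" "N \<le> M"
  shows "schwartz_seminorm N \<phi> \<le> schwartz_seminorm M \<phi>"
proof (rule schwartz_seminorm_least)
  fix x and bs :: "(real^'a) list" assume bs: "set bs \<subseteq> Basis" "length bs \<le> N"
  have "(1 + norm x) ^ N * cmod (iter_deriv bs \<phi> x) \<le> (1 + norm x) ^ M * cmod (iter_deriv bs \<phi> x)"
    using assms by (intro mult_right_mono power_increasing) auto
  also have "\<dots> \<le> schwartz_seminorm M \<phi>"
    using assms bs by (intro schwartz_seminorm_upper) auto
  finally show "(1 + norm x) ^ N * cmod (iter_deriv bs \<phi> x) \<le> schwartz_seminorm M \<phi>" .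
qed

lemma schwartz_seminorm_translate:
  assumes "\<phi> \<in> schwartz"
  shows "schwartz_seminorm N (\<lambda>x. \<phi> (x + a)) \<le> (1 + norm a) ^ N * schwartz_seminorm N \<phi>"
proof (rule schwartz_seminorm_least)
  fix x and bs :: "(real^'a) list" assume bs: "set bs \<subseteq> Basis" "length bs \<le> N"
  have "(1 + norm x) ^ N * cmod (iter_deriv bs \<phi> (x + a)) \<le>
      ((1 + norm a) * (1 + norm (x + a))) ^ N * cmod (iter_deriv bs \<phi> (x + a))"
    by (intro mult_right_mono power_mono one_plus_norm_translate) auto
  also have "\<dots> \<le> (1 + norm a) ^ N * schwartz_seminorm N \<phi>"
    using schwartz_seminorm_upper[OF assms bs, of "x + a"]
    by (simp add: power_mult_distrib mult.assoc mult_left_mono)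
  finally show "(1 + norm x) ^ N * cmod (iter_deriv bs (\<lambda>x. \<phi> (x + a)) x) \<le> (1 + norm a) ^ N * schwartz_seminorm N \<phi>"
    by (simp add: iter_deriv_translate)
qed

lemma tempered_bound:
  assumes "T \<in> tempered"
  obtains C N where "0 \<le> C" "\<And>\<phi>. \<phi> \<in> schwartz \<Longrightarrow> cmod (T \<phi>) \<le> C * schwartz_seminorm N \<phi>"
proof -
  have "\<exists>C N. \<forall>\<phi>\<in>schwartz. cmod (T \<phi>) \<le> C * schwartz_seminorm N \<phi>"
    using assms by (simp add: tempered_def)
  then obtain C N where C: "\<And>\<phi>. \<phi> \<in> schwartz \<Longrightarrow> cmod (T \<phi>) \<le> C * schwartz_seminorm N \<phi>"
    by blast
  have "cmod (T \<phi>) \<le> \<bar>C\<bar> * schwartz_seminorm N \<phi>" if "\<phi> \<in> schwartz" for \<phi>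
    using C[OF that] by (rule order_trans) (intro mult_right_mono schwartz_seminorm_nonneg that abs_ge_self)
  then show ?thesis by (intro that[of "\<bar>C\<bar>" N]) auto
qed

lemma tempered_lincomb:
  assumes T: "T \<in> tempered" and U: "U \<in> tempered"
  shows "(\<lambda>\<phi>. a * T \<phi> + b * U \<phi>) \<in> tempered"
proof -
  obtain C N where C: "0 \<le> C" "\<And>\<phi>. \<phi> \<in> schwartz \<Longrightarrow> cmod (T \<phi>) \<le> C * schwartz_seminorm N \<phi>"
    using tempered_bound[OF T] by blast
  obtain D M where D: "0 \<le> D" "\<And>\<phi>. \<phi> \<in> schwartz \<Longrightarrow> cmod (U \<phi>) \<le> D * schwartz_seminorm M \<phi>"
    using tempered_bound[OF U] by blast
  have "cmod (a * T \<phi> + b * U \<phi>) \<le> (cmod a * C + cmod b * D) * schwartz_seminorm (max N M) \<phi>"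
    if \<phi>: "\<phi> \<in> schwartz" for \<phi>
  proof -
    have "cmod (T \<phi>) \<le> C * schwartz_seminorm (max N M) \<phi>" "cmod (U \<phi>) \<le> D * schwartz_seminorm (max N M) \<phi>"
      using C D \<phi> by (auto intro!: order_trans[OF C(2)] order_trans[OF D(2)] mult_left_mono schwartz_seminorm_mono)
    then have "cmod a * cmod (T \<phi>) + cmod b * cmod (U \<phi>) \<le>
        cmod a * (C * schwartz_seminorm (max N M) \<phi>) + cmod b * (D * schwartz_seminorm (max N M) \<phi>)"
      by (intro add_mono mult_left_mono) auto
    then show ?thesis
      using norm_triangle_ineq[of "a * T \<phi>" "b * U \<phi>"] by (simp add: norm_mult algebra_simps)
  qed
  then have "\<exists>C N. \<forall>\<phi>\<in>schwartz. cmod (a * T \<phi> + b * U \<phi>) \<le> C * schwartz_seminorm N \<phi>"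
    by blast
  moreover have "a * T (\<lambda>x. c * \<phi> x + d * \<psi> x) + b * U (\<lambda>x. c * \<phi> x + d * \<psi> x) =
      c * (a * T \<phi> + b * U \<phi>) + d * (a * T \<psi> + b * U \<psi>)"
    if "\<phi> \<in> schwartz" "\<psi> \<in> schwartz" for c d \<phi> \<psi>
  proof -
    have "T (\<lambda>x. c * \<phi> x + d * \<psi> x) = c * T \<phi> + d * T \<psi>" "U (\<lambda>x. c * \<phi> x + d * \<psi> x) = c * U \<phi> + d * U \<psi>"
      using T U that by (simp_all add: tempered_def)
    then show ?thesis by (simp add: algebra_simps)
  qed
  moreover have "a * T \<phi> + b * U \<phi> = 0" if "\<phi> \<notin> schwartz" for \<phi>
    using T U that by (simp add: tempered_def)
  ultimately show ?thesis
    by (simp add: tempered_def)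
qed

lemma tempered_translate:
  assumes T: "T \<in> tempered"
  shows "translate j T \<in> tempered"
proof -
  obtain C N where C: "0 \<le> C" "\<And>\<phi>. \<phi> \<in> schwartz \<Longrightarrow> cmod (T \<phi>) \<le> C * schwartz_seminorm N \<phi>"
    using tempered_bound[OF T] by blast
  have "cmod (translate j T \<phi>) \<le> C * (1 + norm j) ^ N * schwartz_seminorm N \<phi>"
    if \<phi>: "\<phi> \<in> schwartz" for \<phi>
    using C(2)[OF schwartz_translate[OF \<phi>, of j]] mult_left_mono[OF schwartz_seminorm_translate[OF \<phi>, of N j] C(1)]
    by (simp add: translate_def mult.assoc)
  then have "\<exists>C N. \<forall>\<phi>\<in>schwartz. cmod (translate j T \<phi>) \<le> C * schwartz_seminorm N \<phi>"
    by blast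
  moreover have "translate j T (\<lambda>x. a * \<phi> x + b * \<psi> x) = a * translate j T \<phi> + b * translate j T \<psi>"
    if "\<phi> \<in> schwartz" "\<psi> \<in> schwartz" for a b \<phi> \<psi>
    using T that schwartz_translate[of \<phi> j] schwartz_translate[of \<psi> j]
    by (simp add: tempered_def translate_def)
  moreover have "translate j T \<phi> = 0" if "\<phi> \<notin> schwartz" for \<phi>
    using T that schwartz_translate_iff[of \<phi> j] by (simp add: tempered_def translate_def)
  ultimately show ?thesis by (simp add: tempered_def)
qed

section \<open>Weighted energies and Sobolev spaces\<close>

text \<open>
  The squared \<open>W\<^sub>2\<^sup>s\<close> norm of the distribution with Fourier transform \<open>u\<close>. As an element of
  \<open>[0,\<infinity>]\<close> it is monotone and subadditive up to a factor without integrability conditions, unlike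
  the Bochner integral, which is 0 on functions that are not integrable.
\<close>

definition energy :: "real \<Rightarrow> (real^'d \<Rightarrow> complex) \<Rightarrow> ennreal" where
  "energy s u = (\<integral>\<^sup>+\<omega>. ennreal ((1 + norm \<omega>) powr (2 * s) * (cmod (u \<omega>))\<^sup>2) \<partial>lborel)"

lemma energy_cong_AE:
  "AE \<omega> in lborel. u \<omega> = v \<omega> \<Longrightarrow> energy s u = energy s v"
  unfolding energy_def by (rule nn_integral_cong_AE) auto

lemma energy_zero [simp]: "energy s (\<lambda>\<omega>. 0) = 0"
  by (simp add: energy_def)

lemma energy_cmult:
  assumes [measurable]: "u \<in> borel_measurable borel"
  shows "energy s (\<lambda>\<omega>. c * u \<omega>) = ennreal ((cmod c)\<^sup>2) * energy s u"
proof -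
  have "energy s (\<lambda>\<omega>. c * u \<omega>) =
      (\<integral>\<^sup>+\<omega>. ennreal ((cmod c)\<^sup>2) * ennreal ((1 + norm \<omega>) powr (2 * s) * (cmod (u \<omega>))\<^sup>2) \<partial>lborel)"
    unfolding energy_def by (simp add: norm_mult power_mult_distrib mult_ac flip: ennreal_mult)
  also have "\<dots> = ennreal ((cmod c)\<^sup>2) * energy s u"
    unfolding energy_def by (rule nn_integral_cmult) simp
  finally show ?thesis .
qed

lemma energy_add:
  assumes [measurable]: "u \<in> borel_measurable borel" "v \<in> borel_measurable borel"
  shows "energy s (\<lambda>\<omega>. u \<omega> + v \<omega>) \<le> 2 * energy s u + 2 * energy s v"
proof -
  let ?w = "\<lambda>\<omega>. (1 + norm \<omega>) powr (2 * s)"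
  have "energy s (\<lambda>\<omega>. u \<omega> + v \<omega>) \<le>
      (\<integral>\<^sup>+\<omega>. 2 * ennreal (?w \<omega> * (cmod (u \<omega>))\<^sup>2) + 2 * ennreal (?w \<omega> * (cmod (v \<omega>))\<^sup>2) \<partial>lborel)"
    unfolding energy_def
  proof (intro nn_integral_mono)
    fix \<omega>
    have "?w \<omega> * (cmod (u \<omega> + v \<omega>))\<^sup>2 \<le> ?w \<omega> * (2 * (cmod (u \<omega>))\<^sup>2 + 2 * (cmod (v \<omega>))\<^sup>2)"
      by (intro mult_left_mono norm_add_square_le) auto
    then have "ennreal (?w \<omega> * (cmod (u \<omega> + v \<omega>))\<^sup>2) \<le>
        ennreal (2 * (?w \<omega> * (cmod (u \<omega>))\<^sup>2) + 2 * (?w \<omega> * (cmod (v \<omega>))\<^sup>2))"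
      by (intro ennreal_leI) (simp add: algebra_simps)
    also have "\<dots> = ennreal 2 * ennreal (?w \<omega> * (cmod (u \<omega>))\<^sup>2) + ennreal 2 * ennreal (?w \<omega> * (cmod (v \<omega>))\<^sup>2)"
      by (subst ennreal_plus) (simp_all add: ennreal_mult)
    finally show "ennreal (?w \<omega> * (cmod (u \<omega> + v \<omega>))\<^sup>2) \<le>
        2 * ennreal (?w \<omega> * (cmod (u \<omega>))\<^sup>2) + 2 * ennreal (?w \<omega> * (cmod (v \<omega>))\<^sup>2)"
      by simp
  qed
  also have "\<dots> = 2 * energy s u + 2 * energy s v"
    unfolding energy_def by (simp add: nn_integral_add nn_integral_cmult)
  finally show ?thesis .
qed

lemma energy_diff_triangle:
  assumes [measurable]: "u \<in> borel_measurable borel" "v \<in> borel_measurable borel" "w \<in> borel_measurable borel"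
  shows "energy s (\<lambda>\<omega>. u \<omega> - w \<omega>) \<le> 2 * energy s (\<lambda>\<omega>. u \<omega> - v \<omega>) + 2 * energy s (\<lambda>\<omega>. v \<omega> - w \<omega>)"
  using energy_add[of "\<lambda>\<omega>. u \<omega> - v \<omega>" "\<lambda>\<omega>. v \<omega> - w \<omega>" s] by simp

lemma energy_dominated_tendsto:
  assumes [measurable]: "\<And>n. u n \<in> borel_measurable borel" "v \<in> borel_measurable borel" "w \<in> borel_measurable borel"
    and lim: "AE \<omega> in lborel. (\<lambda>n. u n \<omega>) \<longlonglongrightarrow> v \<omega>"
    and bound: "\<And>n. AE \<omega> in lborel. cmod (u n \<omega> - v \<omega>) \<le> cmod (w \<omega>)"
    and fin: "energy s w < \<infinity>"
  shows "(\<lambda>n. energy s (\<lambda>\<omega>. u n \<omega> - v \<omega>)) \<longlonglongrightarrow> 0"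
proof -
  have "(\<lambda>n. energy s (\<lambda>\<omega>. u n \<omega> - v \<omega>)) \<longlonglongrightarrow> (\<integral>\<^sup>+(\<omega> :: real^'a). 0 \<partial>lborel)"
    unfolding energy_def
  proof (rule nn_integral_dominated_convergence)
    show "(\<integral>\<^sup>+\<omega>. ennreal ((1 + norm \<omega>) powr (2 * s) * (cmod (w \<omega>))\<^sup>2) \<partial>lborel) < \<infinity>"
      using fin by (simp add: energy_def)
    show "AE \<omega> in lborel. ennreal ((1 + norm \<omega>) powr (2 * s) * (cmod (u n \<omega> - v \<omega>))\<^sup>2)
        \<le> ennreal ((1 + norm \<omega>) powr (2 * s) * (cmod (w \<omega>))\<^sup>2)" for n
      using bound[of n] by eventually_elim (auto intro!: ennreal_leI mult_left_mono power_mono)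
    show "AE \<omega> in lborel. (\<lambda>n. ennreal ((1 + norm \<omega>) powr (2 * s) * (cmod (u n \<omega> - v \<omega>))\<^sup>2)) \<longlonglongrightarrow> 0"
      using lim
    proof eventually_elim
      case (elim \<omega>)
      then have "(\<lambda>n. u n \<omega> - v \<omega>) \<longlonglongrightarrow> 0" by (rule LIM_zero)
      then have "(\<lambda>n. (1 + norm \<omega>) powr (2 * s) * (cmod (u n \<omega> - v \<omega>))\<^sup>2) \<longlonglongrightarrow> (1 + norm \<omega>) powr (2 * s) * (cmod 0)\<^sup>2"
        by (intro tendsto_intros)
      from tendsto_ennrealI[OF this] show ?case by simp
    qed
  qed auto
  then show ?thesis by simp
qed

text \<open>
  Here \<open>s \<le> 0\<close> enters: the weight decreases, and \<open>1 + |\<omega>| \<le> max 1 c * (1 + |\<omega>|/c)\<close> bounds the weight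
  at \<open>\<omega>/c\<close> by a multiple of the weight at \<open>\<omega>\<close>.
\<close>

lemma energy_scale:
  fixes u :: "real^'d::finite \<Rightarrow> complex"
  assumes [measurable]: "u \<in> borel_measurable borel" and c: "c > 0" and s: "s \<le> 0"
  shows "energy s (\<lambda>\<omega>. u (c *\<^sub>R \<omega>)) \<le> ennreal (inverse c ^ CARD('d) * max 1 c powr (- 2 * s)) * energy s u"
proof -
  let ?w = "\<lambda>\<omega> :: real^'d. (1 + norm \<omega>) powr (2 * s)"
  have "?w (inverse c *\<^sub>R \<omega>) \<le> max 1 c powr (- 2 * s) * ?w \<omega>" for \<omega>
  proof -
    have "max 1 c * (1 + inverse c * norm \<omega>) \<ge> 1 + norm \<omega>"
    proof (cases "c \<ge> 1")
      case True
      then show ?thesis using c by (simp add: max_def field_simps)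
    next
      case False
      then have "1 * norm \<omega> \<le> inverse c * norm \<omega>"
        using c by (intro mult_right_mono) (auto simp: field_simps)
      then show ?thesis using False by (simp add: max_def)
    qed
    then have "(max 1 c * (1 + inverse c * norm \<omega>)) powr (2 * s) \<le> ?w \<omega>"
      using s by (intro powr_mono2') (auto simp: add_pos_nonneg)
    moreover have "(max 1 c * (1 + inverse c * norm \<omega>)) powr (2 * s) = max 1 c powr (2 * s) * ?w (inverse c *\<^sub>R \<omega>)"
      using c by (subst powr_mult) auto
    ultimately have "max 1 c powr (- 2 * s) * (max 1 c powr (2 * s) * ?w (inverse c *\<^sub>R \<omega>)) \<le> max 1 c powr (- 2 * s) * ?w \<omega>"
      by (intro mult_left_mono) auto
    moreover have "max 1 c powr (- 2 * s) * max 1 c powr (2 * s) = 1"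
      by (simp flip: powr_add)
    ultimately show ?thesis by (simp flip: mult.assoc)
  qed
  then have le: "ennreal (?w (inverse c *\<^sub>R \<omega>) * (cmod (u \<omega>))\<^sup>2) \<le>
      ennreal (max 1 c powr (- 2 * s)) * ennreal (?w \<omega> * (cmod (u \<omega>))\<^sup>2)" for \<omega>
    by (subst ennreal_mult[symmetric]) (auto intro!: ennreal_leI mult_right_mono simp flip: mult.assoc)
  have "energy s (\<lambda>\<omega>. u (c *\<^sub>R \<omega>)) = (\<integral>\<^sup>+\<omega>. ennreal (?w (inverse c *\<^sub>R (c *\<^sub>R \<omega>)) * (cmod (u (c *\<^sub>R \<omega>)))\<^sup>2) \<partial>lborel)"
    unfolding energy_def using c by simp
  also have "\<dots> = ennreal (inverse c ^ CARD('d)) * (\<integral>\<^sup>+\<omega>. ennreal (?w (inverse c *\<^sub>R \<omega>) * (cmod (u \<omega>))\<^sup>2) \<partial>lborel)"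
    using nn_integral_lborel_scale[of "\<lambda>\<omega>. ennreal (?w (inverse c *\<^sub>R \<omega>) * (cmod (u \<omega>))\<^sup>2)" c] c by simp
  also have "\<dots> \<le> ennreal (inverse c ^ CARD('d)) * (\<integral>\<^sup>+\<omega>. ennreal (max 1 c powr (- 2 * s)) * ennreal (?w \<omega> * (cmod (u \<omega>))\<^sup>2) \<partial>lborel)"
    by (intro mult_left_mono nn_integral_mono le) auto
  also have "\<dots> = ennreal (inverse c ^ CARD('d) * max 1 c powr (- 2 * s)) * energy s u"
    using c unfolding energy_def by (subst nn_integral_cmult) (auto simp: ennreal_mult mult.assoc)
  finally show ?thesis .
qed

lemma sobolev_has_fourier: "T \<in> sobolev s \<Longrightarrow> has_fourier T (fhat T)"
  by (auto simp: sobolev_def intro: has_fourier_fhat)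

lemma sobolev_borel: "T \<in> sobolev s \<Longrightarrow> fhat T \<in> borel_measurable borel"
  by (blast intro: has_fourier_borel sobolev_has_fourier)

lemma integrable_energy_iff:
  assumes [measurable]: "u \<in> borel_measurable borel"
  shows "integrable lborel (\<lambda>\<omega>. (1 + norm \<omega>) powr (2 * s) * (cmod (u \<omega>))\<^sup>2) \<longleftrightarrow> energy s u < \<infinity>"
  unfolding energy_def by (subst integrable_iff_bounded) auto

lemma sobolevI:
  assumes "T \<in> tempered" "has_fourier T g" "energy s g < \<infinity>"
  shows "T \<in> sobolev s"
proof -
  have "energy s (fhat T) < \<infinity>"
    using assms energy_cong_AE[OF AE_fhat_eq[OF assms(2)]] by simp
  then show ?thesis
    using assms integrable_energy_iff[OF has_fourier_borel[OF has_fourier_fhat[OF assms(2)]]]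
    by (auto simp: sobolev_def)
qed

lemma sobolev_energy: "T \<in> sobolev s \<Longrightarrow> energy s (fhat T) < \<infinity>"
  using integrable_energy_iff[OF sobolev_borel, of T s s] by (simp add: sobolev_def)

lemma sobolev_norm_eq_energy:
  assumes "has_fourier T g"
  shows "sobolev_norm s T = sqrt (enn2real (energy s g))"
proof -
  have [measurable]: "fhat T \<in> borel_measurable borel"
    using has_fourier_borel[OF has_fourier_fhat[OF assms]] .
  have "(LINT \<omega>|lborel. (1 + norm \<omega>) powr (2 * s) * (cmod (fhat T \<omega>))\<^sup>2) = enn2real (energy s (fhat T))"
    unfolding energy_def by (intro integral_eq_nn_integral) auto
  then show ?thesis
    using energy_cong_AE[OF AE_fhat_eq[OF assms]] by (simp add: sobolev_norm_def)
qed

lemma energy_lincomb_finite: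
  assumes [measurable]: "u \<in> borel_measurable borel" "v \<in> borel_measurable borel"
    and fin: "energy s u < \<infinity>" "energy s v < \<infinity>"
  shows "energy s (\<lambda>\<omega>. a * u \<omega> + b * v \<omega>) < \<infinity>"
proof -
  have "energy s (\<lambda>\<omega>. a * u \<omega> + b * v \<omega>) \<le> 2 * (ennreal ((cmod a)\<^sup>2) * energy s u) + 2 * (ennreal ((cmod b)\<^sup>2) * energy s v)"
    using energy_add[of "\<lambda>\<omega>. a * u \<omega>" "\<lambda>\<omega>. b * v \<omega>" s] by (simp add: energy_cmult)
  also have "\<dots> < \<infinity>"
    using fin by (simp add: ennreal_mult_less_top)
  finally show ?thesis .
qed

lemma sobolev_lincomb:
  assumes "T \<in> sobolev s" "U \<in> sobolev s"
  shows "(\<lambda>\<phi>. a * T \<phi> + b * U \<phi>) \<in> sobolev s"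
proof (rule sobolevI)
  show "(\<lambda>\<phi>. a * T \<phi> + b * U \<phi>) \<in> tempered"
    using assms by (intro tempered_lincomb) (auto simp: sobolev_def)
  show "has_fourier (\<lambda>\<phi>. a * T \<phi> + b * U \<phi>) (\<lambda>\<omega>. a * fhat T \<omega> + b * fhat U \<omega>)"
    using assms by (intro has_fourier_lincomb sobolev_has_fourier)
  show "energy s (\<lambda>\<omega>. a * fhat T \<omega> + b * fhat U \<omega>) < \<infinity>"
    using assms by (intro energy_lincomb_finite sobolev_energy sobolev_borel)
qed

lemma AE_fhat_lincomb:
  assumes "T \<in> sobolev s" "U \<in> sobolev s"
  shows "AE \<omega> in lborel. fhat (\<lambda>\<phi>. a * T \<phi> + b * U \<phi>) \<omega> = a * fhat T \<omega> + b * fhat U \<omega>"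
  using assms by (intro AE_fhat_eq has_fourier_lincomb sobolev_has_fourier)

lemma energy_modulation:
  "energy s (\<lambda>\<omega>. exp (- \<i> * of_real (j \<bullet> \<omega>)) * u \<omega>) = energy s u"
  by (simp add: energy_def norm_mult)

lemma sobolev_translate:
  assumes "T \<in> sobolev s"
  shows "translate j T \<in> sobolev s"
proof (rule sobolevI)
  show "translate j T \<in> tempered"
    using assms by (intro tempered_translate) (auto simp: sobolev_def)
  show "has_fourier (translate j T) (\<lambda>\<omega>. exp (- \<i> * of_real (j \<bullet> \<omega>)) * fhat T \<omega>)"
    using assms by (intro has_fourier_translate sobolev_has_fourier)
  show "energy s (\<lambda>\<omega>. exp (- \<i> * of_real (j \<bullet> \<omega>)) * fhat T \<omega>) < \<infinity>"
    using sobolev_energy[OF assms] by (simp only: energy_modulation)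
qed

lemma zero_tempered: "(\<lambda>\<phi>. 0) \<in> tempered"
  by (auto simp: tempered_def intro!: exI[of _ 0])

lemma has_fourier_zero: "has_fourier (\<lambda>\<phi>. 0) (\<lambda>\<omega>. 0)"
  by (auto simp: has_fourier_def locally_L2_def set_integrable_def)

lemma zero_sobolev: "(\<lambda>\<phi>. 0) \<in> sobolev s"
  by (rule sobolevI[OF zero_tempered has_fourier_zero]) simp

lemma closed_sobolev_subspace_sobolev: "closed_sobolev_subspace s (sobolev s)"
  unfolding closed_sobolev_subspace_def
  using zero_sobolev sobolev_lincomb[of _ s _ 1 1] sobolev_lincomb[of _ s _ _ 0] by auto

section \<open>The shift-invariant space on the Fourier side\<close>

text \<open>
  The space \<open>W\<^sub>2\<^sup>s\<close> is itself closed and shift-invariant, so the family of subspaces whose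
  intersection defines \<open>shift_inv_space\<close> is not empty.
\<close>

lemma shift_inv_space_subset_sobolev:
  assumes "\<And>i. \<Phi> $ i \<in> sobolev s"
  shows "shift_inv_space s \<Phi> \<subseteq> sobolev s"
  unfolding shift_inv_space_def
  by (rule Inter_lower) (auto simp: closed_sobolev_subspace_sobolev assms sobolev_translate)

lemma shift_inv_space_least:
  assumes "closed_sobolev_subspace s V" "\<And>i. \<Phi> $ i \<in> V"
    "\<And>T j. T \<in> V \<Longrightarrow> j \<in> int_lattice \<Longrightarrow> translate j T \<in> V"
  shows "shift_inv_space s \<Phi> \<subseteq> V"
  unfolding shift_inv_space_def using assms by (intro Inter_lower) auto

lemma shift_inv_space_zero: "(\<lambda>\<phi>. 0) \<in> shift_inv_space s \<Phi>"
  by (auto simp: shift_inv_space_def closed_sobolev_subspace_def)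

lemma shift_inv_space_generator: "\<Phi> $ i \<in> shift_inv_space s \<Phi>"
  by (auto simp: shift_inv_space_def)

lemma shift_inv_space_lincomb:
  assumes "T \<in> shift_inv_space s \<Phi>" "U \<in> shift_inv_space s \<Phi>"
  shows "(\<lambda>\<phi>. a * T \<phi> + b * U \<phi>) \<in> shift_inv_space s \<Phi>"
  unfolding shift_inv_space_def
proof (rule InterI)
  fix V assume V: "V \<in> {V. closed_sobolev_subspace s V \<and> (\<forall>i. \<Phi> $ i \<in> V) \<and> (\<forall>T\<in>V. \<forall>j\<in>int_lattice. translate j T \<in> V)}"
  have TU: "T \<in> V" "U \<in> V"
    using assms V unfolding shift_inv_space_def by (auto dest: InterD)
  have closed: "closed_sobolev_subspace s V" using V by simp
  have "(\<lambda>\<phi>. a * T \<phi>) \<in> V" "(\<lambda>\<phi>. b * U \<phi>) \<in> V"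
    using closed TU by (simp_all add: closed_sobolev_subspace_def)
  moreover have add: "\<forall>T\<in>V. \<forall>U\<in>V. (\<lambda>\<phi>. T \<phi> + U \<phi>) \<in> V"
    using closed by (simp add: closed_sobolev_subspace_def)
  ultimately show "(\<lambda>\<phi>. a * T \<phi> + b * U \<phi>) \<in> V"
    using bspec[OF bspec[OF add]] by simp
qed

lemma shift_inv_space_translate:
  "T \<in> shift_inv_space s \<Phi> \<Longrightarrow> j \<in> int_lattice \<Longrightarrow> translate j T \<in> shift_inv_space s \<Phi>"
  by (auto simp: shift_inv_space_def)

text \<open>
  Closed shift-invariant subspaces as they appear on the Fourier side: translation by \<open>j\<close> becomes
  multiplication by \<open>exp(-i j\<cdot>\<omega>)\<close>. Members are honest functions, not classes modulo null sets.
\<close>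

definition modulation_space :: "real \<Rightarrow> (real^'d::finite \<Rightarrow> complex) set \<Rightarrow> bool" where
  "modulation_space s X \<longleftrightarrow>
    (\<forall>u\<in>X. u \<in> borel_measurable borel \<and> energy s u < \<infinity>) \<and>
    (\<forall>u\<in>X. \<forall>v\<in>X. \<forall>a b. (\<lambda>\<omega>. a * u \<omega> + b * v \<omega>) \<in> X) \<and>
    (\<forall>u\<in>X. \<forall>j\<in>int_lattice. (\<lambda>\<omega>. exp (- \<i> * of_real (j \<bullet> \<omega>)) * u \<omega>) \<in> X) \<and>
    (\<forall>u v. u \<in> borel_measurable borel \<longrightarrow> (\<forall>n. v n \<in> X) \<longrightarrow>
       (\<lambda>n. energy s (\<lambda>\<omega>. v n \<omega> - u \<omega>)) \<longlonglongrightarrow> 0 \<longrightarrow> u \<in> X)"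

lemma modulation_space_borel: "modulation_space s X \<Longrightarrow> u \<in> X \<Longrightarrow> u \<in> borel_measurable borel"
  unfolding modulation_space_def by blast

lemma modulation_space_finite: "modulation_space s X \<Longrightarrow> u \<in> X \<Longrightarrow> energy s u < \<infinity>"
  unfolding modulation_space_def by blast

lemma modulation_space_lincomb:
  "modulation_space s X \<Longrightarrow> u \<in> X \<Longrightarrow> v \<in> X \<Longrightarrow> (\<lambda>\<omega>. a * u \<omega> + b * v \<omega>) \<in> X"
  unfolding modulation_space_def by blast

lemma modulation_space_modulation:
  "modulation_space s X \<Longrightarrow> u \<in> X \<Longrightarrow> j \<in> int_lattice \<Longrightarrow> (\<lambda>\<omega>. exp (- \<i> * of_real (j \<bullet> \<omega>)) * u \<omega>) \<in> X"
  unfolding modulation_space_def by blast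

lemma modulation_space_limit:
  "modulation_space s X \<Longrightarrow> u \<in> borel_measurable borel \<Longrightarrow> (\<And>n. v n \<in> X) \<Longrightarrow>
    (\<lambda>n. energy s (\<lambda>\<omega>. v n \<omega> - u \<omega>)) \<longlonglongrightarrow> 0 \<Longrightarrow> u \<in> X"
  unfolding modulation_space_def by blast

lemma modulation_space_cong_AE:
  assumes X: "modulation_space s X" and "u \<in> X" "v \<in> borel_measurable borel" "AE \<omega> in lborel. u \<omega> = v \<omega>"
  shows "v \<in> X"
proof (rule modulation_space_limit[OF X assms(3)])
  have "AE \<omega> in lborel. u \<omega> - v \<omega> = 0"
    using assms(4) by eventually_elim simp
  from energy_cong_AE[OF this]
  show "(\<lambda>n. energy s (\<lambda>\<omega>. u \<omega> - v \<omega>)) \<longlonglongrightarrow> 0" by simp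
qed fact

lemma tendsto_zero_combine_ennreal:
  fixes a b c :: "nat \<Rightarrow> ennreal"
  assumes "\<And>n. c n \<le> \<alpha> * a n + \<beta> * b n" "a \<longlonglongrightarrow> 0" "b \<longlonglongrightarrow> 0" "\<alpha> < top" "\<beta> < top"
  shows "c \<longlonglongrightarrow> 0"
proof (rule tendsto_sandwich[of "\<lambda>_. 0" _ _ "\<lambda>n. \<alpha> * a n + \<beta> * b n"])
  have "(\<lambda>n. \<alpha> * a n + \<beta> * b n) \<longlonglongrightarrow> \<alpha> * 0 + \<beta> * 0"
    using assms by (intro tendsto_add ennreal_tendsto_cmult) auto
  then show "(\<lambda>n. \<alpha> * a n + \<beta> * b n) \<longlonglongrightarrow> 0" by simp
  show "(\<lambda>n. 0) \<longlonglongrightarrow> (0::ennreal)" by simp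
qed (use assms(1) in auto)

lemma energy_minus_commute: "energy s (\<lambda>\<omega>. u \<omega> - v \<omega>) = energy s (\<lambda>\<omega>. v \<omega> - u \<omega>)"
  by (simp add: energy_def norm_minus_commute)

text \<open>
  The closure is taken among functions, which keeps limits available without representing them
  as Fourier transforms of distributions.
\<close>

definition spectral_space :: "real \<Rightarrow> 'd::finite functional ^ 'r \<Rightarrow> (real^'d \<Rightarrow> complex) set" where
  "spectral_space s \<Phi> = {u \<in> borel_measurable borel.
     \<exists>T. (\<forall>n. T n \<in> shift_inv_space s \<Phi>) \<and> (\<lambda>n. energy s (\<lambda>\<omega>. fhat (T n) \<omega> - u \<omega>)) \<longlonglongrightarrow> 0}"

lemma spectral_spaceI:
  assumes "u \<in> borel_measurable borel" "\<And>n. T n \<in> shift_inv_space s \<Phi>"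
    "(\<lambda>n. energy s (\<lambda>\<omega>. fhat (T n) \<omega> - u \<omega>)) \<longlonglongrightarrow> 0"
  shows "u \<in> spectral_space s \<Phi>"
  using assms by (auto simp: spectral_space_def)

text \<open>
  The algebraic closure properties hold for transforms of elements of the shift-invariant space and
  pass to limits; a limit of limits is reached by a diagonal choice.
\<close>

lemma modulation_space_spectral_space:
  fixes \<Phi> :: "'d::finite functional ^ 'r"
  assumes \<Phi>: "\<And>i. \<Phi> $ i \<in> sobolev s"
  shows "modulation_space s (spectral_space s \<Phi>)"
  unfolding modulation_space_def
proof (intro conjI ballI allI impI)
  have sob: "T \<in> sobolev s" if "T \<in> shift_inv_space s \<Phi>" for T
    using shift_inv_space_subset_sobolev[OF \<Phi>] that by blast
  have approx: "\<exists>T\<in>shift_inv_space s \<Phi>. energy s (\<lambda>\<omega>. fhat T \<omega> - u \<omega>) < \<epsilon>"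
    if u: "u \<in> spectral_space s \<Phi>" and \<epsilon>: "\<epsilon> > 0" for u \<epsilon>
  proof -
    obtain T where T: "\<And>n. T n \<in> shift_inv_space s \<Phi>" "(\<lambda>n. energy s (\<lambda>\<omega>. fhat (T n) \<omega> - u \<omega>)) \<longlonglongrightarrow> 0"
      using u unfolding spectral_space_def by blast
    have "\<forall>\<^sub>F n in sequentially. energy s (\<lambda>\<omega>. fhat (T n) \<omega> - u \<omega>) < \<epsilon>"
      by (rule order_tendstoD(2)[OF T(2) \<epsilon>])
    then show ?thesis using T(1) by (auto simp: eventually_sequentially)
  qed
  fix u assume u: "u \<in> spectral_space s \<Phi>"
  then show [measurable]: "u \<in> borel_measurable borel" by (simp add: spectral_space_def)
  obtain T where T: "\<And>n. T n \<in> shift_inv_space s \<Phi>" "(\<lambda>n. energy s (\<lambda>\<omega>. fhat (T n) \<omega> - u \<omega>)) \<longlonglongrightarrow> 0"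
    using u unfolding spectral_space_def by blast
  have [measurable]: "fhat (T n) \<in> borel_measurable borel" for n
    using sobolev_borel[OF sob[OF T(1)]] .
  obtain U where U: "U \<in> shift_inv_space s \<Phi>" "energy s (\<lambda>\<omega>. fhat U \<omega> - u \<omega>) < 1"
    using approx[OF u, of 1] by auto
  have [measurable]: "fhat U \<in> borel_measurable borel"
    using sobolev_borel[OF sob[OF U(1)]] .
  have "energy s u \<le> 2 * energy s (\<lambda>\<omega>. u \<omega> - fhat U \<omega>) + 2 * energy s (fhat U)"
    using energy_diff_triangle[of u "fhat U" "\<lambda>_. 0" s] by simp
  also have "\<dots> = 2 * energy s (\<lambda>\<omega>. fhat U \<omega> - u \<omega>) + 2 * energy s (fhat U)"
    by (simp only: energy_minus_commute)
  also have "\<dots> < \<infinity>"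
    using sobolev_energy[OF sob[OF U(1)]] order_less_trans[OF U(2), of top]
    by (simp add: ennreal_mult_less_top)
  finally show "energy s u < \<infinity>" .
  show "(\<lambda>\<omega>. exp (- \<i> * of_real (j \<bullet> \<omega>)) * u \<omega>) \<in> spectral_space s \<Phi>" if j: "j \<in> int_lattice" for j
  proof -
    have "energy s (\<lambda>\<omega>. fhat (translate j (T n)) \<omega> - exp (- \<i> * of_real (j \<bullet> \<omega>)) * u \<omega>) =
        energy s (\<lambda>\<omega>. fhat (T n) \<omega> - u \<omega>)" for n
    proof -
      have "AE \<omega> in lborel. fhat (translate j (T n)) \<omega> - exp (- \<i> * of_real (j \<bullet> \<omega>)) * u \<omega>
          = exp (- \<i> * of_real (j \<bullet> \<omega>)) * (fhat (T n) \<omega> - u \<omega>)"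
        using AE_fhat_eq[OF has_fourier_translate[OF sobolev_has_fourier[OF sob[OF T(1)]], of j n]]
        by eventually_elim (simp add: algebra_simps)
      from energy_cong_AE[OF this] show ?thesis by (simp only: energy_modulation)
    qed
    then have "(\<lambda>n. energy s (\<lambda>\<omega>. fhat (translate j (T n)) \<omega> - exp (- \<i> * of_real (j \<bullet> \<omega>)) * u \<omega>)) \<longlonglongrightarrow> 0"
      using T(2) by simp
    moreover have "(\<lambda>\<omega>. exp (- \<i> * of_real (j \<bullet> \<omega>)) * u \<omega>) \<in> borel_measurable borel"
      by (intro borel_measurable_times borel_measurable_continuous_onI[OF smooth_continuous_on[OF smooth_exp]]) simp
    ultimately show ?thesis
      by (intro spectral_spaceI[where T = "\<lambda>n. translate j (T n)"] shift_inv_space_translate T j)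
  qed
  fix v a b assume v: "v \<in> spectral_space s \<Phi>"
  then have [measurable]: "v \<in> borel_measurable borel" by (simp add: spectral_space_def)
  obtain W where W: "\<And>n. W n \<in> shift_inv_space s \<Phi>" "(\<lambda>n. energy s (\<lambda>\<omega>. fhat (W n) \<omega> - v \<omega>)) \<longlonglongrightarrow> 0"
    using v unfolding spectral_space_def by blast
  have [measurable]: "fhat (W n) \<in> borel_measurable borel" for n
    using sobolev_borel[OF sob[OF W(1)]] .
  have "energy s (\<lambda>\<omega>. fhat (\<lambda>\<phi>. a * T n \<phi> + b * W n \<phi>) \<omega> - (a * u \<omega> + b * v \<omega>)) \<le>
      (2 * ennreal ((cmod a)\<^sup>2)) * energy s (\<lambda>\<omega>. fhat (T n) \<omega> - u \<omega>)
      + (2 * ennreal ((cmod b)\<^sup>2)) * energy s (\<lambda>\<omega>. fhat (W n) \<omega> - v \<omega>)" for n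
  proof -
    have "AE \<omega> in lborel. fhat (\<lambda>\<phi>. a * T n \<phi> + b * W n \<phi>) \<omega> - (a * u \<omega> + b * v \<omega>) =
        a * (fhat (T n) \<omega> - u \<omega>) + b * (fhat (W n) \<omega> - v \<omega>)"
      using AE_fhat_lincomb[OF sob[OF T(1)[of n]] sob[OF W(1)[of n]], of a b]
      by eventually_elim (simp add: algebra_simps)
    from energy_cong_AE[OF this, of s]
      energy_add[of "\<lambda>\<omega>. a * (fhat (T n) \<omega> - u \<omega>)" "\<lambda>\<omega>. b * (fhat (W n) \<omega> - v \<omega>)" s]
    show ?thesis by (simp add: energy_cmult mult.assoc)
  qed
  then have "(\<lambda>n. energy s (\<lambda>\<omega>. fhat (\<lambda>\<phi>. a * T n \<phi> + b * W n \<phi>) \<omega> - (a * u \<omega> + b * v \<omega>))) \<longlonglongrightarrow> 0"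
    by (rule tendsto_zero_combine_ennreal) (use T W in \<open>auto simp: ennreal_mult_less_top\<close>)
  moreover have "(\<lambda>\<omega>. a * u \<omega> + b * v \<omega>) \<in> borel_measurable borel" by simp
  ultimately show "(\<lambda>\<omega>. a * u \<omega> + b * v \<omega>) \<in> spectral_space s \<Phi>"
    by (intro spectral_spaceI[where T = "\<lambda>n \<phi>. a * T n \<phi> + b * W n \<phi>"] shift_inv_space_lincomb T W)
next
  have sob: "T \<in> sobolev s" if "T \<in> shift_inv_space s \<Phi>" for T
    using shift_inv_space_subset_sobolev[OF \<Phi>] that by blast
  fix u v assume [measurable]: "u \<in> borel_measurable borel" and v: "\<forall>n. v n \<in> spectral_space s \<Phi>"
    and lim: "(\<lambda>n. energy s (\<lambda>\<omega>. v n \<omega> - u \<omega>)) \<longlonglongrightarrow> 0"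
  have [measurable]: "v n \<in> borel_measurable borel" for n
    using v by (simp add: spectral_space_def)
  have "\<exists>T\<in>shift_inv_space s \<Phi>. energy s (\<lambda>\<omega>. fhat T \<omega> - v n \<omega>) < ennreal (1 / real (Suc n))" for n
  proof -
    obtain T where T: "\<And>n. T n \<in> shift_inv_space s \<Phi>" "(\<lambda>m. energy s (\<lambda>\<omega>. fhat (T m) \<omega> - v n \<omega>)) \<longlonglongrightarrow> 0"
      using v unfolding spectral_space_def by blast
    have "\<forall>\<^sub>F m in sequentially. energy s (\<lambda>\<omega>. fhat (T m) \<omega> - v n \<omega>) < ennreal (1 / real (Suc n))"
      by (rule order_tendstoD(2)[OF T(2)]) simp
    then show ?thesis using T(1) by (auto simp: eventually_sequentially)
  qed
  then have "\<forall>n. \<exists>T. T \<in> shift_inv_space s \<Phi> \<and>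
      energy s (\<lambda>\<omega>. fhat T \<omega> - v n \<omega>) < ennreal (1 / real (Suc n))"
    by blast
  from choice[OF this] obtain T where T: "\<And>n. T n \<in> shift_inv_space s \<Phi>"
    "\<And>n. energy s (\<lambda>\<omega>. fhat (T n) \<omega> - v n \<omega>) < ennreal (1 / real (Suc n))"
    by auto
  have [measurable]: "fhat (T n) \<in> borel_measurable borel" for n
    using sobolev_borel[OF sob[OF T(1)]] .
  have "(\<lambda>n. ennreal (1 / real (Suc n))) \<longlonglongrightarrow> ennreal 0"
    using LIMSEQ_inverse_real_of_nat by (intro tendsto_ennrealI) (simp add: inverse_eq_divide)
  then have "(\<lambda>n. ennreal (1 / real (Suc n))) \<longlonglongrightarrow> 0" by simp
  then have T0: "(\<lambda>n. energy s (\<lambda>\<omega>. fhat (T n) \<omega> - v n \<omega>)) \<longlonglongrightarrow> 0"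
    by (rule tendsto_sandwich[OF always_eventually always_eventually tendsto_const, rotated 2])
      (use T(2) in \<open>simp_all add: less_imp_le del: of_nat_Suc\<close>)
  have "(\<lambda>n. energy s (\<lambda>\<omega>. fhat (T n) \<omega> - u \<omega>)) \<longlonglongrightarrow> 0"
    by (rule tendsto_zero_combine_ennreal[OF energy_diff_triangle T0 lim]) auto
  then show "u \<in> spectral_space s \<Phi>"
    using T(1) by (auto simp: spectral_space_def)
qed

section \<open>Multiplication by bounded periodic functions\<close>

text \<open>
  The aim of this part is to show that every bounded Borel function of period \<open>2\<pi>\<close> is a multiplier
  of a modulation space.
\<close>

definition multipliers :: "(real^'d::finite \<Rightarrow> complex) set \<Rightarrow> (real^'d \<Rightarrow> complex) set" where
  "multipliers X = {\<tau> \<in> borel_measurable borel. bounded (range \<tau>) \<and> (\<forall>u\<in>X. (\<lambda>\<omega>. \<tau> \<omega> * u \<omega>) \<in> X)}"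

text \<open>
  The functions of this point are exactly the functions of period \<open>2\<pi>\<close>, and its values stay in a
  compact set, where continuous functions can be approximated uniformly by polynomials.
\<close>

definition torus_point :: "real^'d \<Rightarrow> complex^'d" where
  "torus_point \<omega> = (\<chi> i. cis (\<omega> $ i))"

lemma norm_torus_point: "norm (torus_point \<omega> :: complex^'d::finite) \<le> CARD('d)"
proof -
  have "norm (torus_point \<omega>) \<le> (\<Sum>i\<in>UNIV. norm (torus_point \<omega> $ i))"
    unfolding norm_vec_def by (rule L2_set_le_sum) simp
  then show ?thesis by (simp add: torus_point_def)
qed

lemma multipliers_borel: "\<tau> \<in> multipliers X \<Longrightarrow> \<tau> \<in> borel_measurable borel"
  by (simp add: multipliers_def)

lemma multipliersI:
  assumes "\<tau> \<in> borel_measurable borel" "\<And>\<omega>. cmod (\<tau> \<omega>) \<le> B"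
    "\<And>u. u \<in> X \<Longrightarrow> (\<lambda>\<omega>. \<tau> \<omega> * u \<omega>) \<in> X"
  shows "\<tau> \<in> multipliers X"
  using assms by (auto simp: multipliers_def bounded_iff)

lemma multipliers_bound:
  assumes "\<tau> \<in> multipliers X"
  obtains B where "\<And>\<omega>. cmod (\<tau> \<omega>) \<le> B"
  using assms by (auto simp: multipliers_def bounded_iff)

lemma multipliers_times: "\<tau> \<in> multipliers X \<Longrightarrow> u \<in> X \<Longrightarrow> (\<lambda>\<omega>. \<tau> \<omega> * u \<omega>) \<in> X"
  by (simp add: multipliers_def)

lemma multipliers_lincomb:
  assumes X: "modulation_space s X" and \<tau>: "\<tau> \<in> multipliers X" "\<sigma> \<in> multipliers X"
  shows "(\<lambda>\<omega>. a * \<tau> \<omega> + b * \<sigma> \<omega>) \<in> multipliers X"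
proof -
  obtain A where A: "\<And>\<omega>. cmod (\<tau> \<omega>) \<le> A" using multipliers_bound[OF \<tau>(1)] by blast
  obtain B where B: "\<And>\<omega>. cmod (\<sigma> \<omega>) \<le> B" using multipliers_bound[OF \<tau>(2)] by blast
  show ?thesis
  proof (rule multipliersI)
    show "(\<lambda>\<omega>. a * \<tau> \<omega> + b * \<sigma> \<omega>) \<in> borel_measurable borel"
      using \<tau>[THEN multipliers_borel] by simp
    show "cmod (a * \<tau> \<omega> + b * \<sigma> \<omega>) \<le> cmod a * A + cmod b * B" for \<omega>
      using norm_triangle_ineq[of "a * \<tau> \<omega>" "b * \<sigma> \<omega>"]
        mult_left_mono[OF A[of \<omega>], of "cmod a"] mult_left_mono[OF B[of \<omega>], of "cmod b"]
      by (simp add: norm_mult)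
    show "(\<lambda>\<omega>. (a * \<tau> \<omega> + b * \<sigma> \<omega>) * u \<omega>) \<in> X" if "u \<in> X" for u
      using modulation_space_lincomb[OF X \<tau>[THEN multipliers_times, OF that], of a b]
      by (simp add: algebra_simps)
  qed
qed

lemma multipliers_add:
  assumes "modulation_space s X" "\<tau> \<in> multipliers X" "\<sigma> \<in> multipliers X"
  shows "(\<lambda>\<omega>. \<tau> \<omega> + \<sigma> \<omega>) \<in> multipliers X"
  using multipliers_lincomb[OF assms, of 1 1] by simp

lemma multipliers_mult:
  assumes \<tau>: "\<tau> \<in> multipliers X" "\<sigma> \<in> multipliers X"
  shows "(\<lambda>\<omega>. \<tau> \<omega> * \<sigma> \<omega>) \<in> multipliers X"
proof -
  obtain A where A: "\<And>\<omega>. cmod (\<tau> \<omega>) \<le> A" using multipliers_bound[OF \<tau>(1)] by blast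
  obtain B where B: "\<And>\<omega>. cmod (\<sigma> \<omega>) \<le> B" using multipliers_bound[OF \<tau>(2)] by blast
  have "0 \<le> A" using A[of 0] norm_ge_zero order_trans by blast
  show ?thesis
  proof (rule multipliersI)
    show "(\<lambda>\<omega>. \<tau> \<omega> * \<sigma> \<omega>) \<in> borel_measurable borel"
      using \<tau>[THEN multipliers_borel] by simp
    show "cmod (\<tau> \<omega> * \<sigma> \<omega>) \<le> A * B" for \<omega>
      using A B \<open>0 \<le> A\<close> by (simp add: norm_mult mult_mono)
    show "(\<lambda>\<omega>. \<tau> \<omega> * \<sigma> \<omega> * u \<omega>) \<in> X" if "u \<in> X" for u
      using multipliers_times[OF \<tau>(1) multipliers_times[OF \<tau>(2) that]] by (simp add: mult.assoc)
  qed
qed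

lemma multipliers_exp:
  assumes X: "modulation_space s X" and "j \<in> int_lattice"
  shows "(\<lambda>\<omega>. exp (- \<i> * of_real (j \<bullet> \<omega>))) \<in> multipliers X"
proof -
  have "bounded (range (\<lambda>\<omega>. exp (- \<i> * of_real (j \<bullet> \<omega>))))"
    by (auto simp: bounded_iff intro!: exI[of _ 1])
  then show ?thesis
    using modulation_space_modulation[OF X _ assms(2)]
      borel_measurable_continuous_onI[OF smooth_continuous_on[OF smooth_exp[of j]]]
    by (simp add: multipliers_def)
qed

lemma zero_int_lattice: "0 \<in> int_lattice"
  by (simp add: int_lattice_def)

lemma multipliers_const:
  assumes X: "modulation_space s X"
  shows "(\<lambda>\<omega>. c) \<in> multipliers X"
  using multipliers_lincomb[OF X multipliers_exp[OF X zero_int_lattice] multipliers_exp[OF X zero_int_lattice], of c 0]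
  by simp

text \<open>
  Dominated convergence, with \<open>2 B |u|\<close> as the dominating function.
\<close>

lemma multipliers_limit:
  assumes X: "modulation_space s X" and \<sigma>: "\<And>n. \<sigma> n \<in> multipliers X"
    and bound: "\<And>n \<omega>. cmod (\<sigma> n \<omega>) \<le> B" and lim: "\<And>\<omega>. (\<lambda>n. \<sigma> n \<omega>) \<longlonglongrightarrow> \<tau> \<omega>"
  shows "\<tau> \<in> multipliers X"
proof -
  have [measurable]: "\<sigma> n \<in> borel_measurable borel" for n
    using \<sigma> by (rule multipliers_borel)
  have \<tau>[measurable]: "\<tau> \<in> borel_measurable borel"
    by (rule borel_measurable_LIMSEQ_metric[OF _ lim]) simp
  have bound': "cmod (\<tau> \<omega>) \<le> B" for \<omega>
    by (rule LIMSEQ_le_const2[OF tendsto_norm[OF lim]]) (auto simp: bound)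
  have "(\<lambda>\<omega>. \<tau> \<omega> * u \<omega>) \<in> X" if u: "u \<in> X" for u
  proof (rule modulation_space_limit[OF X])
    have [measurable]: "u \<in> borel_measurable borel" using modulation_space_borel[OF X u] .
    show "(\<lambda>\<omega>. \<tau> \<omega> * u \<omega>) \<in> borel_measurable borel" by simp
    show "(\<lambda>\<omega>. \<sigma> n \<omega> * u \<omega>) \<in> X" for n using \<sigma>[of n] u by (simp add: multipliers_def)
    show "(\<lambda>n. energy s (\<lambda>\<omega>. \<sigma> n \<omega> * u \<omega> - \<tau> \<omega> * u \<omega>)) \<longlonglongrightarrow> 0"
    proof (rule energy_dominated_tendsto)
      show "AE \<omega> in lborel. (\<lambda>n. \<sigma> n \<omega> * u \<omega>) \<longlonglongrightarrow> \<tau> \<omega> * u \<omega>"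
        by (intro always_eventually allI tendsto_mult lim tendsto_const)
      show "AE \<omega> in lborel. cmod (\<sigma> n \<omega> * u \<omega> - \<tau> \<omega> * u \<omega>) \<le> cmod (of_real (2 * B) * u \<omega>)" for n
      proof (intro always_eventually allI)
        fix \<omega>
        have "cmod (\<sigma> n \<omega> - \<tau> \<omega>) \<le> 2 * B"
          using norm_triangle_ineq4[of "\<sigma> n \<omega>" "\<tau> \<omega>"] bound[of n \<omega>] bound'[of \<omega>] by linarith
        then have "cmod (\<sigma> n \<omega> - \<tau> \<omega>) * cmod (u \<omega>) \<le> \<bar>2 * B\<bar> * cmod (u \<omega>)"
          by (intro mult_right_mono) auto
        then show "cmod (\<sigma> n \<omega> * u \<omega> - \<tau> \<omega> * u \<omega>) \<le> cmod (of_real (2 * B) * u \<omega>)"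
          by (simp only: norm_mult norm_of_real flip: left_diff_distrib)
      qed
      show "energy s (\<lambda>\<omega>. of_real (2 * B) * u \<omega>) < \<infinity>"
        using modulation_space_finite[OF X u] by (subst energy_cmult) (auto simp: ennreal_mult_less_top)
    qed auto
  qed
  then show ?thesis
    using bound' by (auto simp: multipliers_def bounded_iff)
qed

lemma axis_int_lattice: "axis i 1 \<in> int_lattice" "- axis i 1 \<in> int_lattice"
  by (auto simp: int_lattice_def axis_def)

text \<open>
  A linear function of the torus point is a combination of the \<open>cos \<omega>\<^sub>i\<close> and \<open>sin \<omega>\<^sub>i\<close>, hence of
  exponentials with frequencies \<open>\<plusminus>1\<close> in a single coordinate.
\<close>

lemma multipliers_bounded_linear:
  fixes L :: "complex^'d::finite \<Rightarrow> real"
  assumes X: "modulation_space s X" and L: "bounded_linear L"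
  shows "(\<lambda>\<omega>. of_real (L (torus_point \<omega>))) \<in> multipliers X"
proof -
  interpret L: bounded_linear L by (rule L)
  have cos: "(\<lambda>\<omega>. of_real (cos (\<omega> $ i))) \<in> multipliers X" for i :: 'd
  proof -
    have "(\<lambda>\<omega>. 1/2 * exp (- \<i> * of_real (axis i 1 \<bullet> \<omega>)) + 1/2 * exp (- \<i> * of_real (- axis i 1 \<bullet> \<omega>))) \<in> multipliers X"
      by (intro multipliers_lincomb[OF X] multipliers_exp[OF X] axis_int_lattice)
    moreover have "of_real (cos (\<omega> $ i)) = 1/2 * exp (- \<i> * of_real (axis i 1 \<bullet> \<omega>)) + 1/2 * exp (- \<i> * of_real (- axis i 1 \<bullet> \<omega>))"
      for \<omega> :: "real^'d"
      by (simp add: inner_axis' cos_of_real[symmetric] cos_exp_eq field_simps)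
    ultimately show ?thesis by presburger
  qed
  have sin: "(\<lambda>\<omega>. of_real (sin (\<omega> $ i))) \<in> multipliers X" for i :: 'd
  proof -
    have "(\<lambda>\<omega>. (\<i>/2) * exp (- \<i> * of_real (axis i 1 \<bullet> \<omega>)) + (-\<i>/2) * exp (- \<i> * of_real (- axis i 1 \<bullet> \<omega>))) \<in> multipliers X"
      by (intro multipliers_lincomb[OF X] multipliers_exp[OF X] axis_int_lattice)
    moreover have "of_real (sin (\<omega> $ i)) = (\<i>/2) * exp (- \<i> * of_real (axis i 1 \<bullet> \<omega>)) + (-\<i>/2) * exp (- \<i> * of_real (- axis i 1 \<bullet> \<omega>))"
      for \<omega> :: "real^'d"
      by (simp add: inner_axis' sin_of_real[symmetric] sin_exp_eq field_simps)
    ultimately show ?thesis by presburger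
  qed
  have "L (torus_point \<omega>) = (\<Sum>i\<in>UNIV. L (axis i 1) * cos (\<omega> $ i) + L (axis i \<i>) * sin (\<omega> $ i))" for \<omega>
  proof -
    have "torus_point \<omega> = (\<Sum>i\<in>UNIV. cos (\<omega> $ i) *\<^sub>R axis i 1 + sin (\<omega> $ i) *\<^sub>R axis i \<i>)"
      by (simp add: vec_eq_iff torus_point_def axis_def complex_eq_iff if_distrib if_distribR
          sum.delta cong: if_cong)
    then show ?thesis by (simp add: L.sum L.add L.scaleR mult.commute)
  qed
  then have "(\<lambda>\<omega>. of_real (L (torus_point \<omega>))) =
      (\<lambda>\<omega>. \<Sum>i\<in>UNIV. of_real (L (axis i 1)) * complex_of_real (cos (\<omega> $ i)) + of_real (L (axis i \<i>)) * of_real (sin (\<omega> $ i)))"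
    by simp
  moreover have "(\<lambda>\<omega>. \<Sum>i\<in>A. of_real (L (axis i 1)) * complex_of_real (cos (\<omega> $ i)) + of_real (L (axis i \<i>)) * of_real (sin (\<omega> $ i))) \<in> multipliers X"
    if "finite A" for A
    using that
  proof induction
    case (insert i A)
    then show ?case
      using multipliers_add[OF X multipliers_lincomb[OF X cos sin] insert.IH] by simp
  qed (simp add: multipliers_const[OF X])
  ultimately show ?thesis by simp
qed

lemma multipliers_polynomial:
  fixes p :: "complex^'d::finite \<Rightarrow> real"
  assumes X: "modulation_space s X" and "real_polynomial_function p"
  shows "(\<lambda>\<omega>. of_real (p (torus_point \<omega>))) \<in> multipliers X"
  using assms(2)
  by induction (auto intro: multipliers_bounded_linear[OF X] multipliers_const[OF X] multipliers_add[OF X] multipliers_mult)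

lemma multipliers_continuous:
  fixes f :: "complex^'d::finite \<Rightarrow> real"
  assumes X: "modulation_space s X" and f: "continuous_on UNIV f"
  shows "(\<lambda>\<omega>. of_real (f (torus_point \<omega>))) \<in> multipliers X"
proof -
  let ?S = "cball (0 :: complex^'d) CARD('d)"
  have fS: "continuous_on ?S f" using f by (rule continuous_on_subset) simp
  have "\<exists>p. real_polynomial_function p \<and> (\<forall>x\<in>?S. \<bar>f x - p x\<bar> < 1 / real (Suc n))" for n
    by (rule Stone_Weierstrass_real_polynomial_function[OF compact_cball fS, of "1 / real (Suc n)"]) auto
  then have "\<forall>n. \<exists>p. real_polynomial_function p \<and> (\<forall>x\<in>?S. \<bar>f x - p x\<bar> < 1 / real (Suc n))"
    by blast
  from choice[OF this] obtain p where p: "\<And>n. real_polynomial_function (p n)"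
    "\<And>n x. x \<in> ?S \<Longrightarrow> \<bar>f x - p n x\<bar> < 1 / real (Suc n)"
    by blast
  have "bounded (f ` ?S)"
    using fS by (intro compact_imp_bounded compact_continuous_image) auto
  then obtain B where "\<forall>y\<in>f ` ?S. norm y \<le> B"
    unfolding bounded_iff by blast
  then have B: "\<And>x. x \<in> ?S \<Longrightarrow> \<bar>f x\<bar> \<le> B" by simp
  have S: "torus_point \<omega> \<in> ?S" for \<omega> by (simp add: norm_torus_point)
  show ?thesis
  proof (rule multipliers_limit[OF X])
    show "(\<lambda>\<omega>. of_real (p n (torus_point \<omega>))) \<in> multipliers X" for n
      by (intro multipliers_polynomial[OF X] p)
    show "cmod (of_real (p n (torus_point \<omega>))) \<le> B + 1" for n \<omega>
    proof -
      have "1 / real (Suc n) \<le> 1" by simp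
      then show ?thesis using p(2)[OF S, of \<omega> n] B[OF S, of \<omega>] by (simp only: norm_of_real)
    qed
    fix \<omega>
    have "(\<lambda>n. p n (torus_point \<omega>) - f (torus_point \<omega>)) \<longlonglongrightarrow> 0"
    proof (rule tendsto_rabs_zero_cancel, rule tendsto_sandwich[of "\<lambda>_. 0" _ _ "\<lambda>n. 1 / real (Suc n)"])
      show "(\<lambda>n. 1 / real (Suc n)) \<longlonglongrightarrow> 0"
        using LIMSEQ_inverse_real_of_nat by (simp add: inverse_eq_divide)
      show "\<forall>\<^sub>F n in sequentially. \<bar>p n (torus_point \<omega>) - f (torus_point \<omega>)\<bar> \<le> 1 / real (Suc n)"
        using p(2)[OF S] by (intro always_eventually allI) (simp add: abs_minus_commute less_imp_le del: of_nat_Suc)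
      show "(\<lambda>n. 0) \<longlonglongrightarrow> (0::real)" by simp
    qed auto
    then show "(\<lambda>n. of_real (p n (torus_point \<omega>))) \<longlonglongrightarrow> complex_of_real (f (torus_point \<omega>))"
      by (intro tendsto_of_real) (simp add: LIM_zero_iff)
  qed
qed

lemma multipliers_indicator_open:
  fixes U :: "(complex^'d::finite) set"
  assumes X: "modulation_space s X" and U: "open U"
  shows "(\<lambda>\<omega>. indicator U (torus_point \<omega>)) \<in> multipliers X"
proof (cases "U = UNIV")
  case False
  define f where "f n x = min 1 (real n * infdist x (- U))" for n x
  show ?thesis
  proof (rule multipliers_limit[OF X])
    show "(\<lambda>\<omega>. of_real (f n (torus_point \<omega>))) \<in> multipliers X" for n
      unfolding f_def by (intro multipliers_continuous[OF X] continuous_intros)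
    show "cmod (of_real (f n (torus_point \<omega>))) \<le> 1" for n \<omega>
      by (simp add: f_def infdist_nonneg)
    fix \<omega>
    show "(\<lambda>n. of_real (f n (torus_point \<omega>))) \<longlonglongrightarrow> (indicator U (torus_point \<omega>) :: complex)"
    proof (cases "torus_point \<omega> \<in> U")
      case True
      have "0 < infdist (torus_point \<omega>) (- U)"
        using True False U in_closed_iff_infdist_zero[of "- U" "torus_point \<omega>"] infdist_nonneg[of "torus_point \<omega>" "- U"]
        by (auto simp: less_le closed_Compl)
      then obtain N :: nat where "1 < N * infdist (torus_point \<omega>) (- U)"
        using ex_less_of_nat_mult by blast
      then have "f n (torus_point \<omega>) = 1" if "n \<ge> N" for n
        using that mult_right_mono[of "real N" "real n" "infdist (torus_point \<omega>) (- U)"]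
        by (simp add: f_def infdist_nonneg)
      then show ?thesis
        using True by (intro tendsto_eventually) (auto simp: eventually_sequentially)
    qed (simp add: f_def)
  qed
qed (simp add: multipliers_const[OF X])

text \<open>
  The sets whose indicators are multipliers contain the open sets and form a \<open>\<sigma>\<close>-algebra, since
  multipliers are closed under sums, products and bounded pointwise limits.
\<close>

lemma multipliers_indicator:
  fixes A :: "(complex^'d::finite) set"
  assumes X: "modulation_space s X" and A: "A \<in> sets borel"
  shows "(\<lambda>\<omega>. indicator A (torus_point \<omega>)) \<in> multipliers X"
proof -
  have "A \<in> sigma_sets UNIV {U. open U}"
    using A by (simp add: borel_def)
  then show ?thesis
  proof induction
    case (Basic U)
    then show ?case by (simp add: multipliers_indicator_open[OF X])
  next
    case Empty
    then show ?case by (simp add: multipliers_const[OF X])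
  next
    case (Compl A)
    then show ?case
      using multipliers_lincomb[OF X multipliers_const[OF X, of 1] Compl.IH, of 1 "-1"]
      by (simp add: indicator_diff)
  next
    case (Union A)
    have "(\<lambda>\<omega>. indicator (\<Union>i<n. A i) (torus_point \<omega>)) \<in> multipliers X" for n
    proof (induction n)
      case (Suc n)
      have "(indicator (\<Union>i<Suc n. A i) x :: complex) = indicator (\<Union>i<n. A i) x
          + (indicator (A n) x + (-1) * (indicator (\<Union>i<n. A i) x * indicator (A n) x))" for x
        by (auto simp: indicator_def lessThan_Suc)
      then show ?case
        by (simp only:) (intro multipliers_add[OF X] multipliers_mult multipliers_const[OF X] Suc Union)
    qed (simp add: multipliers_const[OF X])
    then show ?case
      by (rule multipliers_limit[OF X _ _ LIMSEQ_indicator_UN, of _ _ 1]) (auto simp: indicator_def)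
  qed
qed

lemma multipliers_borel_torus:
  fixes F :: "complex^'d::finite \<Rightarrow> complex"
  assumes X: "modulation_space s X" and F: "F \<in> borel_measurable borel" "\<And>z. cmod (F z) \<le> B"
  shows "(\<lambda>\<omega>. F (torus_point \<omega>)) \<in> multipliers X"
proof -
  obtain S where S: "\<And>n. simple_function borel (S n)" "\<And>z. (\<lambda>n. S n z) \<longlonglongrightarrow> F z"
    "\<And>n z. dist (S n z) 0 \<le> 2 * dist (F z) 0"
    using borel_measurable_implies_sequence_metric[OF F(1), of 0] by (auto simp: space_borel)
  show ?thesis
  proof (rule multipliers_limit[OF X])
    fix n
    have fin: "finite (range (S n))" using S(1)[of n] by (simp add: simple_function_def)
    have "(\<lambda>\<omega>. \<Sum>y\<in>A. y * indicator (S n -` {y}) (torus_point \<omega>)) \<in> multipliers X"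
      if "finite A" "A \<subseteq> range (S n)" for A
      using that
    proof induction
      case (insert y A)
      have "S n -` {y} \<in> sets borel"
        using S(1)[of n] insert.prems by (auto simp: simple_function_def)
      with insert show ?case
        by (simp only: sum.insert[OF insert.hyps])
          (intro multipliers_add[OF X] multipliers_mult multipliers_const[OF X] multipliers_indicator[OF X]; simp)
    qed (simp add: multipliers_const[OF X])
    from this[OF fin] have "(\<lambda>\<omega>. \<Sum>y\<in>range (S n). y * indicator (S n -` {y}) (torus_point \<omega>)) \<in> multipliers X"
      by simp
    moreover have "(\<Sum>y\<in>range (S n). y * indicator (S n -` {y}) z) = S n z" for z
    proof -
      have "(\<Sum>y\<in>range (S n). y * indicator (S n -` {y}) z) = (\<Sum>y\<in>range (S n). if y = S n z then y else 0)"
        by (intro sum.cong) (auto simp: indicator_def)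
      then show ?thesis using fin by simp
    qed
    ultimately show "(\<lambda>\<omega>. S n (torus_point \<omega>)) \<in> multipliers X" by simp
    show "cmod (S n (torus_point \<omega>)) \<le> 2 * B" for \<omega>
      using S(3)[of n "torus_point \<omega>"] F(2)[of "torus_point \<omega>"] by simp
  qed (rule S(2))
qed

lemma Arg_borel [measurable]: "Arg \<in> borel_measurable borel"
proof -
  have closed: "closed (\<real>\<^sub>\<le>\<^sub>0 :: complex set)" by simp
  then have "(\<lambda>z. indicator (- \<real>\<^sub>\<le>\<^sub>0) z *\<^sub>R Arg z) \<in> borel_measurable borel"
    by (intro borel_measurable_continuous_on_indicator)
      (auto intro!: continuous_at_imp_continuous_on continuous_at_Arg)
  moreover have "(\<lambda>z. pi * indicator (\<real>\<^sub>\<le>\<^sub>0 - {0}) (z :: complex)) \<in> borel_measurable borel"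
    using closed by (intro borel_measurable_times borel_measurable_indicator) auto
  ultimately have "(\<lambda>z. indicator (- \<real>\<^sub>\<le>\<^sub>0) z *\<^sub>R Arg z + pi * indicator (\<real>\<^sub>\<le>\<^sub>0 - {0}) z) \<in> borel_measurable borel"
    by (rule borel_measurable_add)
  moreover have "indicator (- \<real>\<^sub>\<le>\<^sub>0) z *\<^sub>R Arg z + pi * indicator (\<real>\<^sub>\<le>\<^sub>0 - {0}) z = Arg z" for z
  proof (cases "z \<in> \<real>\<^sub>\<le>\<^sub>0 - {0}")
    case True
    then have "Re z < 0 \<and> Im z = 0"
      by (auto simp: complex_nonpos_Reals_iff complex_eq_iff)
    then have "Arg z = pi" by (simp add: Arg_eq_pi)
    then show ?thesis using True by simp
  qed (auto simp: Arg_zero)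
  ultimately show ?thesis by simp
qed

text \<open>
  The representative of \<open>\<omega>\<close> modulo \<open>2\<pi>\<int>\<^sup>d\<close> in the cell \<open>(-\<pi>,\<pi>]\<^sup>d\<close>. Thus \<open>t \<circ> cell_rep\<close> is the
  periodization of the restriction of \<open>t\<close> to that cell.
\<close>

definition cell_rep :: "real^'d \<Rightarrow> real^'d" where
  "cell_rep \<omega> = (\<chi> i. Arg (cis (\<omega> $ i)))"

lemma cell_rep_eq:
  assumes "\<And>i. \<bar>\<omega> $ i\<bar> < pi"
  shows "cell_rep \<omega> = \<omega>"
  using assms by (simp add: cell_rep_def vec_eq_iff Arg_cis abs_less_iff minus_less_iff less_imp_le)

lemma cell_rep_lattice:
  obtains j where "j \<in> int_lattice" "\<omega> = cell_rep \<omega> + (2 * pi) *\<^sub>R j"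
proof -
  have "\<exists>n. \<omega> $ i = Arg (cis (\<omega> $ i)) + 2 * pi * of_int n" for i
  proof -
    have "cis (\<omega> $ i) = cis (Arg (cis (\<omega> $ i)))" by (simp add: cis_Arg)
    then have "sin (\<omega> $ i) = sin (Arg (cis (\<omega> $ i))) \<and> cos (\<omega> $ i) = cos (Arg (cis (\<omega> $ i)))"
      unfolding complex_eq_iff cis.sel by blast
    then show ?thesis unfolding sin_cos_eq_iff .
  qed
  then have "\<forall>i. \<exists>n. \<omega> $ i = Arg (cis (\<omega> $ i)) + 2 * pi * of_int n" by blast
  from choice[OF this] obtain n where n: "\<And>i. \<omega> $ i = Arg (cis (\<omega> $ i)) + 2 * pi * of_int (n i)"
    by auto
  show ?thesis
  proof (rule that)
    show "(\<chi> i. of_int (n i)) \<in> int_lattice" by (simp add: int_lattice_def)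
    show "\<omega> = cell_rep \<omega> + (2 * pi) *\<^sub>R (\<chi> i. of_int (n i))"
      by (subst vec_eq_iff) (simp add: cell_rep_def flip: n)
  qed
qed

lemma borel_measurable_vec_lambda:
  assumes "\<And>i. f i \<in> borel_measurable M"
  shows "(\<lambda>x. (\<chi> i. f i x) :: real^'d::finite) \<in> borel_measurable M"
proof -
  have "(\<lambda>x. \<Sum>i\<in>UNIV. f i x *\<^sub>R (axis i 1 :: real^'d)) \<in> borel_measurable M"
    by (intro borel_measurable_sum borel_measurable_scaleR assms borel_measurable_const)
  moreover have "(\<chi> i. f i x) = (\<Sum>i\<in>UNIV. f i x *\<^sub>R axis i (1::real))" for x
    by (simp add: vec_eq_iff axis_def if_distrib cong: if_cong)
  ultimately show ?thesis by simp
qed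

text \<open>
  The argument function recovers \<open>cell_rep \<omega>\<close> from \<open>torus_point \<omega>\<close> in a measurable way, so a
  periodization is a Borel function of the torus point.
\<close>

lemma multipliers_cell_rep:
  fixes t :: "real^'d::finite \<Rightarrow> complex"
  assumes X: "modulation_space s X" and t: "t \<in> borel_measurable borel" and B: "\<And>\<omega>. cmod (t \<omega>) \<le> B"
  shows "(\<lambda>\<omega>. t (cell_rep \<omega>)) \<in> multipliers X"
proof -
  have "(\<lambda>z :: complex^'d. z $ i) \<in> borel_measurable borel" for i
    by (intro borel_measurable_continuous_onI continuous_intros)
  then have "(\<lambda>z :: complex^'d. \<chi> i. Arg (z $ i)) \<in> borel_measurable borel"
    by (intro borel_measurable_vec_lambda measurable_compose[OF _ Arg_borel])
  then have "(\<lambda>z :: complex^'d. t (\<chi> i. Arg (z $ i))) \<in> borel_measurable borel"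
    using t by (rule measurable_compose)
  from multipliers_borel_torus[OF X this B] show ?thesis
    by (simp add: cell_rep_def torus_point_def)
qed

lemma countable_int_lattice: "countable (int_lattice :: (real^'d::finite) set)"
proof -
  have "x \<in> range (\<lambda>f :: 'd \<Rightarrow> int. \<chi> i. of_int (f i))" if x: "x \<in> int_lattice" for x :: "real^'d"
  proof -
    have "x = (\<chi> i. of_int \<lfloor>x $ i\<rfloor>)"
      using x by (auto simp: int_lattice_def vec_eq_iff elim!: allE Ints_cases)
    then show ?thesis by - (rule range_eqI)
  qed
  then have "(int_lattice :: (real^'d) set) \<subseteq> range (\<lambda>f :: 'd \<Rightarrow> int. \<chi> i. of_int (f i))"
    by blast
  then show ?thesis by (rule countable_subset) (intro countable_image countableI_type)
qed

lemma cell_rep_borel [measurable]: "cell_rep \<in> borel_measurable borel"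
proof -
  have "(\<lambda>\<omega> :: real^'d. cis (\<omega> $ i)) \<in> borel_measurable borel" for i
    by (intro borel_measurable_continuous_onI continuous_intros)
  then have "(\<lambda>\<omega> :: real^'d. \<chi> i. Arg (cis (\<omega> $ i))) \<in> borel_measurable borel"
    by (intro borel_measurable_vec_lambda measurable_compose[OF _ Arg_borel])
  then show ?thesis by (simp add: cell_rep_def[abs_def])
qed

section \<open>Dilation by two and refinable generators\<close>

lemma energy_diff_eq_sobolev_norm:
  assumes "T \<in> sobolev s" "U \<in> sobolev s"
  shows "energy s (\<lambda>\<omega>. fhat T \<omega> - fhat U \<omega>) = ennreal ((sobolev_norm s (\<lambda>\<phi>. T \<phi> - U \<phi>))\<^sup>2)"
proof -
  have "has_fourier (\<lambda>\<phi>. 1 * T \<phi> + (-1) * U \<phi>) (\<lambda>\<omega>. 1 * fhat T \<omega> + (-1) * fhat U \<omega>)"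
    using assms by (intro has_fourier_lincomb sobolev_has_fourier)
  then have F: "has_fourier (\<lambda>\<phi>. T \<phi> - U \<phi>) (\<lambda>\<omega>. fhat T \<omega> - fhat U \<omega>)" by simp
  have "energy s (\<lambda>\<omega>. 1 * fhat T \<omega> + (-1) * fhat U \<omega>) < \<infinity>"
    using assms by (intro energy_lincomb_finite sobolev_borel sobolev_energy)
  then have "energy s (\<lambda>\<omega>. fhat T \<omega> - fhat U \<omega>) < top" by simp
  then show ?thesis
    by (simp add: sobolev_norm_eq_energy[OF F])
qed

lemma spectral_space_fhat:
  assumes "\<And>i. \<Phi> $ i \<in> sobolev s" "T \<in> shift_inv_space s \<Phi>"
  shows "fhat T \<in> spectral_space s \<Phi>"
  using assms shift_inv_space_subset_sobolev[OF assms(1)]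
  by (intro spectral_spaceI[where T = "\<lambda>_. T"] sobolev_borel[of T s]) auto

lemma energy_scale_tendsto:
  fixes u :: "real^'d::finite \<Rightarrow> complex"
  assumes [measurable]: "u \<in> borel_measurable borel" "\<And>n. v n \<in> borel_measurable borel"
    and "c > 0" "s \<le> 0" and lim: "(\<lambda>n. energy s (\<lambda>\<omega>. v n \<omega> - u \<omega>)) \<longlonglongrightarrow> 0"
  shows "(\<lambda>n. energy s (\<lambda>\<omega>. v n (c *\<^sub>R \<omega>) - u (c *\<^sub>R \<omega>))) \<longlonglongrightarrow> 0"
proof (rule tendsto_zero_combine_ennreal[OF _ lim lim])
  show "energy s (\<lambda>\<omega>. v n (c *\<^sub>R \<omega>) - u (c *\<^sub>R \<omega>)) \<le>
      ennreal (inverse c ^ CARD('d) * max 1 c powr (- 2 * s)) * energy s (\<lambda>\<omega>. v n \<omega> - u \<omega>)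
      + 0 * energy s (\<lambda>\<omega>. v n \<omega> - u \<omega>)" for n
    using energy_scale[of "\<lambda>\<omega>. v n \<omega> - u \<omega>" c s] assms(3,4) by simp
qed auto

text \<open>
  Replacing a Lebesgue measurable function by a Borel one may destroy periodicity. It is restored
  by evaluating at the cell representative; the exceptional set is a countable union of translates
  of a null set.
\<close>

lemma periodic_borel_version:
  fixes p :: "real^'d::finite \<Rightarrow> complex"
  assumes p: "p \<in> borel_measurable lebesgue" and per: "periodic_2pi p"
  obtains q where "q \<in> borel_measurable borel" "AE \<omega> in lborel. p \<omega> = q (cell_rep \<omega>)"
proof -
  have re: "(\<lambda>\<omega>. Re (p \<omega>)) \<in> borel_measurable lebesgue" and im: "(\<lambda>\<omega>. Im (p \<omega>)) \<in> borel_measurable lebesgue"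
    using p by auto
  obtain a where a[measurable]: "a \<in> borel_measurable lborel" and "AE \<omega> in lborel. Re (p \<omega>) = a \<omega>"
    using completion_ex_borel_measurable_real[OF re] by blast
  moreover obtain b where b[measurable]: "b \<in> borel_measurable lborel" and "AE \<omega> in lborel. Im (p \<omega>) = b \<omega>"
    using completion_ex_borel_measurable_real[OF im] by blast
  ultimately have ab: "AE \<omega> in lborel. Re (p \<omega>) = a \<omega>" "AE \<omega> in lborel. Im (p \<omega>) = b \<omega>"
    by auto
  define q where "q \<omega> = Complex (a \<omega>) (b \<omega>)" for \<omega>
  have "q = (\<lambda>\<omega>. of_real (a \<omega>) + \<i> * of_real (b \<omega>))"
    by (simp add: q_def complex_eq_iff fun_eq_iff)
  then have q: "q \<in> borel_measurable borel" using a b by simp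
  have "AE \<omega> in lborel. p \<omega> = q \<omega>"
    using ab by eventually_elim (simp add: q_def complex_eq_iff)
  then have "AE \<omega> in lborel. p (\<omega> + (- 2 * pi) *\<^sub>R j) = q (\<omega> + (- 2 * pi) *\<^sub>R j)" for j
    by (rule AE_lborel_translate)
  then have "AE \<omega> in lborel. \<forall>j\<in>int_lattice. p (\<omega> + (- 2 * pi) *\<^sub>R j) = q (\<omega> + (- 2 * pi) *\<^sub>R j)"
    using countable_int_lattice by (subst AE_ball_countable) auto
  then have "AE \<omega> in lborel. p \<omega> = q (cell_rep \<omega>)"
  proof eventually_elim
    case (elim \<omega>)
    obtain j where j: "j \<in> int_lattice" "\<omega> = cell_rep \<omega> + (2 * pi) *\<^sub>R j"
      using cell_rep_lattice .
    then have "cell_rep \<omega> = \<omega> + (- 2 * pi) *\<^sub>R j" by (simp add: algebra_simps)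
    then have "q (cell_rep \<omega>) = p (cell_rep \<omega>)" using elim j(1) by metis
    also have "\<dots> = p (cell_rep \<omega> + (2 * pi) *\<^sub>R j)"
      using per j(1) by (simp add: periodic_2pi_def)
    finally show ?case using j(2) by simp
  qed
  with q show ?thesis by (rule that)
qed

lemma modulation_space_sum:
  assumes X: "modulation_space s X" and zero: "(\<lambda>\<omega>. 0) \<in> X" and "finite A" "\<And>i. i \<in> A \<Longrightarrow> u i \<in> X"
  shows "(\<lambda>\<omega>. \<Sum>i\<in>A. u i \<omega>) \<in> X"
  using assms(3,4)
proof induction
  case (insert i A)
  then show ?case
    using modulation_space_lincomb[OF X, of "u i" "\<lambda>\<omega>. \<Sum>i\<in>A. u i \<omega>" 1 1] by simp
qed (simp add: zero)

lemma spectral_space_zero: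
  assumes "\<And>i. \<Phi> $ i \<in> sobolev s"
  shows "(\<lambda>\<omega>. 0) \<in> spectral_space s \<Phi>"
  using modulation_space_lincomb[OF modulation_space_spectral_space[OF assms]
      spectral_space_fhat[OF assms shift_inv_space_zero] spectral_space_fhat[OF assms shift_inv_space_zero], of 0 0]
  by simp

text \<open>
  The entries of \<open>P\<close> may be unbounded, so the single terms of the refinement sum need not have finite
  energy. One therefore restricts the whole sum to the periodic set where all coefficients of the
  row are at most \<open>n\<close>. By the refinement equation the restricted sum is a restriction of the left-hand
  side, whose energy is finite and dominates as \<open>n\<close> grows.
\<close>

lemma spectral_space_refined_generator:
  fixes \<Phi> :: "('d::finite functional)^'r::finite"
  assumes s: "s \<le> 0"
    and P: "\<And>i j. (\<lambda>\<omega>. P \<omega> $ i $ j) \<in> borel_measurable lebesgue"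
    and per: "\<And>i j. periodic_2pi (\<lambda>\<omega>. P \<omega> $ i $ j)"
    and \<Phi>: "\<And>i. \<Phi> $ i \<in> sobolev s"
    and refine: "AE \<omega> in lborel. (\<chi> i. fhat (\<Phi> $ i) (2 *\<^sub>R \<omega>)) = P \<omega> *v (\<chi> i. fhat (\<Phi> $ i) \<omega>)"
  shows "(\<lambda>\<omega>. fhat (\<Phi> $ i) (2 *\<^sub>R \<omega>)) \<in> spectral_space s \<Phi>"
proof -
  let ?X = "spectral_space s \<Phi>" and ?v = "\<lambda>\<omega>. fhat (\<Phi> $ i) (2 *\<^sub>R \<omega>)"
  have X: "modulation_space s ?X" by (rule modulation_space_spectral_space[OF \<Phi>])
  have [measurable]: "fhat (\<Phi> $ i) \<in> borel_measurable borel" for i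
    by (rule sobolev_borel[OF \<Phi>])
  have "\<forall>j. \<exists>q. q \<in> borel_measurable borel \<and> (AE \<omega> in lborel. P \<omega> $ i $ j = q (cell_rep \<omega>))"
    using periodic_borel_version[OF P per] by metis
  from choice[OF this] obtain q where q[measurable]: "\<And>j. q j \<in> borel_measurable borel"
    and Pq: "\<And>j. AE \<omega> in lborel. P \<omega> $ i $ j = q j (cell_rep \<omega>)"
    by auto
  define t where "t n j x = (if \<forall>j. cmod (q j x) \<le> real n then q j x else 0)" for n j x
  have [measurable]: "t n j \<in> borel_measurable borel" for n j
    unfolding t_def[abs_def] by measurable
  define v where "v n \<omega> = (\<Sum>j\<in>UNIV. t n j (cell_rep \<omega>) * fhat (\<Phi> $ j) \<omega>)" for n \<omega>
  have v: "v n \<in> ?X" for n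
    unfolding v_def[abs_def]
  proof (rule modulation_space_sum[OF X spectral_space_zero[OF \<Phi>]])
    fix j
    have "(\<lambda>\<omega>. t n j (cell_rep \<omega>)) \<in> multipliers ?X"
      by (rule multipliers_cell_rep[OF X, of _ "real n"]) (auto simp: t_def)
    then show "(\<lambda>\<omega>. t n j (cell_rep \<omega>) * fhat (\<Phi> $ j) \<omega>) \<in> ?X"
      by (rule multipliers_times) (intro spectral_space_fhat \<Phi> shift_inv_space_generator)
  qed simp
  have "AE \<omega> in lborel. \<forall>j. P \<omega> $ i $ j = q j (cell_rep \<omega>)"
    using Pq by (subst AE_all_countable) auto
  then have eq: "AE \<omega> in lborel. \<forall>n. v n \<omega> = (if \<forall>j. cmod (q j (cell_rep \<omega>)) \<le> real n then ?v \<omega> else 0)"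
    using refine
  proof eventually_elim
    case (elim \<omega>)
    have "?v \<omega> = (\<Sum>j\<in>UNIV. P \<omega> $ i $ j * fhat (\<Phi> $ j) \<omega>)"
      using arg_cong[OF elim(2), of "\<lambda>x. x $ i"] by (simp add: matrix_vector_mult_def)
    moreover have "t n j (cell_rep \<omega>) =
        (if \<forall>j. cmod (q j (cell_rep \<omega>)) \<le> real n then P \<omega> $ i $ j else 0)" for n j
      using elim(1) by (simp only: t_def)
    ultimately have "v n \<omega> = (if \<forall>j. cmod (q j (cell_rep \<omega>)) \<le> real n then ?v \<omega> else 0)" for n
      by (cases "\<forall>j. cmod (q j (cell_rep \<omega>)) \<le> real n") (simp_all only: v_def if_True if_False mult_zero_left sum.neutral_const simp_thms)
    then show ?case by blast
  qed
  show ?thesis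
  proof (rule modulation_space_limit[OF X _ v])
    show "?v \<in> borel_measurable borel" by measurable
    show "(\<lambda>n. energy s (\<lambda>\<omega>. v n \<omega> - ?v \<omega>)) \<longlonglongrightarrow> 0"
    proof (rule energy_dominated_tendsto[where w = ?v])
      show "AE \<omega> in lborel. (\<lambda>n. v n \<omega>) \<longlonglongrightarrow> ?v \<omega>"
        using eq
      proof eventually_elim
        case (elim \<omega>)
        obtain N :: nat where "(\<Sum>j\<in>UNIV. cmod (q j (cell_rep \<omega>))) \<le> N"
          using real_arch_simple by blast
        then have "cmod (q j (cell_rep \<omega>)) \<le> N" for j
          using member_le_sum[of j UNIV "\<lambda>j. cmod (q j (cell_rep \<omega>))"] by simp
        then have "cmod (q j (cell_rep \<omega>)) \<le> n" if "n \<ge> N" for j n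
          using that by (meson of_nat_mono order_trans)
        then show ?case
          using elim by (intro tendsto_eventually) (auto simp: eventually_sequentially)
      qed
      show "AE \<omega> in lborel. cmod (v n \<omega> - ?v \<omega>) \<le> cmod (?v \<omega>)" for n
        using eq by eventually_elim auto
      have "energy s ?v \<le> ennreal (inverse 2 ^ CARD('d) * max 1 2 powr (- 2 * s)) * energy s (fhat (\<Phi> $ i))"
        using s by (intro energy_scale) auto
      also have "\<dots> < \<infinity>"
        using sobolev_energy[OF \<Phi>[of i]] by (simp add: ennreal_mult_less_top)
      finally show "energy s ?v < \<infinity>" .
      show "v n \<in> borel_measurable borel" for n
        using modulation_space_borel[OF X v] .
    qed measurable
  qed
qed

text \<open>
  The distributions whose transforms stay in the spectral space after \<open>\<omega> \<mapsto> 2\<omega>\<close> form a closed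
  subspace. It is shift-invariant because a shift by \<open>j\<close> turns into the modulation with frequency
  \<open>2j\<close>, again a lattice point. Containing the generators, it contains the shift-invariant space.
\<close>

lemma spectral_space_dilate_two:
  fixes \<Phi> :: "('d::finite functional)^'r::finite"
  assumes s: "s \<le> 0" and \<Phi>: "\<And>i. \<Phi> $ i \<in> sobolev s"
    and gen: "\<And>i. (\<lambda>\<omega>. fhat (\<Phi> $ i) (2 *\<^sub>R \<omega>)) \<in> spectral_space s \<Phi>"
    and u: "u \<in> spectral_space s \<Phi>"
  shows "(\<lambda>\<omega>. u (2 *\<^sub>R \<omega>)) \<in> spectral_space s \<Phi>"
proof -
  let ?X = "spectral_space s \<Phi>"
  have X: "modulation_space s ?X" by (rule modulation_space_spectral_space[OF \<Phi>])
  define V where "V = {T \<in> sobolev s. (\<lambda>\<omega>. fhat T (2 *\<^sub>R \<omega>)) \<in> ?X}"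
  have fm: "(\<lambda>\<omega>. fhat T (2 *\<^sub>R \<omega>)) \<in> borel_measurable borel" if "T \<in> sobolev s" for T :: "'d functional"
    using sobolev_borel[OF that] by measurable
  have lincomb: "(\<lambda>\<phi>. a * T \<phi> + b * U \<phi>) \<in> V" if T: "T \<in> V" and U: "U \<in> V" for a b T U
  proof -
    have sob: "T \<in> sobolev s" "U \<in> sobolev s" using T U by (auto simp: V_def)
    then have sob': "(\<lambda>\<phi>. a * T \<phi> + b * U \<phi>) \<in> sobolev s" by (rule sobolev_lincomb)
    have "(\<lambda>\<omega>. a * fhat T (2 *\<^sub>R \<omega>) + b * fhat U (2 *\<^sub>R \<omega>)) \<in> ?X"
      using T U by (intro modulation_space_lincomb[OF X]) (auto simp: V_def)
    moreover have "AE \<omega> in lborel. a * fhat T (2 *\<^sub>R \<omega>) + b * fhat U (2 *\<^sub>R \<omega>) =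
        fhat (\<lambda>\<phi>. a * T \<phi> + b * U \<phi>) (2 *\<^sub>R \<omega>)"
      using AE_lborel_scale[OF AE_fhat_lincomb[OF sob, of a b], of 2] by auto
    ultimately show ?thesis
      using modulation_space_cong_AE[OF X _ fm[OF sob']] sob' by (simp add: V_def)
  qed
  have zero: "(\<lambda>\<phi>. 0) \<in> V"
  proof -
    obtain i :: 'r where True by blast
    have "\<Phi> $ i \<in> V" using \<Phi> gen by (simp add: V_def)
    from lincomb[OF this this, of 0 0] show ?thesis by simp
  qed
  have translate: "translate j T \<in> V" if T: "T \<in> V" and j: "j \<in> int_lattice" for T j
  proof -
    have sob: "T \<in> sobolev s" using T by (simp add: V_def)
    have "2 *\<^sub>R j \<in> int_lattice" using j by (auto simp: int_lattice_def)
    then have "(\<lambda>\<omega>. exp (- \<i> * of_real ((2 *\<^sub>R j) \<bullet> \<omega>)) * fhat T (2 *\<^sub>R \<omega>)) \<in> ?X"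
      using T by (intro modulation_space_modulation[OF X]) (simp add: V_def)
    moreover have "AE \<omega> in lborel. exp (- \<i> * of_real ((2 *\<^sub>R j) \<bullet> \<omega>)) * fhat T (2 *\<^sub>R \<omega>) =
        fhat (translate j T) (2 *\<^sub>R \<omega>)"
      using AE_lborel_scale[OF AE_fhat_eq[OF has_fourier_translate[OF sobolev_has_fourier[OF sob], of j]], of 2]
      by auto
    ultimately show ?thesis
      using modulation_space_cong_AE[OF X _ fm[OF sobolev_translate[OF sob]]] sobolev_translate[OF sob]
      by (simp add: V_def)
  qed
  have limit: "T \<in> V"
    if T: "T \<in> sobolev s" and approx: "\<forall>\<epsilon>>0. \<exists>U\<in>V. sobolev_norm s (\<lambda>\<phi>. T \<phi> - U \<phi>) < \<epsilon>" for T
  proof -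
    have "\<forall>n. \<exists>U. U \<in> V \<and> sobolev_norm s (\<lambda>\<phi>. T \<phi> - U \<phi>) < 1 / real (Suc n)"
    proof
      fix n
      have "0 < 1 / real (Suc n)" by simp
      with approx show "\<exists>U. U \<in> V \<and> sobolev_norm s (\<lambda>\<phi>. T \<phi> - U \<phi>) < 1 / real (Suc n)" by blast
    qed
    from choice[OF this] obtain U where U: "\<And>n. U n \<in> V"
      "\<And>n. sobolev_norm s (\<lambda>\<phi>. T \<phi> - U n \<phi>) < 1 / real (Suc n)" by blast
    have sob: "U n \<in> sobolev s" for n using U(1) by (simp add: V_def)
    have "(\<lambda>n. energy s (\<lambda>\<omega>. fhat T \<omega> - fhat (U n) \<omega>)) \<longlonglongrightarrow> ennreal (0\<^sup>2)"
      unfolding energy_diff_eq_sobolev_norm[OF T sob]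
    proof (intro tendsto_ennrealI tendsto_power)
      have "(\<lambda>n. 1 / real (Suc n)) \<longlonglongrightarrow> 0"
        using LIMSEQ_inverse_real_of_nat by (simp add: inverse_eq_divide)
      then show "(\<lambda>n. sobolev_norm s (\<lambda>\<phi>. T \<phi> - U n \<phi>)) \<longlonglongrightarrow> 0"
        by (rule tendsto_sandwich[OF always_eventually always_eventually tendsto_const, rotated 2])
          (use U(2) in \<open>simp_all add: less_imp_le sobolev_norm_def del: of_nat_Suc\<close>)
    qed
    then have "(\<lambda>n. energy s (\<lambda>\<omega>. fhat (U n) \<omega> - fhat T \<omega>)) \<longlonglongrightarrow> 0"
      by (subst energy_minus_commute) simp
    then have "(\<lambda>n. energy s (\<lambda>\<omega>. fhat (U n) (2 *\<^sub>R \<omega>) - fhat T (2 *\<^sub>R \<omega>))) \<longlonglongrightarrow> 0"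
      using s by (intro energy_scale_tendsto sobolev_borel[OF T] sobolev_borel[OF sob]) auto
    then have "(\<lambda>\<omega>. fhat T (2 *\<^sub>R \<omega>)) \<in> ?X"
      using U(1) by (intro modulation_space_limit[OF X fm[OF T], of "\<lambda>n \<omega>. fhat (U n) (2 *\<^sub>R \<omega>)"])
        (auto simp: V_def)
    then show ?thesis using T by (simp add: V_def)
  qed
  have "closed_sobolev_subspace s V"
    unfolding closed_sobolev_subspace_def
  proof (intro conjI ballI allI impI)
    show "V \<subseteq> sobolev s" by (auto simp: V_def)
    show "(\<lambda>\<phi>. T \<phi> + U \<phi>) \<in> V" if "T \<in> V" "U \<in> V" for T U
      using lincomb[OF that, of 1 1] by simp
    show "(\<lambda>\<phi>. c * T \<phi>) \<in> V" if "T \<in> V" for c T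
      using lincomb[OF that that, of c 0] by simp
  qed (use zero limit in auto)
  then have SV: "shift_inv_space s \<Phi> \<subseteq> V"
    by (rule shift_inv_space_least) (use \<Phi> gen translate in \<open>auto simp: V_def\<close>)
  obtain T where T: "\<And>n. T n \<in> shift_inv_space s \<Phi>"
    and lim: "(\<lambda>n. energy s (\<lambda>\<omega>. fhat (T n) \<omega> - u \<omega>)) \<longlonglongrightarrow> 0"
    using u unfolding spectral_space_def by blast
  have TV: "T n \<in> V" for n using SV T by blast
  have um: "u \<in> borel_measurable borel" using modulation_space_borel[OF X u] .
  show ?thesis
  proof (rule modulation_space_limit[OF X])
    show "(\<lambda>\<omega>. u (2 *\<^sub>R \<omega>)) \<in> borel_measurable borel" using um by measurable
    show "(\<lambda>\<omega>. fhat (T n) (2 *\<^sub>R \<omega>)) \<in> ?X" for n using TV by (simp add: V_def)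
    have "fhat (T n) \<in> borel_measurable borel" for n
      using TV[of n] by (intro sobolev_borel[where s = s]) (simp add: V_def)
    then show "(\<lambda>n. energy s (\<lambda>\<omega>. fhat (T n) (2 *\<^sub>R \<omega>) - u (2 *\<^sub>R \<omega>))) \<longlonglongrightarrow> 0"
      using lim s by (intro energy_scale_tendsto um) auto
  qed
qed

lemma spectral_space_dilate_power_two:
  fixes \<Phi> :: "('d::finite functional)^'r::finite"
  assumes s: "s \<le> 0" and \<Phi>: "\<And>i. \<Phi> $ i \<in> sobolev s"
    and gen: "\<And>i. (\<lambda>\<omega>. fhat (\<Phi> $ i) (2 *\<^sub>R \<omega>)) \<in> spectral_space s \<Phi>"
    and u: "u \<in> spectral_space s \<Phi>"
  shows "(\<lambda>\<omega>. u (2 ^ m *\<^sub>R \<omega>)) \<in> spectral_space s \<Phi>"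
proof (induction m)
  case (Suc m)
  from spectral_space_dilate_two[OF s \<Phi> gen this] show ?case by (simp add: mult.commute)
qed (simp add: u)

section \<open>Aliasing estimate\<close>

lemma infinite_int_lattice: "infinite (int_lattice - {0 :: real^'d::finite})"
proof -
  obtain i :: 'd where True by blast
  let ?g = "\<lambda>n :: nat. real (Suc n) *\<^sub>R (axis i 1 :: real^'d)"
  have "inj ?g"
    by (auto simp: inj_def vec_eq_iff axis_def dest!: spec[of _ i])
  then have "infinite (range ?g)" by (rule range_inj_infinite)
  moreover have "?g n \<in> int_lattice - {0}" for n
  proof -
    have "?g n \<noteq> 0" by (simp add: axis_eq_0_iff del: of_nat_Suc)
    moreover have "?g n \<in> int_lattice" by (auto simp: int_lattice_def axis_def)
    ultimately show ?thesis by blast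
  qed
  then have "range ?g \<subseteq> int_lattice - {0}" by (intro image_subsetI)
  ultimately show ?thesis using finite_subset by blast
qed

text \<open>
  Summation over the lattice is handled through an enumeration, because integrals of series are
  exchanged with the sum for sequences.
\<close>

lemma suminf_le_infsum_ennreal:
  fixes f :: "'a \<Rightarrow> ennreal"
  assumes "inj g" "range g \<subseteq> B"
  shows "(\<Sum>n. f (g n)) \<le> infsum f B"
  unfolding suminf_eq_SUP
proof (rule SUP_least)
  fix n
  have "(\<Sum>i<n. f (g i)) = sum f (g ` {..<n})"
    using assms(1) by (subst sum.reindex) (auto simp: inj_on_def inj_def)
  also have "\<dots> \<le> infsum f B"
    unfolding nonneg_infsum_complete[OF zero_le] by (rule SUP_upper) (use assms(2) in auto)
  finally show "(\<Sum>i<n. f (g i)) \<le> infsum f B" .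
qed

lemma ennreal_le_suminf: "F n \<le> (\<Sum>n. F n :: ennreal)"
  using sum_le_suminf[of F "{n}"] by simp

text \<open>
  Off the ball that supports \<open>t\<close>, the periodization of \<open>t\<close> at \<open>\<xi>\<close> is the value of \<open>t\<close> at \<open>\<xi> - 2\<pi>j\<close> for
  some \<open>j \<noteq> 0\<close>. Bounding by the sum over all such \<open>j\<close> and moving each summand back by \<open>2\<pi>j\<close> collects
  the aliased values of \<open>u\<close> in front of the single function \<open>t\<close>.
\<close>

lemma periodized_product_integral:
  fixes t u :: "real^'d::finite \<Rightarrow> complex"
  assumes [measurable]: "t \<in> borel_measurable borel" "u \<in> borel_measurable borel"
    and c: "c \<noteq> 0" and supp: "\<And>\<xi>. t \<xi> \<noteq> 0 \<Longrightarrow> norm \<xi> \<le> \<rho>"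
  shows "(\<integral>\<^sup>+\<xi>. indicator {\<xi>. \<rho> < norm \<xi>} \<xi> * ennreal ((cmod (t (cell_rep \<xi>) * u (c *\<^sub>R \<xi>)))\<^sup>2) \<partial>lborel) \<le>
    (\<integral>\<^sup>+\<xi>. ennreal ((cmod (t \<xi>))\<^sup>2) *
      (\<Sum>\<^sub>\<infinity>\<alpha>\<in>(\<lambda>j. (c * (2 * pi)) *\<^sub>R j) ` (int_lattice - {0}). ennreal ((cmod (u (c *\<^sub>R \<xi> + \<alpha>)))\<^sup>2)) \<partial>lborel)"
proof -
  define g where "g = from_nat_into (int_lattice - {0 :: real^'d})"
  have "bij_betw g UNIV (int_lattice - {0})"
    unfolding g_def by (rule bij_betw_from_nat_into[OF countable_Diff[OF countable_int_lattice] infinite_int_lattice])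
  then have g: "inj g" "range g = int_lattice - {0}"
    by (auto simp: bij_betw_def)
  let ?f = "\<lambda>n \<xi>. ennreal ((cmod (t (\<xi> - (2 * pi) *\<^sub>R g n)))\<^sup>2) * ennreal ((cmod (u (c *\<^sub>R \<xi>)))\<^sup>2)"
  have "(\<integral>\<^sup>+\<xi>. indicator {\<xi>. \<rho> < norm \<xi>} \<xi> * ennreal ((cmod (t (cell_rep \<xi>) * u (c *\<^sub>R \<xi>)))\<^sup>2) \<partial>lborel) \<le>
      (\<integral>\<^sup>+\<xi>. (\<Sum>n. ?f n \<xi>) \<partial>lborel)"
  proof (intro nn_integral_mono)
    fix \<xi>
    show "indicator {\<xi>. \<rho> < norm \<xi>} \<xi> * ennreal ((cmod (t (cell_rep \<xi>) * u (c *\<^sub>R \<xi>)))\<^sup>2) \<le> (\<Sum>n. ?f n \<xi>)"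
    proof (cases "\<rho> < norm \<xi> \<and> t (cell_rep \<xi>) \<noteq> 0")
      case True
      obtain j where j: "j \<in> int_lattice" "\<xi> = cell_rep \<xi> + (2 * pi) *\<^sub>R j"
        using cell_rep_lattice .
      have rep: "cell_rep \<xi> = \<xi> - (2 * pi) *\<^sub>R j"
        by (subst (2) j(2)) simp
      have "j \<noteq> 0"
        using True supp[of "cell_rep \<xi>"] rep by auto
      then obtain n where n: "j = g n" using j(1) g(2) by blast
      have "?f n \<xi> \<le> (\<Sum>n. ?f n \<xi>)"
        by (rule ennreal_le_suminf)
      moreover have "cell_rep \<xi> = \<xi> - (2 * pi) *\<^sub>R g n" using rep n by simp
      ultimately show ?thesis using True
        by (simp add: norm_mult power_mult_distrib ennreal_mult)
    next
      case False
      then show ?thesis by (auto simp: indicator_def)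
    qed
  qed
  also have "\<dots> = (\<Sum>n. \<integral>\<^sup>+\<xi>. ?f n \<xi> \<partial>lborel)"
    by (rule nn_integral_suminf) measurable
  also have "\<dots> = (\<Sum>n. \<integral>\<^sup>+\<xi>. ennreal ((cmod (t \<xi>))\<^sup>2) * ennreal ((cmod (u (c *\<^sub>R \<xi> + (c * (2 * pi)) *\<^sub>R g n)))\<^sup>2) \<partial>lborel)"
  proof (intro suminf_cong)
    fix n
    have "(\<integral>\<^sup>+\<xi>. ?f n \<xi> \<partial>lborel) = (\<integral>\<^sup>+\<xi>. ?f n (\<xi> + (2 * pi) *\<^sub>R g n) \<partial>lborel)"
      by (rule nn_integral_lborel_translate[symmetric]) measurable
    then show "(\<integral>\<^sup>+\<xi>. ?f n \<xi> \<partial>lborel) =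
        (\<integral>\<^sup>+\<xi>. ennreal ((cmod (t \<xi>))\<^sup>2) * ennreal ((cmod (u (c *\<^sub>R \<xi> + (c * (2 * pi)) *\<^sub>R g n)))\<^sup>2) \<partial>lborel)"
      by (simp add: scaleR_add_right)
  qed
  also have "\<dots> = (\<integral>\<^sup>+\<xi>. (\<Sum>n. ennreal ((cmod (t \<xi>))\<^sup>2) * ennreal ((cmod (u (c *\<^sub>R \<xi> + (c * (2 * pi)) *\<^sub>R g n)))\<^sup>2)) \<partial>lborel)"
    by (rule nn_integral_suminf[symmetric]) measurable
  also have "\<dots> \<le> (\<integral>\<^sup>+\<xi>. ennreal ((cmod (t \<xi>))\<^sup>2) *
      (\<Sum>\<^sub>\<infinity>\<alpha>\<in>(\<lambda>j. (c * (2 * pi)) *\<^sub>R j) ` (int_lattice - {0}). ennreal ((cmod (u (c *\<^sub>R \<xi> + \<alpha>)))\<^sup>2)) \<partial>lborel)"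
  proof (intro nn_integral_mono)
    fix \<xi> :: "real^'d"
    have "inj (\<lambda>n. (c * (2 * pi)) *\<^sub>R g n)"
      using g(1) c by (auto simp: inj_def)
    then have "(\<Sum>n. ennreal ((cmod (u (c *\<^sub>R \<xi> + (c * (2 * pi)) *\<^sub>R g n)))\<^sup>2)) \<le>
        (\<Sum>\<^sub>\<infinity>\<alpha>\<in>(\<lambda>j. (c * (2 * pi)) *\<^sub>R j) ` (int_lattice - {0}). ennreal ((cmod (u (c *\<^sub>R \<xi> + \<alpha>)))\<^sup>2))"
      by (rule suminf_le_infsum_ennreal) (auto simp flip: g(2))
    then show "(\<Sum>n. ennreal ((cmod (t \<xi>))\<^sup>2) * ennreal ((cmod (u (c *\<^sub>R \<xi> + (c * (2 * pi)) *\<^sub>R g n)))\<^sup>2)) \<le>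
        ennreal ((cmod (t \<xi>))\<^sup>2) *
          (\<Sum>\<^sub>\<infinity>\<alpha>\<in>(\<lambda>j. (c * (2 * pi)) *\<^sub>R j) ` (int_lattice - {0}). ennreal ((cmod (u (c *\<^sub>R \<xi> + \<alpha>)))\<^sup>2))"
      by (simp add: ennreal_suminf_cmult mult_left_mono)
  qed
  finally show ?thesis .
qed

section \<open>The approximant\<close>

text \<open>
  The factor that turns \<open>u(2\<^sup>m\<cdot>)\<close> into \<open>H\<close> on the shell where \<open>2\<^sup>m\<xi>\<close> lies in the annulus. The cut-off of
  \<open>H\<close> at height \<open>M\<close> and the lower bound \<open>c\<close> for the denominator make it bounded everywhere.
\<close>

definition shell_quotient ::
    "real \<Rightarrow> real \<Rightarrow> nat \<Rightarrow> (real^'d \<Rightarrow> complex) \<Rightarrow> (real^'d \<Rightarrow> complex) \<Rightarrow> nat \<Rightarrow> real^'d \<Rightarrow> complex" where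
  "shell_quotient \<rho> c M H u m \<xi> =
     (if 2 ^ m *\<^sub>R \<xi> \<in> annulus \<rho> \<and> cmod (H \<xi>) \<le> real M \<and> c \<le> cmod (u (2 ^ m *\<^sub>R \<xi>))
      then H \<xi> / u (2 ^ m *\<^sub>R \<xi>) else 0)"

text \<open>
  The parameter \<open>M\<close> serves both as the number of shells and as the height of the cut-off, so that a
  single limit removes both truncations.
\<close>

definition approximant ::
    "real \<Rightarrow> real \<Rightarrow> nat \<Rightarrow> (real^'d \<Rightarrow> complex) \<Rightarrow> (real^'d \<Rightarrow> complex) \<Rightarrow> real^'d \<Rightarrow> complex" where
  "approximant \<rho> c M H u \<xi> =
     (\<Sum>m<M. shell_quotient \<rho> c M H u m (cell_rep \<xi>) * u (2 ^ m *\<^sub>R \<xi>))"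

lemma annulus_dyadic_unique:
  assumes "2 ^ m *\<^sub>R \<xi> \<in> annulus \<rho>" "2 ^ n *\<^sub>R \<xi> \<in> annulus \<rho>"
  shows "m = n"
proof -
  have "\<not> m < n" if "2 ^ m *\<^sub>R \<xi> \<in> annulus \<rho>" "2 ^ n *\<^sub>R \<xi> \<in> annulus \<rho>" for m n
  proof
    assume "m < n"
    then have "(2::real) ^ Suc m \<le> 2 ^ n" by (intro power_increasing) auto
    then have "2 ^ Suc m * norm \<xi> \<le> 2 ^ n * norm \<xi>" by (intro mult_right_mono) auto
    then show False using that by (simp add: annulus_def)
  qed
  with assms show ?thesis by (meson linorder_neqE_nat)
qed

lemma annulus_dyadic_exists:
  "\<rho> / 2 ^ M < norm \<xi> \<Longrightarrow> norm \<xi> \<le> \<rho> \<Longrightarrow> \<exists>m<M. 2 ^ m *\<^sub>R \<xi> \<in> annulus \<rho>"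
proof (induction M)
  case (Suc M)
  show ?case
  proof (cases "\<rho> / 2 ^ M < norm \<xi>")
    case True
    then show ?thesis using Suc by (auto intro: less_SucI)
  next
    case False
    then have "2 ^ M *\<^sub>R \<xi> \<in> annulus \<rho>"
      using Suc.prems by (simp add: annulus_def field_simps)
    then show ?thesis by blast
  qed
qed simp

lemma annulus_dyadic_small:
  assumes "norm \<xi> \<le> \<rho> / 2 ^ M" "m < M" "0 \<le> \<rho>"
  shows "2 ^ m *\<^sub>R \<xi> \<notin> annulus \<rho>"
proof -
  have "(2::real) ^ Suc m \<le> 2 ^ M" using assms by (intro power_increasing) auto
  then have "2 ^ Suc m * norm \<xi> \<le> 2 ^ M * norm \<xi>" by (intro mult_right_mono) auto
  also have "\<dots> \<le> \<rho>" using assms(1) by (simp add: field_simps)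
  finally show ?thesis by (simp add: annulus_def)
qed

lemma annulus_borel [measurable]: "annulus \<rho> \<in> sets borel"
  unfolding annulus_def by measurable

lemma shell_quotient_borel:
  assumes [measurable]: "H \<in> borel_measurable borel" "u \<in> borel_measurable borel"
  shows "shell_quotient \<rho> c M H u m \<in> borel_measurable borel"
  unfolding shell_quotient_def[abs_def] by measurable

lemma shell_quotient_bound:
  assumes "0 < c"
  shows "cmod (shell_quotient \<rho> c M H u m \<xi>) \<le> real M / c"
  using assms by (auto simp: shell_quotient_def norm_divide intro!: frac_le)

lemma shell_quotient_support:
  assumes "shell_quotient \<rho> c M H u m \<xi> \<noteq> 0"
  shows "2 ^ m *\<^sub>R \<xi> \<in> annulus \<rho>" "norm \<xi> \<le> \<rho>"
proof -
  show A: "2 ^ m *\<^sub>R \<xi> \<in> annulus \<rho>"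
    using assms by (auto simp: shell_quotient_def split: if_splits)
  have "1 * norm \<xi> \<le> 2 ^ m * norm \<xi>" by (intro mult_right_mono) auto
  then show "norm \<xi> \<le> \<rho>" using A by (simp add: annulus_def)
qed

lemma shell_quotient_square_le:
  assumes "0 < c"
  shows "(cmod (shell_quotient \<rho> c M H u m \<xi>))\<^sup>2 \<le> (cmod (H \<xi>))\<^sup>2 / c\<^sup>2"
proof -
  have "cmod (shell_quotient \<rho> c M H u m \<xi>) \<le> cmod (H \<xi>) / c"
    using assms by (auto simp: shell_quotient_def norm_divide intro!: divide_left_mono mult_pos_pos)
  then have "(cmod (shell_quotient \<rho> c M H u m \<xi>))\<^sup>2 \<le> (cmod (H \<xi>) / c)\<^sup>2"
    by (intro power_mono) auto
  then show ?thesis by (simp add: power_divide)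
qed

lemma approximant_in_modulation_space:
  assumes X: "modulation_space s X" "(\<lambda>\<omega>. 0) \<in> X" and "0 < c"
    and H: "H \<in> borel_measurable borel" and u: "u \<in> borel_measurable borel"
    and uX: "\<And>m. (\<lambda>\<omega>. u (2 ^ m *\<^sub>R \<omega>)) \<in> X"
  shows "approximant \<rho> c M H u \<in> X"
  unfolding approximant_def[abs_def]
  by (intro modulation_space_sum[OF X] finite_lessThan multipliers_times
      multipliers_cell_rep[OF X(1) shell_quotient_borel[OF H u] shell_quotient_bound[OF \<open>0 < c\<close>]] uX)

text \<open>
  Inside the ball the cell representative of \<open>\<xi>\<close> is \<open>\<xi>\<close> itself and exactly one shell contains \<open>\<xi>\<close>,
  unless \<open>\<xi>\<close> is too close to the origin for the first \<open>M\<close> shells.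
\<close>

lemma approximant_inside:
  assumes \<rho>: "0 < \<rho>" "\<rho> < pi" and "norm \<xi> \<le> \<rho>" and c: "0 < c"
    and below: "\<And>m. 2 ^ m *\<^sub>R \<xi> \<in> annulus \<rho> \<Longrightarrow> c \<le> cmod (u (2 ^ m *\<^sub>R \<xi>))"
  shows "H \<xi> - approximant \<rho> c M H u \<xi> =
    (if norm \<xi> \<le> \<rho> / 2 ^ M \<or> real M < cmod (H \<xi>) then H \<xi> else 0)"
proof -
  have "\<bar>\<xi> $ i\<bar> < pi" for i
    using component_le_norm_cart[of \<xi> i] assms by linarith
  then have rep: "cell_rep \<xi> = \<xi>" by (rule cell_rep_eq)
  have "approximant \<rho> c M H u \<xi> =
      (\<Sum>m<M. if 2 ^ m *\<^sub>R \<xi> \<in> annulus \<rho> \<and> cmod (H \<xi>) \<le> real M then H \<xi> else 0)"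
    unfolding approximant_def rep
  proof (intro sum.cong refl)
    fix m
    show "shell_quotient \<rho> c M H u m \<xi> * u (2 ^ m *\<^sub>R \<xi>) =
        (if 2 ^ m *\<^sub>R \<xi> \<in> annulus \<rho> \<and> cmod (H \<xi>) \<le> real M then H \<xi> else 0)"
      using below[of m] c by (auto simp: shell_quotient_def)
  qed
  also have "\<dots> = (if norm \<xi> \<le> \<rho> / 2 ^ M \<or> real M < cmod (H \<xi>) then 0 else H \<xi>)"
  proof (cases "norm \<xi> \<le> \<rho> / 2 ^ M \<or> real M < cmod (H \<xi>)")
    case True
    then have "(if 2 ^ m *\<^sub>R \<xi> \<in> annulus \<rho> \<and> cmod (H \<xi>) \<le> real M then H \<xi> else 0) = 0" if "m < M" for m
      using annulus_dyadic_small[of \<xi> \<rho> M m] that \<rho> by auto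
    then show ?thesis using True by simp
  next
    case False
    then obtain n where n: "n < M" "2 ^ n *\<^sub>R \<xi> \<in> annulus \<rho>"
      using annulus_dyadic_exists[of \<rho> M \<xi>] assms(3) by (auto simp: not_le)
    have "(if 2 ^ m *\<^sub>R \<xi> \<in> annulus \<rho> \<and> cmod (H \<xi>) \<le> real M then H \<xi> else 0) = (if m = n then H \<xi> else 0)" for m
    proof (cases "m = n")
      case True
      then show ?thesis using n(2) False by (simp add: not_le not_less)
    next
      case neq: False
      then have "2 ^ m *\<^sub>R \<xi> \<notin> annulus \<rho>" using annulus_dyadic_unique[OF _ n(2)] by blast
      then show ?thesis using neq by simp
    qed
    then have "(\<Sum>m<M. if 2 ^ m *\<^sub>R \<xi> \<in> annulus \<rho> \<and> cmod (H \<xi>) \<le> real M then H \<xi> else 0) =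
        (\<Sum>m<M. if m = n then H \<xi> else 0)" by (simp only:)
    then show ?thesis using n(1) False by (simp only: if_False) simp
  qed
  finally show ?thesis by simp
qed

lemma norm_sum_square_le_of_unique:
  fixes f :: "'a \<Rightarrow> complex"
  assumes "finite A" and uniq: "\<And>i j. i \<in> A \<Longrightarrow> j \<in> A \<Longrightarrow> f i \<noteq> 0 \<Longrightarrow> f j \<noteq> 0 \<Longrightarrow> i = j"
  shows "(cmod (sum f A))\<^sup>2 \<le> (\<Sum>i\<in>A. (cmod (f i))\<^sup>2)"
proof (cases "\<exists>i\<in>A. f i \<noteq> 0")
  case True
  then obtain i where i: "i \<in> A" "f i \<noteq> 0" by blast
  have "sum f A = f i + sum f (A - {i})"
    using assms(1) i(1) by (rule sum.remove)
  moreover have "sum f (A - {i}) = 0"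
    using uniq[OF i(1) _ i(2)] by (intro sum.neutral) auto
  ultimately have "(cmod (sum f A))\<^sup>2 = (cmod (f i))\<^sup>2" by simp
  also have "\<dots> \<le> (\<Sum>i\<in>A. (cmod (f i))\<^sup>2)"
    using assms(1) i(1) by (intro member_le_sum) auto
  finally show ?thesis .
qed (simp add: sum_nonneg)

text \<open>
  The shells are disjoint, so the square of the approximant is at most the sum of the squares of its
  terms. In the \<open>m\<close>-th term the aliasing factor is at most \<open>C 2\<^bsup>-2mk\<^esup>\<close>, while \<open>2\<^bsup>-m\<^esup> \<le> (2/\<rho>) |\<xi>|\<close> on the
  shell; trading the one for the other leaves the bound \<open>|\<xi>|\<^bsup>2k\<^esup>\<close> that no longer depends on \<open>m\<close>, nor
  on \<open>M\<close>.
\<close>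

lemma approximant_tail:
  fixes H u :: "real^'d::finite \<Rightarrow> complex"
  assumes [measurable]: "H \<in> borel_measurable borel" "u \<in> borel_measurable borel"
    and \<rho>: "0 < \<rho>" and c: "0 < c" and k: "0 < k"
    and aliasing: "\<And>m :: nat. AE \<omega> in lborel. \<omega> \<in> annulus \<rho> \<longrightarrow>
       (\<Sum>\<^sub>\<infinity>\<alpha>\<in>(\<lambda>j. (2 ^ m * (2 * pi)) *\<^sub>R j) ` (int_lattice - {0}). ennreal ((cmod (u (\<omega> + \<alpha>)))\<^sup>2))
         \<le> ennreal (C * 2 powr (- 2 * real m * k))"
  shows "(\<integral>\<^sup>+\<xi>. indicator {\<xi>. \<rho> < norm \<xi>} \<xi> * ennreal ((cmod (approximant \<rho> c M H u \<xi>))\<^sup>2) \<partial>lborel) \<le>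
    ennreal (\<bar>C\<bar> * (2 / \<rho>) powr (2 * k) / c\<^sup>2) * (\<integral>\<^sup>+\<xi>. ennreal (norm \<xi> powr (2 * k) * (cmod (H \<xi>))\<^sup>2) \<partial>lborel)"
proof -
  let ?t = "shell_quotient \<rho> c M H u"
  let ?K = "\<bar>C\<bar> * (2 / \<rho>) powr (2 * k) / c\<^sup>2"
  let ?I = "\<lambda>\<xi> :: real^'d. indicator {\<xi>. \<rho> < norm \<xi>} \<xi> :: ennreal"
  let ?S = "\<lambda>m \<omega>. \<Sum>\<^sub>\<infinity>\<alpha>\<in>(\<lambda>j. (2 ^ m * (2 * pi)) *\<^sub>R j) ` (int_lattice - {0}). ennreal ((cmod (u (\<omega> + \<alpha>)))\<^sup>2)"
  have [measurable]: "?t m \<in> borel_measurable borel" for m by (rule shell_quotient_borel) measurable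
  have "(\<integral>\<^sup>+\<xi>. ?I \<xi> * ennreal ((cmod (approximant \<rho> c M H u \<xi>))\<^sup>2) \<partial>lborel) \<le>
      (\<integral>\<^sup>+\<xi>. (\<Sum>m<M. ?I \<xi> * ennreal ((cmod (?t m (cell_rep \<xi>) * u (2 ^ m *\<^sub>R \<xi>)))\<^sup>2)) \<partial>lborel)"
  proof (intro nn_integral_mono)
    fix \<xi>
    have "(cmod (approximant \<rho> c M H u \<xi>))\<^sup>2 \<le> (\<Sum>m<M. (cmod (?t m (cell_rep \<xi>) * u (2 ^ m *\<^sub>R \<xi>)))\<^sup>2)"
      unfolding approximant_def
    proof (rule norm_sum_square_le_of_unique)
      fix m n
      assume "?t m (cell_rep \<xi>) * u (2 ^ m *\<^sub>R \<xi>) \<noteq> 0" "?t n (cell_rep \<xi>) * u (2 ^ n *\<^sub>R \<xi>) \<noteq> 0"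
      then have "?t m (cell_rep \<xi>) \<noteq> 0" "?t n (cell_rep \<xi>) \<noteq> 0" by auto
      from this[THEN shell_quotient_support(1)] show "m = n" by (rule annulus_dyadic_unique)
    qed simp
    then have "ennreal ((cmod (approximant \<rho> c M H u \<xi>))\<^sup>2) \<le> (\<Sum>m<M. ennreal ((cmod (?t m (cell_rep \<xi>) * u (2 ^ m *\<^sub>R \<xi>)))\<^sup>2))"
      by (subst sum_ennreal) (auto intro: ennreal_leI)
    then show "?I \<xi> * ennreal ((cmod (approximant \<rho> c M H u \<xi>))\<^sup>2) \<le>
        (\<Sum>m<M. ?I \<xi> * ennreal ((cmod (?t m (cell_rep \<xi>) * u (2 ^ m *\<^sub>R \<xi>)))\<^sup>2))"
      unfolding sum_distrib_left[symmetric] by (rule mult_left_mono) simp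
  qed
  also have "\<dots> = (\<Sum>m<M. \<integral>\<^sup>+\<xi>. ?I \<xi> * ennreal ((cmod (?t m (cell_rep \<xi>) * u (2 ^ m *\<^sub>R \<xi>)))\<^sup>2) \<partial>lborel)"
    by (rule nn_integral_sum) measurable
  also have "\<dots> \<le> (\<Sum>m<M. \<integral>\<^sup>+\<xi>. ennreal ((cmod (?t m \<xi>))\<^sup>2) * ?S m (2 ^ m *\<^sub>R \<xi>) \<partial>lborel)"
    by (intro sum_mono periodized_product_integral) (auto intro: shell_quotient_support(2))
  also have "\<dots> \<le> (\<Sum>m<M. \<integral>\<^sup>+\<xi>. indicator {\<xi>. 2 ^ m *\<^sub>R \<xi> \<in> annulus \<rho>} \<xi> *
      ennreal (?K * (norm \<xi> powr (2 * k) * (cmod (H \<xi>))\<^sup>2)) \<partial>lborel)"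
  proof (intro sum_mono nn_integral_mono_AE)
    fix m
    have "AE \<xi> in lborel. 2 ^ m *\<^sub>R \<xi> \<in> annulus \<rho> \<longrightarrow> ?S m (2 ^ m *\<^sub>R \<xi>) \<le> ennreal (C * 2 powr (- 2 * real m * k))"
      by (rule AE_lborel_scale[OF aliasing]) simp
    then show "AE \<xi> in lborel. ennreal ((cmod (?t m \<xi>))\<^sup>2) * ?S m (2 ^ m *\<^sub>R \<xi>) \<le>
        indicator {\<xi>. 2 ^ m *\<^sub>R \<xi> \<in> annulus \<rho>} \<xi> * ennreal (?K * (norm \<xi> powr (2 * k) * (cmod (H \<xi>))\<^sup>2))"
    proof eventually_elim
      case (elim \<xi>)
      show ?case
      proof (cases "?t m \<xi> = 0")
        case False
        then have A: "2 ^ m *\<^sub>R \<xi> \<in> annulus \<rho>" by (rule shell_quotient_support)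
        then have "\<rho> / 2 < 2 ^ m * norm \<xi>" by (simp add: annulus_def)
        then have "1 / 2 ^ m \<le> 2 / \<rho> * norm \<xi>" using \<rho> by (simp add: field_simps)
        then have "(1 / 2 ^ m) powr (2 * k) \<le> (2 / \<rho> * norm \<xi>) powr (2 * k)"
          using k by (intro powr_mono2) auto
        moreover have "(1 / 2 ^ m) powr (2 * k) = 2 powr (- 2 * real m * k)"
          by (simp add: powr_divide powr_powr powr_minus inverse_eq_divide mult_ac flip: powr_realpow)
        moreover have "(2 / \<rho> * norm \<xi>) powr (2 * k) = (2 / \<rho>) powr (2 * k) * norm \<xi> powr (2 * k)"
          by (rule powr_mult)
        ultimately have pow: "2 powr (- 2 * real m * k) \<le> (2 / \<rho>) powr (2 * k) * norm \<xi> powr (2 * k)"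
          by simp
        have "C * 2 powr (- 2 * real m * k) \<le> \<bar>C\<bar> * 2 powr (- 2 * real m * k)"
          by (intro mult_right_mono) auto
        also have "\<dots> \<le> \<bar>C\<bar> * ((2 / \<rho>) powr (2 * k) * norm \<xi> powr (2 * k))"
          using pow by (intro mult_left_mono) auto
        finally have "?S m (2 ^ m *\<^sub>R \<xi>) \<le> ennreal (\<bar>C\<bar> * ((2 / \<rho>) powr (2 * k) * norm \<xi> powr (2 * k)))"
          using elim A order_trans[OF _ ennreal_leI] by blast
        then have "ennreal ((cmod (?t m \<xi>))\<^sup>2) * ?S m (2 ^ m *\<^sub>R \<xi>) \<le>
            ennreal ((cmod (H \<xi>))\<^sup>2 / c\<^sup>2) * ennreal (\<bar>C\<bar> * ((2 / \<rho>) powr (2 * k) * norm \<xi> powr (2 * k)))"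
          by (intro mult_mono ennreal_leI shell_quotient_square_le c) auto
        also have "\<dots> = ennreal (?K * (norm \<xi> powr (2 * k) * (cmod (H \<xi>))\<^sup>2))"
          by (subst ennreal_mult[symmetric]) (auto intro!: arg_cong[where f = ennreal])
        finally show ?thesis using A by simp
      qed simp
    qed
  qed
  also have "\<dots> = (\<integral>\<^sup>+\<xi>. (\<Sum>m<M. indicator {\<xi>. 2 ^ m *\<^sub>R \<xi> \<in> annulus \<rho>} \<xi> *
      ennreal (?K * (norm \<xi> powr (2 * k) * (cmod (H \<xi>))\<^sup>2))) \<partial>lborel)"
    by (rule nn_integral_sum[symmetric]) measurable
  also have "\<dots> \<le> (\<integral>\<^sup>+\<xi>. ennreal ?K * ennreal (norm \<xi> powr (2 * k) * (cmod (H \<xi>))\<^sup>2) \<partial>lborel)"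
  proof (intro nn_integral_mono)
    fix \<xi> :: "real^'d"
    have "(\<Sum>m<M. indicator {\<xi>. 2 ^ m *\<^sub>R \<xi> \<in> annulus \<rho>} \<xi> :: ennreal) \<le> 1"
    proof (cases "\<exists>n<M. 2 ^ n *\<^sub>R \<xi> \<in> annulus \<rho>")
      case True
      then obtain n where n: "n < M" "2 ^ n *\<^sub>R \<xi> \<in> annulus \<rho>" by blast
      have "indicator {\<xi>. 2 ^ m *\<^sub>R \<xi> \<in> annulus \<rho>} \<xi> = (if m = n then 1 else 0 :: ennreal)" for m
      proof (cases "m = n")
        case True
        then show ?thesis using n(2) by simp
      next
        case False
        then have "2 ^ m *\<^sub>R \<xi> \<notin> annulus \<rho>" using annulus_dyadic_unique[OF _ n(2)] by blast
        then show ?thesis using False by simp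
      qed
      then show ?thesis using n(1) by simp
    qed (simp add: indicator_def)
    then have "(\<Sum>m<M. indicator {\<xi>. 2 ^ m *\<^sub>R \<xi> \<in> annulus \<rho>} \<xi>) * ennreal (?K * (norm \<xi> powr (2 * k) * (cmod (H \<xi>))\<^sup>2))
        \<le> 1 * ennreal (?K * (norm \<xi> powr (2 * k) * (cmod (H \<xi>))\<^sup>2))"
      by (rule mult_right_mono) simp
    moreover have "ennreal (?K * (norm \<xi> powr (2 * k) * (cmod (H \<xi>))\<^sup>2)) =
        ennreal ?K * ennreal (norm \<xi> powr (2 * k) * (cmod (H \<xi>))\<^sup>2)"
      by (rule ennreal_mult) auto
    ultimately show "(\<Sum>m<M. indicator {\<xi>. 2 ^ m *\<^sub>R \<xi> \<in> annulus \<rho>} \<xi> * ennreal (?K * (norm \<xi> powr (2 * k) * (cmod (H \<xi>))\<^sup>2)))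
        \<le> ennreal ?K * ennreal (norm \<xi> powr (2 * k) * (cmod (H \<xi>))\<^sup>2)"
      by (simp only: sum_distrib_right mult_1)
  qed
  also have "\<dots> = ennreal ?K * (\<integral>\<^sup>+\<xi>. ennreal (norm \<xi> powr (2 * k) * (cmod (H \<xi>))\<^sup>2) \<partial>lborel)"
    by (rule nn_integral_cmult) measurable
  finally show ?thesis .
qed

section \<open>Approximation order\<close>

lemma energy_mono_order:
  assumes "s \<le> k"
  shows "energy s u \<le> energy k u"
  unfolding energy_def
  by (intro nn_integral_mono ennreal_leI mult_right_mono powr_mono) (use assms in auto)

lemma weight_outside_le:
  assumes "s \<le> 0" "0 < k" "0 < r" "r \<le> norm \<omega>"
  shows "(1 + norm \<omega>) powr (2 * s) \<le> r powr (2 * s)"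
    and "(1 + norm \<omega>) powr (2 * s) \<le> r powr (2 * s - 2 * k) * (1 + norm \<omega>) powr (2 * k)"
proof -
  show "(1 + norm \<omega>) powr (2 * s) \<le> r powr (2 * s)"
    using assms by (intro powr_mono2') auto
  have "(1 + norm \<omega>) powr (2 * s - 2 * k) \<le> r powr (2 * s - 2 * k)"
    using assms by (intro powr_mono2') auto
  then have "(1 + norm \<omega>) powr (2 * s - 2 * k) * (1 + norm \<omega>) powr (2 * k) \<le> r powr (2 * s - 2 * k) * (1 + norm \<omega>) powr (2 * k)"
    by (rule mult_right_mono) simp
  then show "(1 + norm \<omega>) powr (2 * s) \<le> r powr (2 * s - 2 * k) * (1 + norm \<omega>) powr (2 * k)"
    by (simp flip: powr_add)
qed

text \<open>
  The substitution \<open>\<xi> = h\<omega>\<close> turns \<open>|\<xi>|\<^bsup>2k\<^esup>\<close> into the factor \<open>h\<^bsup>2k\<^esup>\<close>; the powers of \<open>h\<close> coming from the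
  volume cancel because both sides are rescaled.
\<close>

lemma scaled_approximant_tail:
  fixes G u :: "real^'d::finite \<Rightarrow> complex"
  assumes [measurable]: "G \<in> borel_measurable borel" "u \<in> borel_measurable borel"
    and \<rho>: "0 < \<rho>" and c: "0 < c" and k: "0 < k" and h: "0 < h"
    and aliasing: "\<And>m :: nat. AE \<omega> in lborel. \<omega> \<in> annulus \<rho> \<longrightarrow>
       (\<Sum>\<^sub>\<infinity>\<alpha>\<in>(\<lambda>j. (2 ^ m * (2 * pi)) *\<^sub>R j) ` (int_lattice - {0}). ennreal ((cmod (u (\<omega> + \<alpha>)))\<^sup>2))
         \<le> ennreal (C * 2 powr (- 2 * real m * k))"
  shows "(\<integral>\<^sup>+\<omega>. indicator {\<omega>. \<rho> < norm (h *\<^sub>R \<omega>)} \<omega> *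
      ennreal ((cmod (approximant \<rho> c M (\<lambda>\<xi>. G (inverse h *\<^sub>R \<xi>)) u (h *\<^sub>R \<omega>)))\<^sup>2) \<partial>lborel) \<le>
    ennreal (\<bar>C\<bar> * (2 / \<rho>) powr (2 * k) / c\<^sup>2 * h powr (2 * k)) * energy k G"
proof -
  let ?H = "\<lambda>\<xi>. G (inverse h *\<^sub>R \<xi>)"
  let ?K = "\<bar>C\<bar> * (2 / \<rho>) powr (2 * k) / c\<^sup>2"
  let ?d = "ennreal (inverse h ^ CARD('d))"
  have [measurable]: "approximant \<rho> c M ?H u \<in> borel_measurable borel"
    unfolding approximant_def[abs_def]
    by (intro borel_measurable_sum borel_measurable_times measurable_compose[OF cell_rep_borel shell_quotient_borel]) measurable
  have "(\<integral>\<^sup>+\<omega>. indicator {\<omega>. \<rho> < norm (h *\<^sub>R \<omega>)} \<omega> * ennreal ((cmod (approximant \<rho> c M ?H u (h *\<^sub>R \<omega>)))\<^sup>2) \<partial>lborel) =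
      (\<integral>\<^sup>+\<omega>. (\<lambda>\<xi>. indicator {\<xi>. \<rho> < norm \<xi>} \<xi> * ennreal ((cmod (approximant \<rho> c M ?H u \<xi>))\<^sup>2)) (h *\<^sub>R \<omega>) \<partial>lborel)"
    by (simp add: indicator_def)
  also have "\<dots> = ?d * (\<integral>\<^sup>+\<xi>. indicator {\<xi>. \<rho> < norm \<xi>} \<xi> * ennreal ((cmod (approximant \<rho> c M ?H u \<xi>))\<^sup>2) \<partial>lborel)"
    using h by (subst nn_integral_lborel_scale) auto
  also have "\<dots> \<le> ?d * (ennreal ?K * (\<integral>\<^sup>+\<xi>. ennreal (norm \<xi> powr (2 * k) * (cmod (?H \<xi>))\<^sup>2) \<partial>lborel))"
    by (intro mult_left_mono approximant_tail \<rho> c k aliasing) auto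
  also have "\<dots> = ennreal ?K * (?d * (\<integral>\<^sup>+\<xi>. ennreal (norm \<xi> powr (2 * k) * (cmod (?H \<xi>))\<^sup>2) \<partial>lborel))"
    by (simp add: mult.left_commute)
  also have "?d * (\<integral>\<^sup>+\<xi>. ennreal (norm \<xi> powr (2 * k) * (cmod (?H \<xi>))\<^sup>2) \<partial>lborel) =
      (\<integral>\<^sup>+\<omega>. ennreal (norm (h *\<^sub>R \<omega>) powr (2 * k) * (cmod (?H (h *\<^sub>R \<omega>)))\<^sup>2) \<partial>lborel)"
  proof -
    have "(\<lambda>\<xi>. ennreal (norm \<xi> powr (2 * k) * (cmod (?H \<xi>))\<^sup>2)) \<in> borel_measurable borel" by measurable
    from nn_integral_lborel_scale[OF this h] show ?thesis by simp
  qed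
  also have "\<dots> \<le> (\<integral>\<^sup>+\<omega>. ennreal (h powr (2 * k)) * ennreal ((1 + norm \<omega>) powr (2 * k) * (cmod (G \<omega>))\<^sup>2) \<partial>lborel)"
  proof (intro nn_integral_mono)
    fix \<omega> :: "real^'d"
    have "norm \<omega> powr (2 * k) \<le> (1 + norm \<omega>) powr (2 * k)"
      using k by (intro powr_mono2) auto
    then have "norm (h *\<^sub>R \<omega>) powr (2 * k) * (cmod (?H (h *\<^sub>R \<omega>)))\<^sup>2 \<le>
        h powr (2 * k) * ((1 + norm \<omega>) powr (2 * k) * (cmod (G \<omega>))\<^sup>2)"
      using h by (simp add: powr_mult mult.assoc mult_left_mono mult_right_mono)
    then show "ennreal (norm (h *\<^sub>R \<omega>) powr (2 * k) * (cmod (?H (h *\<^sub>R \<omega>)))\<^sup>2) \<le>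
        ennreal (h powr (2 * k)) * ennreal ((1 + norm \<omega>) powr (2 * k) * (cmod (G \<omega>))\<^sup>2)"
      by (subst ennreal_mult[symmetric]) (auto intro: ennreal_leI)
  qed
  also have "\<dots> = ennreal (h powr (2 * k)) * energy k G"
    unfolding energy_def by (rule nn_integral_cmult) measurable
  finally have "(\<integral>\<^sup>+\<omega>. indicator {\<omega>. \<rho> < norm (h *\<^sub>R \<omega>)} \<omega> * ennreal ((cmod (approximant \<rho> c M ?H u (h *\<^sub>R \<omega>)))\<^sup>2) \<partial>lborel)
      \<le> ennreal ?K * (ennreal (h powr (2 * k)) * energy k G)"
    by (simp add: mult_left_mono)
  also have "\<dots> = ennreal (?K * h powr (2 * k)) * energy k G"
    by (subst ennreal_mult) (auto simp: mult.assoc)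
  finally show ?thesis .
qed

text \<open>
  Where \<open>h|\<omega>| \<le> \<rho>\<close> the error is only the truncation in \<open>approximant_inside\<close>. Elsewhere \<open>G\<close> and the
  approximant are estimated separately: for \<open>G\<close> the weight with exponent \<open>2s\<close> is compared with the
  one with exponent \<open>2k\<close>, and for the approximant the weight is replaced by \<open>(\<rho>/h)\<^bsup>2s\<^esup>\<close>.
\<close>

lemma approximation_error:
  fixes G u :: "real^'d::finite \<Rightarrow> complex"
  assumes [measurable]: "G \<in> borel_measurable borel" "u \<in> borel_measurable borel"
    and s: "s \<le> 0" and \<rho>: "0 < \<rho>" "\<rho> < pi" and c: "0 < c" and k: "0 < k" and h: "0 < h"
    and below: "AE \<omega> in lborel. \<omega> \<in> annulus \<rho> \<longrightarrow> c \<le> cmod (u \<omega>)"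
    and aliasing: "\<And>m :: nat. AE \<omega> in lborel. \<omega> \<in> annulus \<rho> \<longrightarrow>
       (\<Sum>\<^sub>\<infinity>\<alpha>\<in>(\<lambda>j. (2 ^ m * (2 * pi)) *\<^sub>R j) ` (int_lattice - {0}). ennreal ((cmod (u (\<omega> + \<alpha>)))\<^sup>2))
         \<le> ennreal (C * 2 powr (- 2 * real m * k))"
  shows "energy s (\<lambda>\<omega>. G \<omega> - approximant \<rho> c M (\<lambda>\<xi>. G (inverse h *\<^sub>R \<xi>)) u (h *\<^sub>R \<omega>)) \<le>
    energy s (\<lambda>\<omega>. if norm (h *\<^sub>R \<omega>) \<le> \<rho> / 2 ^ M \<or> real M < cmod (G \<omega>) then G \<omega> else 0) +
    ennreal ((2 * \<rho> powr (2 * s - 2 * k) + 2 * \<rho> powr (2 * s) * (\<bar>C\<bar> * (2 / \<rho>) powr (2 * k) / c\<^sup>2)) * h powr (2 * (k - s))) * energy k G"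
proof -
  let ?H = "\<lambda>\<xi>. G (inverse h *\<^sub>R \<xi>)"
  let ?K = "\<bar>C\<bar> * (2 / \<rho>) powr (2 * k) / c\<^sup>2"
  let ?a = "approximant \<rho> c M ?H u"
  let ?r = "\<rho> / h"
  let ?g = "\<lambda>\<omega>. if norm (h *\<^sub>R \<omega>) \<le> \<rho> / 2 ^ M \<or> real M < cmod (G \<omega>) then G \<omega> else 0"
  let ?I = "\<lambda>\<omega> :: real^'d. indicator {\<omega>. \<rho> < norm (h *\<^sub>R \<omega>)} \<omega> :: real"
  let ?w = "\<lambda>s (\<omega> :: real^'d). (1 + norm \<omega>) powr (2 * s)"
  have [measurable]: "?a \<in> borel_measurable borel"
    unfolding approximant_def[abs_def]
    by (intro borel_measurable_sum borel_measurable_times measurable_compose[OF cell_rep_borel shell_quotient_borel]) measurable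
  have r: "0 < ?r" using \<rho> h by simp
  have "AE \<omega> in lborel. 2 ^ m *\<^sub>R \<omega> \<in> annulus \<rho> \<longrightarrow> c \<le> cmod (u (2 ^ m *\<^sub>R \<omega>))" for m
    by (rule AE_lborel_scale[OF below]) simp
  then have "AE \<omega> in lborel. \<forall>m. 2 ^ m *\<^sub>R \<omega> \<in> annulus \<rho> \<longrightarrow> c \<le> cmod (u (2 ^ m *\<^sub>R \<omega>))"
    by (simp add: AE_all_countable)
  from AE_lborel_scale[OF this, of h] h
  have "AE \<omega> in lborel. \<forall>m. 2 ^ m *\<^sub>R (h *\<^sub>R \<omega>) \<in> annulus \<rho> \<longrightarrow> c \<le> cmod (u (2 ^ m *\<^sub>R (h *\<^sub>R \<omega>)))"
    by simp
  then have pointwise: "AE \<omega> in lborel. ?w s \<omega> * (cmod (G \<omega> - ?a (h *\<^sub>R \<omega>)))\<^sup>2 \<le>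
      ?w s \<omega> * (cmod (?g \<omega>))\<^sup>2 + (2 * ?r powr (2 * s - 2 * k) * (?w k \<omega> * (cmod (G \<omega>))\<^sup>2)
      + 2 * ?r powr (2 * s) * (?I \<omega> * (cmod (?a (h *\<^sub>R \<omega>)))\<^sup>2))"
  proof eventually_elim
    case (elim \<omega>)
    have GH: "?H (h *\<^sub>R \<omega>) = G \<omega>" using h by simp
    show ?case
    proof (cases "norm (h *\<^sub>R \<omega>) \<le> \<rho>")
      case True
      have "?H (h *\<^sub>R \<omega>) - ?a (h *\<^sub>R \<omega>) =
          (if norm (h *\<^sub>R \<omega>) \<le> \<rho> / 2 ^ M \<or> real M < cmod (?H (h *\<^sub>R \<omega>)) then ?H (h *\<^sub>R \<omega>) else 0)"
        by (rule approximant_inside[OF \<rho> True c]) (use elim in blast)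
      then have "G \<omega> - ?a (h *\<^sub>R \<omega>) = ?g \<omega>" by (simp only: GH)
      moreover have "0 \<le> 2 * ?r powr (2 * s - 2 * k) * (?w k \<omega> * (cmod (G \<omega>))\<^sup>2)"
        "0 \<le> 2 * ?r powr (2 * s) * (?I \<omega> * (cmod (?a (h *\<^sub>R \<omega>)))\<^sup>2)" by auto
      ultimately show ?thesis by (simp only:)
    next
      case False
      then have rw: "?r \<le> norm \<omega>" using h by (simp add: field_simps)
      have "(cmod (G \<omega> - ?a (h *\<^sub>R \<omega>)))\<^sup>2 \<le> 2 * (cmod (G \<omega>))\<^sup>2 + 2 * (cmod (?a (h *\<^sub>R \<omega>)))\<^sup>2"
        using norm_add_square_le[of "G \<omega>" "- ?a (h *\<^sub>R \<omega>)"] by simp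
      then have "?w s \<omega> * (cmod (G \<omega> - ?a (h *\<^sub>R \<omega>)))\<^sup>2 \<le>
          ?w s \<omega> * (2 * (cmod (G \<omega>))\<^sup>2) + ?w s \<omega> * (2 * (cmod (?a (h *\<^sub>R \<omega>)))\<^sup>2)"
        unfolding distrib_left[symmetric] by (rule mult_left_mono) simp
      also have "\<dots> \<le> ?r powr (2 * s - 2 * k) * ?w k \<omega> * (2 * (cmod (G \<omega>))\<^sup>2) + ?r powr (2 * s) * (2 * (cmod (?a (h *\<^sub>R \<omega>)))\<^sup>2)"
        by (intro add_mono mult_right_mono weight_outside_le[OF s k r rw]) auto
      also have "\<dots> = 2 * ?r powr (2 * s - 2 * k) * (?w k \<omega> * (cmod (G \<omega>))\<^sup>2)
          + 2 * ?r powr (2 * s) * (?I \<omega> * (cmod (?a (h *\<^sub>R \<omega>)))\<^sup>2)"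
        using False by simp
      finally show ?thesis by (simp add: add_increasing)
    qed
  qed
  have "energy s (\<lambda>\<omega>. G \<omega> - ?a (h *\<^sub>R \<omega>)) \<le>
      (\<integral>\<^sup>+\<omega>. ennreal (?w s \<omega> * (cmod (?g \<omega>))\<^sup>2) + (ennreal (2 * ?r powr (2 * s - 2 * k)) * ennreal (?w k \<omega> * (cmod (G \<omega>))\<^sup>2)
      + ennreal (2 * ?r powr (2 * s)) * (indicator {\<omega>. \<rho> < norm (h *\<^sub>R \<omega>)} \<omega> * ennreal ((cmod (?a (h *\<^sub>R \<omega>)))\<^sup>2))) \<partial>lborel)"
    unfolding energy_def
  proof (rule nn_integral_mono_AE)
    have split: "ennreal (x + (a * y + b * (?I \<omega> * z))) = ennreal x + (ennreal a * ennreal y + ennreal b * (indicator {\<omega>. \<rho> < norm (h *\<^sub>R \<omega>)} \<omega> * ennreal z))"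
      if "0 \<le> x" "0 \<le> a" "0 \<le> y" "0 \<le> b" "0 \<le> z" for x a y b z \<omega>
      using that by (cases "\<rho> < norm (h *\<^sub>R \<omega>)") (simp_all add: ennreal_plus ennreal_mult)
    show "AE \<omega> in lborel. ennreal (?w s \<omega> * (cmod (G \<omega> - ?a (h *\<^sub>R \<omega>)))\<^sup>2) \<le>
      ennreal (?w s \<omega> * (cmod (?g \<omega>))\<^sup>2) + (ennreal (2 * ?r powr (2 * s - 2 * k)) * ennreal (?w k \<omega> * (cmod (G \<omega>))\<^sup>2)
      + ennreal (2 * ?r powr (2 * s)) * (indicator {\<omega>. \<rho> < norm (h *\<^sub>R \<omega>)} \<omega> * ennreal ((cmod (?a (h *\<^sub>R \<omega>)))\<^sup>2)))"
      using pointwise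
    proof eventually_elim
      case (elim \<omega>)
      from ennreal_leI[OF this] show ?case
        by (subst (asm) split) simp_all
    qed
  qed
  also have "\<dots> = energy s ?g + (ennreal (2 * ?r powr (2 * s - 2 * k)) * energy k G +
      ennreal (2 * ?r powr (2 * s)) * (\<integral>\<^sup>+\<omega>. indicator {\<omega>. \<rho> < norm (h *\<^sub>R \<omega>)} \<omega> * ennreal ((cmod (?a (h *\<^sub>R \<omega>)))\<^sup>2) \<partial>lborel))"
    unfolding energy_def by (simp add: nn_integral_add nn_integral_cmult)
  also have "\<dots> \<le> energy s ?g + (ennreal (2 * ?r powr (2 * s - 2 * k)) * energy k G +
      ennreal (2 * ?r powr (2 * s)) * (ennreal (?K * h powr (2 * k)) * energy k G))"
    by (intro add_mono order_refl mult_left_mono scaled_approximant_tail \<rho> c k h aliasing) auto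
  also have "\<dots> = energy s ?g + ennreal (2 * ?r powr (2 * s - 2 * k) + 2 * ?r powr (2 * s) * (?K * h powr (2 * k))) * energy k G"
  proof -
    have combine: "ennreal a * e + ennreal b * (ennreal b' * e) = ennreal (a + b * b') * e"
      if "0 \<le> a" "0 \<le> b" "0 \<le> b'" for a b b' :: real and e :: ennreal
      using that by (simp add: ennreal_plus ennreal_mult distrib_right mult.assoc)
    show ?thesis by (subst combine) simp_all
  qed
  also have "2 * ?r powr (2 * s - 2 * k) + 2 * ?r powr (2 * s) * (?K * h powr (2 * k)) =
      (2 * \<rho> powr (2 * s - 2 * k) + 2 * \<rho> powr (2 * s) * ?K) * h powr (2 * (k - s))"
  proof -
    have r_powr: "?r powr e = \<rho> powr e * h powr (- e)" for e
      using \<rho> h by (simp add: powr_divide powr_minus_divide)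
    have "- (2 * s - 2 * k) = 2 * (k - s)" by simp
    then have "?r powr (2 * s - 2 * k) = \<rho> powr (2 * s - 2 * k) * h powr (2 * (k - s))"
      by (simp only: r_powr)
    moreover have "h powr (- (2 * s)) * h powr (2 * k) = h powr (2 * (k - s))"
      by (simp add: algebra_simps flip: powr_add)
    then have "?r powr (2 * s) * h powr (2 * k) = \<rho> powr (2 * s) * h powr (2 * (k - s))"
      by (simp only: r_powr mult.assoc)
    ultimately show ?thesis by (simp add: algebra_simps)
  qed
  finally show ?thesis .
qed

text \<open>
  For fixed \<open>\<omega> \<noteq> 0\<close> both truncation conditions fail for large \<open>M\<close>, and the origin is a null set.
\<close>

lemma truncation_tendsto:
  fixes G :: "real^'d::finite \<Rightarrow> complex"
  assumes [measurable]: "G \<in> borel_measurable borel" and fin: "energy s G < \<infinity>" and h: "0 < h"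
  shows "(\<lambda>M. energy s (\<lambda>\<omega>. if norm (h *\<^sub>R \<omega>) \<le> \<rho> / 2 ^ M \<or> real M < cmod (G \<omega>) then G \<omega> else 0)) \<longlonglongrightarrow> 0"
proof -
  let ?g = "\<lambda>M \<omega>. if norm (h *\<^sub>R \<omega>) \<le> \<rho> / 2 ^ M \<or> real M < cmod (G \<omega>) then G \<omega> else 0"
  have "(\<lambda>M. energy s (\<lambda>\<omega>. ?g M \<omega> - 0)) \<longlonglongrightarrow> 0"
  proof (rule energy_dominated_tendsto[where w = G])
    have "AE \<omega> in lborel. \<omega> \<noteq> (0 :: real^'d)" by (rule AE_lborel_singleton)
    then show "AE \<omega> in lborel. (\<lambda>M. ?g M \<omega>) \<longlonglongrightarrow> 0"
    proof eventually_elim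
      case (elim \<omega>)
      then have pos: "0 < norm (h *\<^sub>R \<omega>)" using h by simp
      have "(\<lambda>M. \<rho> / 2 ^ M) \<longlonglongrightarrow> 0" by real_asymp
      from order_tendstoD(2)[OF this pos]
      have "\<forall>\<^sub>F M in sequentially. \<rho> / 2 ^ M < norm (h *\<^sub>R \<omega>)" .
      moreover obtain N :: nat where "cmod (G \<omega>) \<le> real N" using real_arch_simple by blast
      then have "\<forall>\<^sub>F M in sequentially. cmod (G \<omega>) \<le> real M"
        by (intro eventually_sequentiallyI[of N]) (simp add: order_trans)
      ultimately have "\<forall>\<^sub>F M in sequentially. ?g M \<omega> = 0"
        by eventually_elim auto
      then show ?case by (rule tendsto_eventually)
    qed
    show "AE \<omega> in lborel. cmod (?g M \<omega> - 0) \<le> cmod (G \<omega>)" for M by auto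
    show "energy s G < \<infinity>" by (rule fin)
  qed measurable
  then show ?thesis by simp
qed

lemma sobolev_norm_nonneg: "0 \<le> sobolev_norm s T"
  by (simp add: sobolev_norm_def)

text \<open>
  Elements of the shift-invariant space have transforms arbitrarily close to \<open>a\<close> up to the factor
  \<open>h\<^sup>d\<close> that dilation introduces, and dilation is bounded for \<open>s \<le> 0\<close>. The factor 2 comes from the
  triangle inequality for squared norms.
\<close>

lemma distance_to_dilate_le:
  fixes \<Phi> :: "('d::finite functional)^'r::finite"
  assumes \<Phi>: "\<And>i. \<Phi> $ i \<in> sobolev s" and s: "s \<le> 0" "s \<le> k"
    and F: "F \<in> sobolev k" and h: "0 < h"
    and a: "a \<in> spectral_space s \<Phi>"
  shows "ennreal ((INF g\<in>dilate h ` shift_inv_space s \<Phi>. sobolev_norm s (\<lambda>\<phi>. F \<phi> - g \<phi>))\<^sup>2)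
    \<le> 2 * energy s (\<lambda>\<omega>. fhat F \<omega> - a (h *\<^sub>R \<omega>))"
proof -
  let ?X = "spectral_space s \<Phi>" and ?D = "of_real (h ^ CARD('d)) :: complex"
  let ?I = "INF g\<in>dilate h ` shift_inv_space s \<Phi>. sobolev_norm s (\<lambda>\<phi>. F \<phi> - g \<phi>)"
  have X: "modulation_space s ?X" by (rule modulation_space_spectral_space[OF \<Phi>])
  have [measurable]: "a \<in> borel_measurable borel" by (rule modulation_space_borel[OF X a])
  have [measurable]: "fhat F \<in> borel_measurable borel" by (rule sobolev_borel[OF F])
  have "(\<lambda>\<omega>. inverse ?D * a \<omega> + 0 * a \<omega>) \<in> ?X"
    using a by (intro modulation_space_lincomb[OF X])
  then have "(\<lambda>\<omega>. inverse ?D * a \<omega>) \<in> ?X" by simp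
  then obtain T where T: "\<And>n. T n \<in> shift_inv_space s \<Phi>"
    and lim: "(\<lambda>n. energy s (\<lambda>\<omega>. fhat (T n) \<omega> - inverse ?D * a \<omega>)) \<longlonglongrightarrow> 0"
    unfolding spectral_space_def by blast
  have sob: "T n \<in> sobolev s" for n
    using shift_inv_space_subset_sobolev[OF \<Phi>] T by blast
  have [measurable]: "fhat (T n) \<in> borel_measurable borel" for n by (rule sobolev_borel[OF sob])
  have lim': "(\<lambda>n. energy s (\<lambda>\<omega>. fhat (T n) (h *\<^sub>R \<omega>) - inverse ?D * a (h *\<^sub>R \<omega>))) \<longlonglongrightarrow> 0"
    by (rule energy_scale_tendsto[OF _ _ h s(1) lim]) measurable
  have bound: "ennreal (?I\<^sup>2) \<le> 2 * energy s (\<lambda>\<omega>. fhat F \<omega> - a (h *\<^sub>R \<omega>)) +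
      2 * (ennreal ((cmod ?D)\<^sup>2) * energy s (\<lambda>\<omega>. fhat (T n) (h *\<^sub>R \<omega>) - inverse ?D * a (h *\<^sub>R \<omega>)))" for n
  proof -
    have "energy s (\<lambda>\<omega>. fhat (T n) (h *\<^sub>R \<omega>)) \<le>
        ennreal (inverse h ^ CARD('d) * max 1 h powr (- 2 * s)) * energy s (fhat (T n))"
      by (rule energy_scale[OF _ h s(1)]) measurable
    also have "\<dots> < \<infinity>"
      using sobolev_energy[OF sob[of n]] by (simp add: ennreal_mult_less_top)
    finally have "energy s (\<lambda>\<omega>. 1 * fhat F \<omega> + (- ?D) * fhat (T n) (h *\<^sub>R \<omega>)) < \<infinity>"
      using le_less_trans[OF energy_mono_order[OF s(2)] sobolev_energy[OF F]]
      by (intro energy_lincomb_finite) measurable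
    then have fin: "energy s (\<lambda>\<omega>. fhat F \<omega> - ?D * fhat (T n) (h *\<^sub>R \<omega>)) < top" by simp
    have "has_fourier (\<lambda>\<phi>. 1 * F \<phi> + (-1) * dilate h (T n) \<phi>) (\<lambda>\<omega>. 1 * fhat F \<omega> + (-1) * (?D * fhat (T n) (h *\<^sub>R \<omega>)))"
      by (intro has_fourier_lincomb has_fourier_dilate sobolev_has_fourier[OF F] sobolev_has_fourier[OF sob] h)
    then have HF: "has_fourier (\<lambda>\<phi>. F \<phi> - dilate h (T n) \<phi>) (\<lambda>\<omega>. fhat F \<omega> - ?D * fhat (T n) (h *\<^sub>R \<omega>))"
      by simp
    have "bdd_below ((\<lambda>g. sobolev_norm s (\<lambda>\<phi>. F \<phi> - g \<phi>)) ` (dilate h ` shift_inv_space s \<Phi>))"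
      by (intro bdd_belowI[of _ 0]) (auto simp: sobolev_norm_nonneg)
    then have "?I \<le> sobolev_norm s (\<lambda>\<phi>. F \<phi> - dilate h (T n) \<phi>)"
      by (rule cINF_lower) (use T in blast)
    moreover have "0 \<le> ?I"
      by (rule cINF_greatest) (use T in \<open>auto simp: sobolev_norm_nonneg\<close>)
    ultimately have "ennreal (?I\<^sup>2) \<le> ennreal ((sobolev_norm s (\<lambda>\<phi>. F \<phi> - dilate h (T n) \<phi>))\<^sup>2)"
      by (intro ennreal_leI power_mono)
    also have "\<dots> = energy s (\<lambda>\<omega>. fhat F \<omega> - ?D * fhat (T n) (h *\<^sub>R \<omega>))"
      using fin by (simp add: sobolev_norm_eq_energy[OF HF])
    also have "\<dots> \<le> 2 * energy s (\<lambda>\<omega>. fhat F \<omega> - a (h *\<^sub>R \<omega>)) + 2 * energy s (\<lambda>\<omega>. a (h *\<^sub>R \<omega>) - ?D * fhat (T n) (h *\<^sub>R \<omega>))"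
      by (rule energy_diff_triangle) measurable
    also have "energy s (\<lambda>\<omega>. a (h *\<^sub>R \<omega>) - ?D * fhat (T n) (h *\<^sub>R \<omega>)) =
        energy s (\<lambda>\<omega>. ?D * (fhat (T n) (h *\<^sub>R \<omega>) - inverse ?D * a (h *\<^sub>R \<omega>)))"
      using h by (subst energy_minus_commute) (simp add: algebra_simps)
    also have "\<dots> = ennreal ((cmod ?D)\<^sup>2) * energy s (\<lambda>\<omega>. fhat (T n) (h *\<^sub>R \<omega>) - inverse ?D * a (h *\<^sub>R \<omega>))"
      by (rule energy_cmult) measurable
    finally show ?thesis .
  qed
  have "(\<lambda>n. 2 * energy s (\<lambda>\<omega>. fhat F \<omega> - a (h *\<^sub>R \<omega>)) +
      2 * (ennreal ((cmod ?D)\<^sup>2) * energy s (\<lambda>\<omega>. fhat (T n) (h *\<^sub>R \<omega>) - inverse ?D * a (h *\<^sub>R \<omega>)))) \<longlonglongrightarrow>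
      2 * energy s (\<lambda>\<omega>. fhat F \<omega> - a (h *\<^sub>R \<omega>)) + 2 * (ennreal ((cmod ?D)\<^sup>2) * 0)"
    by (intro tendsto_add tendsto_const ennreal_tendsto_cmult lim') auto
  then have "(\<lambda>n. 2 * energy s (\<lambda>\<omega>. fhat F \<omega> - a (h *\<^sub>R \<omega>)) +
      2 * (ennreal ((cmod ?D)\<^sup>2) * energy s (\<lambda>\<omega>. fhat (T n) (h *\<^sub>R \<omega>) - inverse ?D * a (h *\<^sub>R \<omega>)))) \<longlonglongrightarrow>
      2 * energy s (\<lambda>\<omega>. fhat F \<omega> - a (h *\<^sub>R \<omega>))" by simp
  then show ?thesis
    by (rule LIMSEQ_le_const) (use bound in blast)
qed

theorem theorem35:
  fixes s k \<rho> :: real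
    and P :: "real^'d \<Rightarrow> complex^'r^'r"
    and \<Phi> :: "('d::finite functional)^'r::finite"
    and f :: "'d functional"
  assumes "s \<le> 0"
    and "\<And>i j. (\<lambda>\<omega>. P \<omega> $ i $ j) \<in> borel_measurable lebesgue"
    and "\<And>i j. periodic_2pi (\<lambda>\<omega>. P \<omega> $ i $ j)"
    and "\<And>i. \<Phi> $ i \<in> sobolev s"
    and "AE \<omega> in lborel.
           (\<chi> i. fhat (\<Phi> $ i) (2 *\<^sub>R \<omega>)) = P \<omega> *v (\<chi> i. fhat (\<Phi> $ i) \<omega>)"
    and "0 < \<rho>" and "\<rho> < pi"
    and "f \<in> shift_inv_space s \<Phi>"
    and "\<exists>c C. 0 < c \<and>
           (AE \<omega> in lborel. \<omega> \<in> annulus \<rho> \<longrightarrow>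
              c \<le> cmod (fhat f \<omega>) \<and> cmod (fhat f \<omega>) \<le> C)"
    and "0 < k"
    and "\<exists>C::real. \<forall>m::nat. lambda_num \<rho> f m \<le> ennreal (C * 2 powr (- 2 * real m * k))"
  shows "provides_approx_order s \<Phi> k"
proof -
  note s = assms(1) and \<Phi> = assms(4) and \<rho> = assms(6,7) and k = \<open>0 < k\<close>
  let ?X = "spectral_space s \<Phi>" and ?u = "fhat f"
  have X: "modulation_space s ?X" by (rule modulation_space_spectral_space[OF \<Phi>])
  have sk: "s \<le> k" using s k by simp
  have uX: "?u \<in> ?X" by (rule spectral_space_fhat[OF \<Phi> assms(8)])
  have u: "?u \<in> borel_measurable borel" by (rule modulation_space_borel[OF X uX])
  have uX': "(\<lambda>\<omega>. ?u (2 ^ m *\<^sub>R \<omega>)) \<in> ?X" for m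
    by (rule spectral_space_dilate_power_two[OF s \<Phi> spectral_space_refined_generator[OF assms(1-5)] uX])
  obtain c where c: "0 < c" and below: "AE \<omega> in lborel. \<omega> \<in> annulus \<rho> \<longrightarrow> c \<le> cmod (?u \<omega>)"
  proof -
    obtain c C where "0 < c" and *: "AE \<omega> in lborel. \<omega> \<in> annulus \<rho> \<longrightarrow> c \<le> cmod (?u \<omega>) \<and> cmod (?u \<omega>) \<le> C"
      using assms(9) by blast
    from * have "AE \<omega> in lborel. \<omega> \<in> annulus \<rho> \<longrightarrow> c \<le> cmod (?u \<omega>)"
      by eventually_elim simp
    with \<open>0 < c\<close> show thesis by (rule that)
  qed
  obtain C where C: "\<And>m :: nat. lambda_num \<rho> f m \<le> ennreal (C * 2 powr (- 2 * real m * k))"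
    using assms(11) by blast
  have aliasing: "AE \<omega> in lborel. \<omega> \<in> annulus \<rho> \<longrightarrow>
       (\<Sum>\<^sub>\<infinity>\<alpha>\<in>(\<lambda>j. (2 ^ m * (2 * pi)) *\<^sub>R j) ` (int_lattice - {0}). ennreal ((cmod (?u (\<omega> + \<alpha>)))\<^sup>2))
         \<le> ennreal (C * 2 powr (- 2 * real m * k))" for m :: nat
  proof -
    have "AE \<omega> in restrict_space lborel (annulus \<rho>).
       (\<Sum>\<^sub>\<infinity>\<alpha>\<in>(\<lambda>j. (2 ^ m * (2 * pi)) *\<^sub>R j) ` (int_lattice - {0}). ennreal ((cmod (?u (\<omega> + \<alpha>)))\<^sup>2)) \<le> lambda_num \<rho> f m"
      unfolding lambda_num_def by (rule esssup_AE)
    then show ?thesis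
      using C[of m] by (subst (asm) AE_restrict_space_iff) (auto elim!: eventually_mono intro: order_trans)
  qed
  define K where "K = 2 * \<rho> powr (2 * s - 2 * k) + 2 * \<rho> powr (2 * s) * (\<bar>C\<bar> * (2 / \<rho>) powr (2 * k) / c\<^sup>2)"
  have K: "0 \<le> K" by (simp add: K_def)
  have main: "(INF g\<in>dilate h ` shift_inv_space s \<Phi>. sobolev_norm s (\<lambda>\<phi>. F \<phi> - g \<phi>)) \<le>
      sqrt (2 * K) * h powr (k - s) * sobolev_norm k F" if F: "F \<in> sobolev k" and h: "0 < h" for F h
  proof -
    let ?I = "INF g\<in>dilate h ` shift_inv_space s \<Phi>. sobolev_norm s (\<lambda>\<phi>. F \<phi> - g \<phi>)"
    let ?G = "fhat F"
    let ?a = "\<lambda>M. approximant \<rho> c M (\<lambda>\<xi>. ?G (inverse h *\<^sub>R \<xi>)) ?u"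
    let ?g = "\<lambda>M \<omega>. if norm (h *\<^sub>R \<omega>) \<le> \<rho> / 2 ^ M \<or> real M < cmod (?G \<omega>) then ?G \<omega> else 0"
    have G[measurable]: "?G \<in> borel_measurable borel" by (rule sobolev_borel[OF F])
    have fin: "energy k ?G < \<infinity>" by (rule sobolev_energy[OF F])
    then have fin': "energy s ?G < \<infinity>" using energy_mono_order[OF sk] by (rule le_less_trans[rotated])
    have "ennreal (?I\<^sup>2) \<le> 2 * (energy s (?g M) + ennreal (K * h powr (2 * (k - s))) * energy k ?G)" for M
    proof -
      have "?a M \<in> ?X"
        by (rule approximant_in_modulation_space[OF X spectral_space_zero[OF \<Phi>] c _ u uX']) measurable
      then have "ennreal (?I\<^sup>2) \<le> 2 * energy s (\<lambda>\<omega>. ?G \<omega> - ?a M (h *\<^sub>R \<omega>))"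
        by (rule distance_to_dilate_le[OF \<Phi> s sk F h])
      also have "\<dots> \<le> 2 * (energy s (?g M) + ennreal (K * h powr (2 * (k - s))) * energy k ?G)"
        unfolding K_def
        by (intro mult_left_mono approximation_error[OF G u s \<rho> c k h below aliasing]) auto
      finally show ?thesis .
    qed
    moreover have "(\<lambda>M. 2 * (energy s (?g M) + ennreal (K * h powr (2 * (k - s))) * energy k ?G)) \<longlonglongrightarrow>
        2 * (0 + ennreal (K * h powr (2 * (k - s))) * energy k ?G)"
      by (intro ennreal_tendsto_cmult tendsto_add tendsto_const truncation_tendsto G fin' h) auto
    ultimately have "ennreal (?I\<^sup>2) \<le> 2 * (0 + ennreal (K * h powr (2 * (k - s))) * energy k ?G)"
      by (intro LIMSEQ_le_const) auto
    also have "energy k ?G = ennreal ((sobolev_norm k F)\<^sup>2)"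
      using fin by (simp add: sobolev_norm_eq_energy[OF sobolev_has_fourier[OF F]])
    also have "2 * (0 + ennreal (K * h powr (2 * (k - s))) * ennreal ((sobolev_norm k F)\<^sup>2)) =
        ennreal (2 * (K * h powr (2 * (k - s)) * (sobolev_norm k F)\<^sup>2))"
      using K by (simp add: ennreal_mult)
    finally have "?I\<^sup>2 \<le> 2 * (K * h powr (2 * (k - s)) * (sobolev_norm k F)\<^sup>2)"
      using K by (simp add: ennreal_le_iff)
    also have "\<dots> = (sqrt (2 * K) * h powr (k - s) * sobolev_norm k F)\<^sup>2"
    proof -
      have "(h powr (k - s))\<^sup>2 = h powr (2 * (k - s))"
        by (simp only: power2_eq_square powr_add[symmetric] mult_2)
      then show ?thesis using K by (simp add: power_mult_distrib)
    qed
    finally show ?thesis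
      by (rule power2_le_imp_le) (auto intro!: mult_nonneg_nonneg K sobolev_norm_nonneg)
  qed
  then show ?thesis
    unfolding provides_approx_order_def by blast
qed

end
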